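(* Let $R$ be a commutative ring. Every motivic measure $\mu:K_0(\mathbf{Var}^{tor}_{\mathbb{F}_1})\to R$ (that is, every ring morphism) is exponentiable and rational.
   Context: A torification of a complex algebraic variety $X$ defined over $\mathbb{Z}$ is a decomposition $X=\sqcup_{i\in I}T_i$ into algebraic tori $T_i\simeq\mathbb{G}_m^{d_i}$. A strong morphism $X=\sqcup_{i\in I} T_i\to Y=\sqcup_{j\in J}T'_j$ of torified varieties is a morphism of varieties $f:X\to Y$ defined over $\mathbb{Z}$ with a map $h:I\to J$ such that each restriction $f|_{T_i}:T_i\to T'_{h(i)}$ is a morphism of algebraic groups. $K_0(\mathbf{Var}^{tor}_{\mathbb{F}_1})$ is the Grothendieck ring generated by strong isomorphism classes of torified varieties modulo the relations $[X=\sqcup_i T_i]=[Y=\sqcup_jT'_j]+[X\setminus Y=\sqcup_kT''_k]$ whenever the tori in the torifications of $Y$ and of $X\setminus Y$ together form the tori of the torification of $X$. It is identified with the polynomial ring $\mathbb{Z}[\mathbb{T}]=\mathbb{Z}[\mathbb{L}]\subset K_0(\mathbf{Var}_{\mathbb{C}})$, where $\mathbb{L}=[\mathbb{A}^1]$ and $\mathbb{T}=[\mathbb{G}_m]=\mathbb{L}-1$. For a commutative ring $A$, $\mathbb{W}(A)$ is the set $1+tA[[t]]$ with addition given by multiplication of power series and with multiplication $\ast$ determined functorially by $(1-at)^{-1}\ast(1-bt)^{-1}=(1-abt)^{-1}$ (the big Witt ring). Kapranov's motivic zeta function $[X]\mapsto 1+[X]t+[S^2X]t^2+\cdots$ ($S^nX$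 the $n$-th symmetric product) restricts to a $\lambda$-ring structure $\lambda_t:\mathbb{Z}[\mathbb{L}]\to\mathbb{W}(\mathbb{Z}[\mathbb{L}])$, the ring morphism with $\lambda_t(\mathbb{L}^i)=(1-\mathbb{L}^it)^{-1}$; write $\lambda_t(a)=\sum_n S^n(a)t^n$. A motivic measure $\mu:\mathbb{Z}[\mathbb{L}]\to R$ is exponentiable if the map $\zeta_\mu:\mathbb{Z}[\mathbb{L}]\to\mathbb{W}(R)$, $\zeta_\mu(a)=\sum_{n\geq0}\mu(S^n(a))t^n$, is a ring morphism. It is rational if it is exponentiable and there is a unique ring morphism $r_\mu:\mathbb{Z}[\mathbb{L}]\to\mathbb{W}_0(R)$ with $\zeta_\mu=L_R\circ r_\mu$. Here $\mathbb{W}_0(R)$ is the quotient of the Grothendieck ring $K_0(\mathcal{E}_R)$ by the ideal consisting of the pairs $(E,0)$, with $\mathcal{E}_R$ the category of pairs $(E,f)$, $E$ a projective $R$-module of finite rank and $f\in End_R(E)$ (relations from short exact sequences, sum induced by $\oplus$, product by $\otimes$). The map $L_R:\mathbb{W}_0(R)\to\mathbb{W}(R)$, $L_R(E,f)=\det(1-tM_f)^{-1}$ with $M_f$ the matrix of $f$, is an injective ring morphism with image all quotients $\frac{1+a_1t+\cdots+a_nt^n}{1+b_1t+\cdots+b_mt^m}$, $a_i,b_i\in R$. *)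

theory Defs
  imports
    "Jordan_Normal_Form.VS_Connect"
    "HOL-Algebra.QuotRing"
    "HOL-Algebra.Generated_Groups"
    "HOL-Computational_Algebra.Formal_Power_Series"
    "HOL-Library.Poly_Mapping"
begin

hide_const (open) Multiset.mult Modules.module_hom Ring_Hom.ring_hom Module.submodule

section \<open>The big Witt ring\<close>

text \<open>The series with constant coefficient 1 are invertible over every commutative ring;
  \<open>fps_inv1 f\<close> is the power series \<open>1 / f\<close>, i.e. the additive inverse of \<open>f\<close> in the Witt ring.\<close>

abbreviation fps_inv1 :: "'a::comm_ring_1 fps \<Rightarrow> 'a fps" where
  "fps_inv1 f \<equiv> fps_right_inverse f 1"

text \<open>Integer powers of a power series, i.e. integer multiples in the Witt ring.\<close>

definition fps_int_pow :: "'a::comm_ring_1 fps \<Rightarrow> int \<Rightarrow> 'a fps" where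
  "fps_int_pow f k = (if k \<ge> 0 then f ^ nat k else fps_inv1 f ^ nat (- k))"

text \<open>Every \<open>f\<close> with constant coefficient 1 is uniquely of the form
  \<open>f = (\<Prod>n\<ge>1. 1 / (1 - x\<^sub>n t\<^sup>n))\<close>. Since multiplying \<open>f\<close> by \<open>1 - x\<^sub>d t\<^sup>d\<close> for all
  \<open>1 \<le> d < n\<close> leaves a series \<open>1 + x\<^sub>n t\<^sup>n + \<dots>\<close>, the \<open>x\<^sub>n\<close> are given by the
  following recursion (only indices \<open>n \<ge> 1\<close> are meaningful).\<close>

fun witt_coord :: "'a::comm_ring_1 fps \<Rightarrow> nat \<Rightarrow> 'a" where
  "witt_coord f n =
     fps_nth (f * (\<Prod>d\<in>{1..<n}. 1 - fps_const (witt_coord f d) * fps_X ^ d)) n"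

declare witt_coord.simps [simp del]

text \<open>The product is biadditive and continuous, and
  \<open>1 / (1 - a t\<^sup>m) \<^bold>* 1 / (1 - b t\<^sup>n) = (1 / (1 - a\<^bsup>n/d\<^esup> b\<^bsup>m/d\<^esup> t\<^bsup>mn/d\<^esup>))\<^sup>d\<close> with \<open>d = gcd m n\<close>.
  The latter follows from the case \<open>m = n = 1\<close> by functoriality: adjoin an \<open>m\<close>-th root \<open>\<alpha>\<close> of \<open>a\<close>,
  an \<open>n\<close>-th root \<open>\<beta>\<close> of \<open>b\<close>, and roots of unity, and multiply out the product over all pairs of
  the factors \<open>1 - \<zeta> \<alpha> t\<close> of \<open>1 - a t\<^sup>m\<close> and \<open>1 - \<xi> \<beta> t\<close> of \<open>1 - b t\<^sup>n\<close>. Factors with \<open>m > N\<close> or \<open>n > N\<close> do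
  not contribute to the coefficient of \<open>t\<^sup>N\<close>.\<close>

definition witt_mult :: "'a::comm_ring_1 fps \<Rightarrow> 'a fps \<Rightarrow> 'a fps" where
  "witt_mult f g = Abs_fps (\<lambda>N. fps_nth
     (\<Prod>m\<in>{1..N}. \<Prod>n\<in>{1..N}.
        fps_inv1 (1 - fps_const (witt_coord f m ^ (n div gcd m n) * witt_coord g n ^ (m div gcd m n))
                      * fps_X ^ lcm m n) ^ gcd m n) N)"

text \<open>Two facts pinning down \<^const>\<open>witt_mult\<close>: its value on the series \<open>1 / (1 - a t)\<close> and
  functoriality.\<close>

lemma fps_inv1_mult: "fps_nth f 0 = 1 \<Longrightarrow> f * fps_inv1 f = (1 :: 'a::comm_ring_1 fps)"
  by (rule fps_right_inverse) simp

lemma fps_inv1_unique: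
  fixes f g :: "'a::comm_ring_1 fps"
  assumes "f * g = 1" "fps_nth f 0 = 1"
  shows "fps_inv1 f = g"
proof -
  have "fps_inv1 f = (f * g) * fps_inv1 f" using assms by simp
  also have "\<dots> = g * (f * fps_inv1 f)" by (simp add: mult_ac)
  finally show ?thesis using fps_inv1_mult[OF assms(2)] by simp
qed

lemma witt_coord_geometric:
  fixes a :: "'a::comm_ring_1"
  defines "f \<equiv> fps_inv1 (1 - fps_const a * fps_X)"
  shows "n \<ge> 1 \<Longrightarrow> witt_coord f n = (if n = 1 then a else 0)"
proof (induction n rule: less_induct)
  case (less n)
  have f: "(1 - fps_const a * fps_X) * f = 1"
    unfolding f_def by (rule fps_inv1_mult) simp
  show ?case
  proof (cases "n = 1")
    case True
    have "fps_nth ((1 - fps_const a * fps_X) * f) 1 = 0" using f by simp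
    moreover have "fps_nth f 0 = 1" by (simp add: f_def)
    ultimately have "fps_nth f 1 = a" by (simp add: left_diff_distrib mult.assoc)
    then show ?thesis using True by (simp add: witt_coord.simps[of f "Suc 0"])
  next
    case False
    have "(\<Prod>d\<in>{1..<n}. 1 - fps_const (witt_coord f d) * fps_X ^ d)
          = (\<Prod>d\<in>{1..<n}. if d = 1 then 1 - fps_const a * fps_X else 1)"
      using less.IH by (intro prod.cong) auto
    also have "\<dots> = 1 - fps_const a * fps_X" using False less.prems by simp
    finally have "witt_coord f n = fps_nth (f * (1 - fps_const a * fps_X)) n"
      by (subst witt_coord.simps) simp
    also have "\<dots> = 0" using f False less.prems by (simp add: mult.commute)
    finally show ?thesis using False by simp
  qed
qed

lemma witt_mult_geometric:
  fixes a b :: "'a::comm_ring_1"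
  shows "witt_mult (fps_inv1 (1 - fps_const a * fps_X)) (fps_inv1 (1 - fps_const b * fps_X))
         = fps_inv1 (1 - fps_const (a * b) * fps_X)" (is "witt_mult ?f ?g = ?h")
proof (rule fps_ext)
  fix N
  let ?t = "\<lambda>m n. fps_inv1 (1 - fps_const (witt_coord ?f m ^ (n div gcd m n)
                                         * witt_coord ?g n ^ (m div gcd m n))
                      * fps_X ^ lcm m n) ^ gcd m n"
  have one: "fps_inv1 (1 :: 'a fps) = 1" by (rule fps_inv1_unique) auto
  have t: "?t m n = (if m = 1 then if n = 1 then ?h else 1 else 1)" if "m \<ge> 1" "n \<ge> 1" for m n
  proof -
    have pos: "n div gcd m n > 0" "m div gcd m n > 0" using that
      by (auto simp: div_greater_zero_iff dvd_imp_le)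
    show ?thesis
      using pos that one
      by (auto simp: witt_coord_geometric[OF that(1)] witt_coord_geometric[OF that(2)] zero_power
               simp del: fps_const_mult)
  qed
  have "fps_nth (witt_mult ?f ?g) N = fps_nth (\<Prod>m\<in>{1..N}. \<Prod>n\<in>{1..N}. ?t m n) N"
    by (simp add: witt_mult_def)
  also have "(\<Prod>m\<in>{1..N}. \<Prod>n\<in>{1..N}. ?t m n)
             = (\<Prod>m\<in>{1..N}. \<Prod>n\<in>{1..N}. if m = 1 then if n = 1 then ?h else 1 else 1)"
    by (intro prod.cong refl t) auto
  also have "\<dots> = (\<Prod>m\<in>{1..N}. if m = 1 then (\<Prod>n\<in>{1..N}. if n = 1 then ?h else 1) else 1)"
    by (intro prod.cong) auto
  also have "fps_nth \<dots> N = fps_nth ?h N"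
    by (cases "N = 0") (simp_all add: prod.delta)
  finally show "fps_nth (witt_mult ?f ?g) N = fps_nth ?h N" .
qed

context
  fixes h :: "'a::comm_ring_1 \<Rightarrow> 'b::comm_ring_1"
  assumes h: "comm_ring_hom h"
begin

interpretation comm_ring_hom h by (fact h)

private definition H :: "'a fps \<Rightarrow> 'b fps" where "H f = Abs_fps (\<lambda>n. h (fps_nth f n))"

private lemma H_simps:
  "H 1 = 1" "H (f * g) = H f * H g" "H (f - g) = H f - H g" "H fps_X = fps_X"
  "H (fps_const c) = fps_const (h c)" "fps_nth (H f) n = h (fps_nth f n)"
  by (auto simp: H_def fps_eq_iff fps_mult_nth hom_distribs fps_X_def)

private lemma H_power: "H (f ^ n) = H f ^ n"
  by (induction n) (auto simp: H_simps)

private lemma H_prod: "H (\<Prod>x\<in>A. F x) = (\<Prod>x\<in>A. H (F x))"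
  by (induction A rule: infinite_finite_induct) (auto simp: H_simps)

private lemma H_inv1: "fps_nth f 0 = 1 \<Longrightarrow> H (fps_inv1 f) = fps_inv1 (H f)"
proof (rule sym, rule fps_inv1_unique)
  assume "fps_nth f 0 = 1"
  then show "H f * H (fps_inv1 f) = 1" "fps_nth (H f) 0 = 1"
    by (simp_all only: H_simps(2)[symmetric] fps_inv1_mult H_simps(1,6) hom_one)
qed

private lemma H_coord: "witt_coord (H f) n = h (witt_coord f n)"
proof (induction n rule: less_induct)
  case (less n)
  have "witt_coord (H f) n
        = fps_nth (H f * (\<Prod>d\<in>{1..<n}. 1 - fps_const (h (witt_coord f d)) * fps_X ^ d)) n"
    using less.IH by (subst witt_coord.simps) (auto intro!: arg_cong2[where f = fps_nth] prod.cong)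
  also have "\<dots> = fps_nth (H (f * (\<Prod>d\<in>{1..<n}. 1 - fps_const (witt_coord f d) * fps_X ^ d))) n"
    by (simp add: H_simps H_prod H_power)
  also have "\<dots> = h (witt_coord f n)"
    by (subst (2) witt_coord.simps) (simp only: H_simps(6))
  finally show ?case .
qed

lemma witt_mult_functorial:
  "Abs_fps (\<lambda>n. h (fps_nth (witt_mult f g) n))
   = witt_mult (Abs_fps (\<lambda>n. h (fps_nth f n))) (Abs_fps (\<lambda>n. h (fps_nth g n)))"
proof -
  have "H (witt_mult f g) = witt_mult (H f) (H g)"
  proof (rule fps_ext)
    fix N
    have nz: "m \<in> {1..N} \<Longrightarrow> n \<in> {1..N} \<Longrightarrow>
        fps_nth (1 - fps_const c * fps_X ^ lcm m n) 0 = (1::'a)" for m n c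
      by auto
    show "fps_nth (H (witt_mult f g)) N = fps_nth (witt_mult (H f) (H g)) N"
      unfolding witt_mult_def H_simps(6) fps_nth_Abs_fps
      unfolding H_simps(6)[symmetric] H_prod H_power
      by (intro arg_cong2[where f = fps_nth] prod.cong refl arg_cong2[where f = "(^)"])
         (simp add: H_inv1[OF nz] H_simps(1-5) H_power H_coord hom_power hom_mult
               del: fps_const_mult fps_const_power)
  qed
  then show ?thesis by (simp add: H_def)
qed

end

definition witt_ring :: "'a::comm_ring_1 fps ring" where
  "witt_ring = \<lparr>carrier = {f. fps_nth f 0 = 1}, mult = witt_mult, one = fps_inv1 (1 - fps_X),
                zero = 1, add = (*)\<rparr>"


section \<open>Motivic measures on \<open>\<int>[\<LL>]\<close>\<close>

text \<open>The Grothendieck ring of torified varieties is the polynomial ring \<open>\<int>[\<LL>]\<close>, represented by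
  \<^typ>\<open>int poly\<close> with \<open>\<LL>\<close> as the polynomial variable.\<close>

abbreviation lefschetz :: "int poly" where
  "lefschetz \<equiv> [:0, 1:]"

text \<open>The additive extension of \<open>\<LL>\<^sup>i \<mapsto> 1 / (1 - \<LL>\<^sup>i t)\<close>.\<close>

definition kapranov_zeta :: "int poly \<Rightarrow> int poly fps" where
  "kapranov_zeta a =
     (\<Prod>i\<le>degree a. fps_int_pow (fps_inv1 (1 - fps_const (lefschetz ^ i) * fps_X)) (poly.coeff a i))"

lemma kapranov_zeta_lefschetz_power:
  "kapranov_zeta (lefschetz ^ i) = fps_inv1 (1 - fps_const (lefschetz ^ i) * fps_X)"
proof -
  have m: "lefschetz ^ i = Polynomial.monom 1 i" by (simp add: monom_altdef)
  have "kapranov_zeta (lefschetz ^ i)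
        = (\<Prod>k\<le>i. if k = i then fps_inv1 (1 - fps_const (lefschetz ^ i) * fps_X) else 1)"
    unfolding kapranov_zeta_def
    by (rule prod.cong) (auto simp: m degree_monom_eq fps_int_pow_def)
  then show ?thesis by simp
qed

abbreviation sym_power :: "nat \<Rightarrow> int poly \<Rightarrow> int poly" where
  "sym_power n a \<equiv> fps_nth (kapranov_zeta a) n"

definition motivic_measure :: "(int poly \<Rightarrow> 'r::comm_ring_1) \<Rightarrow> bool" where
  "motivic_measure \<mu> \<longleftrightarrow> \<mu> \<in> ring_hom class_ring class_ring"

definition zeta :: "(int poly \<Rightarrow> 'r::comm_ring_1) \<Rightarrow> int poly \<Rightarrow> 'r fps" where
  "zeta \<mu> a = Abs_fps (\<lambda>n. \<mu> (sym_power n a))"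

definition exponentiable :: "(int poly \<Rightarrow> 'r::comm_ring_1) \<Rightarrow> bool" where
  "exponentiable \<mu> \<longleftrightarrow> zeta \<mu> \<in> ring_hom class_ring witt_ring"


section \<open>Endomorphisms of finitely generated projective modules\<close>

text \<open>A projective module of finite rank is a direct summand of some \<open>R\<^sup>n\<close>; in order to have a
  set of objects, we take these summands themselves (every isomorphism class is represented). A
  triple \<open>(n, E, f)\<close> stands for the summand \<open>E\<close> of \<open>R\<^sup>n\<close> with the endomorphism \<open>f\<close>; the values
  of \<open>f\<close> outside \<open>E\<close> are irrelevant.\<close>

type_synonym 'r endo = "nat \<times> 'r vec set \<times> ('r vec \<Rightarrow> 'r vec)"

abbreviation sub_vec :: "nat \<Rightarrow> 'r::comm_ring_1 vec set \<Rightarrow> ('r, 'r vec) module" where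
  "sub_vec n E \<equiv> (module_vec TYPE('r) n)\<lparr>carrier := E\<rparr>"

definition complementary :: "nat \<Rightarrow> 'r::comm_ring_1 vec set \<Rightarrow> 'r vec set \<Rightarrow> bool" where
  "complementary n E F \<longleftrightarrow>
     submodule class_ring E (module_vec TYPE('r) n) \<and>
     submodule class_ring F (module_vec TYPE('r) n) \<and>
     E \<inter> F = {0\<^sub>v n} \<and> {x + y | x y. x \<in> E \<and> y \<in> F} = carrier_vec n"

definition endos :: "'r::comm_ring_1 endo set" where
  "endos = {(n, E, f). (\<exists>F. complementary n E F) \<and>
                       f \<in> module_hom class_ring (sub_vec n E) (sub_vec n E)}"

text \<open>Short exact sequences \<open>0 \<rightarrow> (E\<^sub>1, f\<^sub>1) \<rightarrow> (E, f) \<rightarrow> (E\<^sub>2, f\<^sub>2) \<rightarrow> 0\<close>.\<close>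

fun short_exact :: "'r::comm_ring_1 endo \<Rightarrow> 'r endo \<Rightarrow> 'r endo \<Rightarrow> bool" where
  "short_exact (n1, E1, f1) (n, E, f) (n2, E2, f2) \<longleftrightarrow>
     (\<exists>i \<in> module_hom class_ring (sub_vec n1 E1) (sub_vec n E).
      \<exists>p \<in> module_hom class_ring (sub_vec n E) (sub_vec n2 E2).
        inj_on i E1 \<and> i ` E1 = {x \<in> E. p x = 0\<^sub>v n2} \<and> p ` E = E2 \<and>
        (\<forall>x\<in>E1. i (f1 x) = f (i x)) \<and> (\<forall>x\<in>E. p (f x) = f2 (p x)))"

definition vec_tensor :: "'r::comm_ring_1 vec \<Rightarrow> 'r vec \<Rightarrow> 'r vec" where
  "vec_tensor x y = vec (dim_vec x * dim_vec y) (\<lambda>k. x $ (k div dim_vec y) * y $ (k mod dim_vec y))"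

text \<open>For direct summands \<open>E\<close> of \<open>R\<^sup>n\<close> and \<open>F\<close> of \<open>R\<^sup>m\<close>, the map from \<open>E \<otimes> F\<close> to
  \<open>R\<^sup>n \<otimes> R\<^sup>m = R\<^bsup>nm\<^esup>\<close> is injective, so that \<open>E \<otimes> F\<close> is the span of the tensors \<open>x \<otimes> y\<close>. The
  linear map \<open>f \<otimes> g\<close> is determined on this span by its values on these tensors.\<close>

definition tensor_space :: "nat \<Rightarrow> 'r::comm_ring_1 vec set \<Rightarrow> nat \<Rightarrow> 'r vec set \<Rightarrow> 'r vec set" where
  "tensor_space n E m F = LinearCombinations.module.span class_ring (module_vec TYPE('r) (n * m))
                            {vec_tensor x y | x y. x \<in> E \<and> y \<in> F}"

fun endo_tensor :: "'r::comm_ring_1 endo \<Rightarrow> 'r endo \<Rightarrow> 'r endo" where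
  "endo_tensor (n, E, f) (m, F, g) =
     (n * m, tensor_space n E m F,
      SOME h. h \<in> module_hom class_ring (sub_vec (n * m) (tensor_space n E m F))
                                        (sub_vec (n * m) (tensor_space n E m F)) \<and>
              (\<forall>x\<in>E. \<forall>y\<in>F. h (vec_tensor x y) = vec_tensor (f x) (g y)))"


section \<open>The rings \<open>K\<^sub>0(\<E>\<^sub>R)\<close> and \<open>W\<^sub>0(R)\<close>\<close>

text \<open>The free abelian group on \<^const>\<open>endos\<close> with the biadditive extension of the tensor product
  is not an associative ring (the tensor product is associative only up to isomorphism), but its
  quotient by the relations from short exact sequences is. The operation \<open>Quot\<close> makes sense for
  any record of this shape.\<close>

definition free_endos :: "('r::comm_ring_1 endo \<Rightarrow>\<^sub>0 int) ring" where
  "free_endos =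
     \<lparr>carrier = {c. Poly_Mapping.keys c \<subseteq> endos},
      mult = (\<lambda>a b. frag_extend (\<lambda>x. frag_extend (\<lambda>y. frag_of (endo_tensor x y)) b) a),
      one = frag_of (1, carrier_vec 1, \<lambda>x. x),
      zero = 0, add = (+)\<rparr>"

definition exact_rels :: "('r::comm_ring_1 endo \<Rightarrow>\<^sub>0 int) set" where
  "exact_rels = generate (add_monoid free_endos)
     {frag_of y - frag_of x - frag_of z | x y z.
        x \<in> endos \<and> y \<in> endos \<and> z \<in> endos \<and> short_exact x y z}"

definition K0_endo :: "('r::comm_ring_1 endo \<Rightarrow>\<^sub>0 int) set ring" where
  "K0_endo = free_endos Quot exact_rels"

definition endo_class :: "'r::comm_ring_1 endo \<Rightarrow> ('r endo \<Rightarrow>\<^sub>0 int) set" where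
  "endo_class x = exact_rels +>\<^bsub>free_endos\<^esub> frag_of x"

definition zero_ideal :: "('r::comm_ring_1 endo \<Rightarrow>\<^sub>0 int) set set" where
  "zero_ideal = Idl\<^bsub>K0_endo\<^esub> {endo_class (n, E, f) | n E f. (n, E, f) \<in> endos \<and> (\<forall>x\<in>E. f x = 0\<^sub>v n)}"

definition W0 :: "('r::comm_ring_1 endo \<Rightarrow>\<^sub>0 int) set set ring" where
  "W0 = K0_endo Quot zero_ideal"

text \<open>The matrix of \<open>f\<close> for a direct summand \<open>E\<close> of \<open>R\<^sup>n\<close> is that of \<open>f \<oplus> 0\<close> on
  \<open>E \<oplus> F = R\<^sup>n\<close>. It depends on the complement \<open>F\<close>, but \<open>det (1 - t M)\<close> does not; for \<open>E = R\<^sup>n\<close> it is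
  the usual matrix of \<open>f\<close>.\<close>

fun endo_mat :: "'r::comm_ring_1 endo \<Rightarrow> 'r mat" where
  "endo_mat (n, E, f) = (SOME M. M \<in> carrier_mat n n \<and>
     (\<exists>F. complementary n E F \<and> (\<forall>x\<in>E. M *\<^sub>v x = f x) \<and> (\<forall>x\<in>F. M *\<^sub>v x = 0\<^sub>v n)))"

definition endo_char :: "'r::comm_ring_1 endo \<Rightarrow> 'r fps" where
  "endo_char x =
     fps_inv1 (det (1\<^sub>m (fst x) - fps_X \<cdot>\<^sub>m map_mat fps_const (endo_mat x)))"

definition free_char :: "('r::comm_ring_1 endo \<Rightarrow>\<^sub>0 int) \<Rightarrow> 'r fps" where
  "free_char c = (\<Prod>x\<in>Poly_Mapping.keys c. fps_int_pow (endo_char x) (Poly_Mapping.lookup c x))"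

text \<open>An element of \<^const>\<open>W0\<close> is a set of cosets, whose union is the set of all formal
  combinations representing it; \<^const>\<open>free_char\<close> is constant on that set.\<close>

definition L_map :: "('r::comm_ring_1 endo \<Rightarrow>\<^sub>0 int) set set \<Rightarrow> 'r fps" where
  "L_map X = the_elem (free_char ` \<Union> X)"

definition rational :: "(int poly \<Rightarrow> 'r::comm_ring_1) \<Rightarrow> bool" where
  "rational \<mu> \<longleftrightarrow> exponentiable \<mu> \<and> (\<exists>!r. r \<in> ring_hom class_ring W0 \<and> zeta \<mu> = L_map \<circ> r)"

end

theory Submission
  imports Defs "HOL-Computational_Algebra.Group_Closure"
begin

text \<open>Exponentiability: since \<open>\<zeta>\<^sub>\<mu>\<close> is the image under \<open>\<mu>\<close> of Kapranov's zeta function, by functoriality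
  of the Witt product it suffices to treat \<open>\<mu> = id\<close>. The ring \<open>\<int>[\<LL>]\<close> is torsion free, so power series
  over it are determined by their ghost components (the coefficients of \<open>t f' / f\<close>). These turn the
  Witt product into the componentwise product, and the \<open>k\<close>-th ghost component of the zeta function of \<open>a\<close>
  is \<open>a(\<LL>\<^sup>k)\<close>, which is multiplicative in \<open>a\<close>.

  Rationality: \<open>r\<^sub>\<mu>\<close> sends \<open>\<LL>\<^sup>i\<close> to the class of multiplication by \<open>\<mu>(\<LL>)\<^sup>i\<close> on \<open>R\<close>; uniqueness is
  Almkvist's theorem that \<open>L\<^sub>R\<close> is injective. For the latter, attach to a matrix \<open>P\<close> of polynomials
  with leading coefficient the identity matrix the free module of all sequences \<open>u\<close> with \<open>P(\<sigma>) u = 0\<close>,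
  together with its endomorphism \<open>\<sigma>\<close>, the shift. Its class is additive under products of
  matrices, because \<open>Q(\<sigma>)\<close> maps the solutions of \<open>P Q\<close> onto those of \<open>P\<close>, and Gaussian elimination
  shows that it only depends on \<open>det P\<close>. The matrix \<open>x - A\<close> yields \<open>(R\<^sup>n, A)\<close>, hence the class
  of \<open>(R\<^sup>n, A)\<close> in \<open>W\<^sub>0(R)\<close> is determined by the characteristic polynomial of \<open>A\<close>.\<close>

section \<open>Ghost components\<close>

text \<open>Two obstacles shape the rationality half. The objects in \<open>endos\<close> involve
  choices: a complement, values of the map off the summand, the \<open>SOME\<close> in
  \<open>endo_tensor\<close> and \<open>endo_mat\<close>. They are therefore translated into pairs
  of matrices \<open>p\<close>, \<open>M\<close> with \<open>p\<close> idempotent; exactness becomes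
  splitting, i.e. a list of matrix identities that Kronecker products and block determinants handle
  without further choices. Moreover the tensor product is associative only modulo exact sequences,
  so \<open>free_endos\<close> is not a ring and its quotients are computed on representatives.

  For injectivity, \<open>R\<close> may have zero divisors and pivots cannot be inverted. Passing
  from x - A to general monic matrices of polynomials makes room for elimination steps that multiply
  by a pivot, and solution spaces have explicit bases, given by initial values. Finally, L_R sees
  only det(1 - tA), which forgets the size of A; the zero endomorphisms divided out in W_0(R) supply
  the blocks that equalise sizes.\<close>

abbreviation fps_agree :: "nat \<Rightarrow> 'a::zero fps \<Rightarrow> 'a fps \<Rightarrow> bool" where
  "fps_agree K f g \<equiv> \<forall>n\<le>K. fps_nth f n = fps_nth g n"

lemma fps_agree_mult:
  fixes f g :: "'a::comm_ring_1 fps"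
  shows "fps_agree K f f' \<Longrightarrow> fps_agree K g g' \<Longrightarrow> fps_agree K (f * g) (f' * g')"
  by (auto simp: fps_mult_nth intro!: sum.cong)

lemma fps_agree_prod:
  fixes F G :: "'b \<Rightarrow> 'a::comm_ring_1 fps"
  shows "(\<And>x. x \<in> S \<Longrightarrow> fps_agree K (F x) (G x)) \<Longrightarrow> fps_agree K (prod F S) (prod G S)"
proof (induction S rule: infinite_finite_induct)
  case (insert x S)
  then show ?case using fps_agree_mult[of K "F x" "G x" "prod F S" "prod G S"] by auto
qed auto

text \<open>The inverses are compared through (1/f)(g/g) and (1/f)(f/g), which agree up to degree K
  because f and g do.\<close>

lemma fps_agree_inv1:
  fixes f g :: "'a::comm_ring_1 fps"
  assumes "fps_agree K f g" "fps_nth f 0 = 1"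
  shows "fps_agree K (fps_inv1 f) (fps_inv1 g)"
proof -
  have g: "fps_nth g 0 = 1" using assms by auto
  have "fps_agree K (fps_inv1 f * (g * fps_inv1 g)) (fps_inv1 f * (f * fps_inv1 g))"
    using assms by (intro fps_agree_mult) auto
  moreover have "fps_inv1 f * (f * fps_inv1 g) = f * fps_inv1 f * fps_inv1 g"
    by (simp add: mult_ac)
  ultimately show ?thesis using fps_inv1_mult[OF assms(2)] fps_inv1_mult[OF g] by simp
qed

lemma fps_inv1_distrib:
  fixes f g :: "'a::comm_ring_1 fps"
  assumes "fps_nth f 0 = 1" "fps_nth g 0 = 1"
  shows "fps_inv1 (f * g) = fps_inv1 f * fps_inv1 g"
proof (rule fps_inv1_unique)
  have "f * g * (fps_inv1 f * fps_inv1 g) = (f * fps_inv1 f) * (g * fps_inv1 g)"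
    by (simp add: mult_ac)
  then show "f * g * (fps_inv1 f * fps_inv1 g) = 1"
    using assms by (simp add: fps_inv1_mult)
qed (use assms in simp)

lemma fps_inv1_inv1:
  fixes f :: "'a::comm_ring_1 fps"
  assumes "fps_nth f 0 = 1"
  shows "fps_inv1 (fps_inv1 f) = f"
  using fps_inv1_mult[OF assms] by (intro fps_inv1_unique) (simp_all add: mult.commute)

lemma fps_inv1_one: "fps_inv1 (1 :: 'a::comm_ring_1 fps) = 1"
  by (rule fps_inv1_unique) auto

lemma fps_nth_prod_0:
  fixes F :: "'b \<Rightarrow> 'a::comm_ring_1 fps"
  shows "fps_nth (prod F S) 0 = (\<Prod>x\<in>S. fps_nth (F x) 0)"
  by (induction S rule: infinite_finite_induct) auto

lemma fps_nth_power_0: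
  fixes f :: "'a::comm_ring_1 fps"
  shows "fps_nth (f ^ n) 0 = fps_nth f 0 ^ n"
  by (induction n) auto

text \<open>With \<open>g = ghost f\<close>, the series \<open>t \<cdot> g\<close> is the logarithmic derivative \<open>t f' / f\<close>; so the
  \<open>k\<close>-th ghost component of \<open>f\<close> is the coefficient of \<open>t\<^bsup>k-1\<^esup>\<close> in \<open>ghost f\<close>.\<close>

definition ghost :: "'a::comm_ring_1 fps \<Rightarrow> 'a fps" where
  "ghost f = fps_deriv f * fps_inv1 f"

lemma ghost_one: "ghost 1 = 0"
  by (simp add: ghost_def)

lemma ghost_mult:
  assumes "fps_nth f 0 = 1" "fps_nth g 0 = 1"
  shows "ghost (f * g) = ghost f + ghost g"
proof -
  have "ghost (f * g) = fps_deriv f * fps_inv1 f * (g * fps_inv1 g)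
                        + fps_deriv g * fps_inv1 g * (f * fps_inv1 f)"
    by (simp add: ghost_def fps_inv1_distrib[OF assms] algebra_simps)
  then show ?thesis using assms by (simp add: fps_inv1_mult ghost_def)
qed

lemma ghost_power: "fps_nth f 0 = 1 \<Longrightarrow> ghost (f ^ n) = of_nat n * ghost f"
  by (induction n) (simp_all add: ghost_one ghost_mult fps_nth_power_0 algebra_simps)

lemma ghost_prod:
  "(\<And>x. x \<in> S \<Longrightarrow> fps_nth (F x) 0 = 1) \<Longrightarrow> ghost (prod F S) = (\<Sum>x\<in>S. ghost (F x))"
  by (induction S rule: infinite_finite_induct) (simp_all add: ghost_one ghost_mult fps_nth_prod_0)

lemma ghost_inv1:
  assumes "fps_nth f 0 = 1"
  shows "ghost (fps_inv1 f) = - ghost f"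
proof -
  have "0 = ghost (f * fps_inv1 f)" using assms by (simp add: fps_inv1_mult ghost_one)
  also have "\<dots> = ghost f + ghost (fps_inv1 f)" using assms by (intro ghost_mult) auto
  finally show ?thesis by (simp add: eq_neg_iff_add_eq_0 add.commute)
qed

text \<open>The derivative shifts degrees by one: the coefficient of t^k in \<open>ghost f\<close>
  involves the coefficients of \<open>f\<close> up to t^(k+1), hence the
  \<open>Suc k\<close>.\<close>

lemma ghost_agree:
  fixes f g :: "'a::comm_ring_1 fps"
  assumes "fps_agree (Suc k) f g" "fps_nth f 0 = 1"
  shows "fps_nth (ghost f) k = fps_nth (ghost g) k"
proof -
  have "fps_agree k (fps_deriv f * fps_inv1 f) (fps_deriv g * fps_inv1 g)"
    using assms fps_agree_inv1[of k f g] by (intro fps_agree_mult) auto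
  then show ?thesis by (simp add: ghost_def)
qed

text \<open>The quotient h = f/g has logarithmic derivative 0, and 1/h is a unit, so h' = 0. In
  characteristic 0 this makes h constant, equal to its constant coefficient 1.\<close>

lemma ghost_inj:
  fixes f g :: "'a::{idom, ring_char_0} fps"
  assumes "ghost f = ghost g" "fps_nth f 0 = 1" "fps_nth g 0 = 1"
  shows "f = g"
proof -
  let ?h = "f * fps_inv1 g"
  have "fps_deriv ?h * fps_inv1 ?h = 0"
    using assms by (simp only: ghost_def[symmetric]) (simp add: ghost_mult ghost_inv1)
  moreover have "?h * fps_inv1 ?h = 1" using assms by (intro fps_inv1_mult) simp
  ultimately have "fps_deriv ?h = 0" by (metis mult_eq_0_iff zero_neq_one mult_zero_right)
  then have "?h = fps_const (fps_nth ?h 0)" by (simp only: fps_deriv_eq_0_iff)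
  also have "\<dots> = 1" using assms by simp
  finally have "?h * g = g" by simp
  moreover have "?h * g = f * (g * fps_inv1 g)" by (simp add: mult_ac)
  ultimately show ?thesis using fps_inv1_mult[OF assms(3)] by simp
qed

section \<open>Geometric series and Witt coordinates\<close>

lemma fps_inv1_geometric_power:
  fixes c :: "'a::comm_ring_1"
  assumes "l > 0"
  shows "fps_inv1 (1 - fps_const c * fps_X ^ l)
         = Abs_fps (\<lambda>n. if l dvd n then c ^ (n div l) else 0)" (is "_ = ?g")
proof (rule fps_inv1_unique)
  have dv: "l dvd n - l \<longleftrightarrow> l dvd n" "c * c ^ ((n - l) div l) = c ^ (n div l)" if "l \<le> n" for n
  proof -
    show "l dvd n - l \<longleftrightarrow> l dvd n" using that by (simp add: dvd_minus_self)
    have "n div l = Suc ((n - l) div l)" using that assms by (simp add: le_div_geq)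
    then show "c * c ^ ((n - l) div l) = c ^ (n div l)" by simp
  qed
  show "(1 - fps_const c * fps_X ^ l) * ?g = 1"
  proof (rule fps_ext)
    fix n
    have "fps_nth ((1 - fps_const c * fps_X ^ l) * ?g) n
          = fps_nth ?g n - c * fps_nth (fps_X ^ l * ?g) n"
      by (simp add: left_diff_distrib mult.assoc)
    also have "\<dots> = (if n = 0 then 1 else 0)"
      using assms dv[of n] by (auto simp: fps_X_power_mult_nth not_less dest: dvd_imp_le)
    finally show "fps_nth ((1 - fps_const c * fps_X ^ l) * ?g) n = fps_nth 1 n" by simp
  qed
qed (use assms in simp)

text \<open>For f = 1/(1 - c t^l), the series t f'/f is the sum of l c^j t^(lj) over j >= 1. The
  index is k + 1 because \<open>ghost\<close> omits the factor t.\<close>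

lemma ghost_geometric_power:
  fixes c :: "'a::comm_ring_1"
  assumes "l > 0"
  shows "fps_nth (ghost (fps_inv1 (1 - fps_const c * fps_X ^ l))) k
         = (if l dvd Suc k then of_nat l * c ^ (Suc k div l) else 0)"
proof -
  let ?p = "1 - fps_const c * fps_X ^ l"
  have p0: "fps_nth ?p 0 = 1" using assms by simp
  have "fps_deriv (fps_const c * fps_X ^ l) = fps_const (of_nat l * c) * fps_X ^ (l - 1)"
    by (simp add: fps_deriv_power fps_of_nat[symmetric] mult_ac flip: fps_const_mult)
  then have "ghost (fps_inv1 ?p) = fps_const (of_nat l * c) * (fps_X ^ (l - 1) * fps_inv1 ?p)"
    unfolding ghost_inv1[OF p0] by (simp add: ghost_def mult.assoc del: fps_deriv_mult)
  then have *: "fps_nth (ghost (fps_inv1 ?p)) k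
    = of_nat l * (c * (if k < l - 1 then 0 else if l dvd k - (l - 1) then c ^ ((k - (l - 1)) div l) else 0))"
    by (simp add: fps_X_power_mult_nth fps_inv1_geometric_power[OF assms] mult.assoc)
  show ?thesis
  proof (cases "k < l - 1")
    case True
    then have "\<not> l dvd Suc k" by (auto dest: dvd_imp_le)
    with True show ?thesis unfolding * by simp
  next
    case False
    with assms have 1: "k - (l - 1) = Suc k - l" "l \<le> Suc k" by auto
    have 2: "l dvd Suc k - l \<longleftrightarrow> l dvd Suc k" using 1 by (simp add: dvd_minus_self)
    have "Suc k div l = Suc ((Suc k - l) div l)" using 1 assms by (simp add: le_div_geq)
    with False show ?thesis unfolding * 1(1) 2 by simp
  qed
qed

text \<open>In the induction step the product up to \<open>K\<close> leaves a series 1 + x t^(K+1) +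
  ..., and \<open>witt_coord\<close> is defined as exactly this coefficient x, so that the next
  factor cancels it.\<close>

lemma witt_coord_expansion:
  fixes f :: "'a::comm_ring_1 fps"
  assumes "fps_nth f 0 = 1"
  shows "fps_agree K (f * (\<Prod>d\<in>{1..K}. 1 - fps_const (witt_coord f d) * fps_X ^ d)) 1"
proof (induction K)
  case 0
  then show ?case using assms by simp
next
  case (Suc K)
  define x where "x = witt_coord f (Suc K)"
  define F where "F = f * (\<Prod>d\<in>{1..K}. 1 - fps_const (witt_coord f d) * fps_X ^ d)"
  have F: "fps_nth F n = fps_nth 1 n" if "n \<le> K" for n using Suc that by (simp add: F_def)
  have x: "x = fps_nth F (Suc K)"
    unfolding x_def by (subst witt_coord.simps) (simp add: F_def atLeastLessThanSuc_atLeastAtMost)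
  have "f * (\<Prod>d\<in>{1..Suc K}. 1 - fps_const (witt_coord f d) * fps_X ^ d)
        = F * (1 - fps_const x * fps_X ^ Suc K)"
    by (simp add: F_def x_def prod.nat_ivl_Suc' mult_ac)
  also have "\<dots> = F - fps_const x * (fps_X ^ Suc K * F)" by (simp add: algebra_simps)
  finally have eq: "f * (\<Prod>d\<in>{1..Suc K}. 1 - fps_const (witt_coord f d) * fps_X ^ d)
        = F - fps_const x * (fps_X ^ Suc K * F)" .
  have X: "fps_nth (fps_X ^ Suc K * F) n = (if n < Suc K then 0 else fps_nth F (n - Suc K))" for n
    by (rule fps_X_power_mult_nth)
  show ?case
  proof (intro allI impI)
    fix n assume "n \<le> Suc K"
    then consider "n \<le> K" | "n = Suc K" by linarith
    then show "fps_nth (f * (\<Prod>d\<in>{1..Suc K}. 1 - fps_const (witt_coord f d) * fps_X ^ d)) n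
               = fps_nth 1 n"
      unfolding eq fps_sub_nth fps_mult_left_const_nth X
      by cases (simp_all add: F x)
  qed
qed

lemma witt_coord_product:
  fixes f :: "'a::comm_ring_1 fps"
  assumes "fps_nth f 0 = 1"
  shows "fps_agree K f (\<Prod>d\<in>{1..K}. fps_inv1 (1 - fps_const (witt_coord f d) * fps_X ^ d))"
proof -
  let ?p = "\<lambda>d. 1 - fps_const (witt_coord f d) * fps_X ^ d"
  let ?P = "\<Prod>d\<in>{1..K}. ?p d" and ?Q = "\<Prod>d\<in>{1..K}. fps_inv1 (?p d)"
  have "?P * ?Q = (\<Prod>d\<in>{1..K}. ?p d * fps_inv1 (?p d))" by (simp add: prod.distrib)
  also have "\<dots> = 1" by (rule prod.neutral) (simp add: fps_inv1_mult)
  finally have "f = f * ?P * ?Q" by (simp add: mult.assoc)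
  moreover have "fps_agree K (f * ?P * ?Q) (1 * ?Q)"
    using witt_coord_expansion[OF assms] by (intro fps_agree_mult) auto
  ultimately show ?thesis by simp
qed

text \<open>The product expansion turns into a sum of contributions of geometric series; the result
  is the classical Witt polynomial of index k + 1.\<close>

lemma ghost_witt_coord:
  fixes f :: "'a::comm_ring_1 fps"
  assumes "fps_nth f 0 = 1"
  shows "fps_nth (ghost f) k = (\<Sum>m\<in>{1..Suc k}. if m dvd Suc k
           then of_nat m * witt_coord f m ^ (Suc k div m) else 0)"
proof -
  have "fps_nth (ghost f) k = fps_nth (ghost (\<Prod>d\<in>{1..Suc k}.
      fps_inv1 (1 - fps_const (witt_coord f d) * fps_X ^ d))) k"
    using witt_coord_product[OF assms] assms by (intro ghost_agree) blast+
  also have "\<dots> = (\<Sum>d\<in>{1..Suc k}.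
      fps_nth (ghost (fps_inv1 (1 - fps_const (witt_coord f d) * fps_X ^ d))) k)"
    by (subst ghost_prod) (simp_all add: fps_sum_nth)
  also have "\<dots> = (\<Sum>m\<in>{1..Suc k}. if m dvd Suc k
           then of_nat m * witt_coord f m ^ (Suc k div m) else 0)"
    by (intro sum.cong refl ghost_geometric_power) auto
  finally show ?thesis .
qed

text \<open>\<open>witt_mult\<close> takes a different finite product for each coefficient. If m or
  n exceeds N, so does their lcm, and the factor is 1 up to t^N; hence one product serves all
  coefficients up to \<open>K\<close>. Ghost components mix several coefficients and need such a
  common product.\<close>

lemma witt_mult_agree:
  fixes f g :: "'a::comm_ring_1 fps"
  defines "t \<equiv> \<lambda>m n. fps_inv1 (1 - fps_const (witt_coord f m ^ (n div gcd m n)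
      * witt_coord g n ^ (m div gcd m n)) * fps_X ^ lcm m n) ^ gcd m n"
  shows "fps_agree K (witt_mult f g) (\<Prod>m\<in>{1..K}. \<Prod>n\<in>{1..K}. t m n)"
proof (intro allI impI)
  fix N assume "N \<le> K"
  have one: "fps_agree N (t m n) 1" if "\<not> (m \<le> N \<and> n \<le> N)" "m \<ge> 1" "n \<ge> 1" for m n
  proof -
    have "lcm m n > N" using that lcm_pos_nat[of m n] dvd_imp_le[of m "lcm m n"] dvd_imp_le[of n "lcm m n"]
      by auto
    then have "fps_agree N (fps_inv1 (1 - fps_const c * fps_X ^ lcm m n)) (fps_inv1 1)" for c :: 'a
      by (intro fps_agree_inv1) auto
    then have a: "fps_agree N (fps_inv1 (1 - fps_const c * fps_X ^ lcm m n)) 1" for c :: 'a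
      by (simp add: fps_inv1_one)
    have pw: "fps_agree N h 1 \<Longrightarrow> fps_agree N (h ^ j) 1" for h :: "'a fps" and j
      using fps_agree_prod[of "{..<j}" N "\<lambda>_. h" "\<lambda>_. 1"] by simp
    show ?thesis unfolding t_def by (intro pw a)
  qed
  have "fps_agree N (\<Prod>m\<in>{1..K}. \<Prod>n\<in>{1..K}. t m n)
          (\<Prod>m\<in>{1..K}. \<Prod>n\<in>{1..K}. if m \<le> N \<and> n \<le> N then t m n else 1)"
    using one by (intro fps_agree_prod) auto
  moreover have "(\<Prod>m\<in>{1..K}. \<Prod>n\<in>{1..K}. if m \<le> N \<and> n \<le> N then t m n else 1)
                 = (\<Prod>m\<in>{1..K}. if m \<le> N then (\<Prod>n\<in>{1..K}. if n \<le> N then t m n else 1) else 1)"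
    by (intro prod.cong) auto
  moreover have "\<dots> = (\<Prod>m\<in>{1..N}. \<Prod>n\<in>{1..N}. t m n)"
  proof -
    have s: "{Suc 0..K} \<inter> {m. m \<le> N} = {Suc 0..N}" using \<open>N \<le> K\<close> by auto
    show ?thesis by (simp add: prod.If_cases s)
  qed
  ultimately show "fps_nth (witt_mult f g) N = fps_nth (\<Prod>m\<in>{1..K}. \<Prod>n\<in>{1..K}. t m n) N"
    by (simp add: witt_mult_def t_def)
qed

lemma witt_mult_nth_0: "fps_nth (witt_mult f g) 0 = 1"
  by (simp add: witt_mult_def)

text \<open>For m and n dividing K = k + 1, the factor contributes gcd times lcm, i.e. mn, times
  powers whose exponents (n/gcd)(K/lcm) and (m/gcd)(K/lcm) are K/m and K/n. So each pair yields a
  term of the Witt polynomial of \<open>f\<close> times one of that of \<open>g\<close>, and the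
  double sum factors.\<close>

lemma ghost_witt_mult:
  fixes f g :: "'a::comm_ring_1 fps"
  assumes "fps_nth f 0 = 1" "fps_nth g 0 = 1"
  shows "fps_nth (ghost (witt_mult f g)) k = fps_nth (ghost f) k * fps_nth (ghost g) k"
proof -
  let ?x = "witt_coord f" and ?y = "witt_coord g" and ?S = "{1..Suc k}"
  let ?c = "\<lambda>m n. ?x m ^ (n div gcd m n) * ?y n ^ (m div gcd m n)"
  let ?i = "\<lambda>m n. fps_inv1 (1 - fps_const (?c m n) * fps_X ^ lcm m n)"
  have i0: "fps_nth (?i m n ^ j) 0 = 1" for m n j by (simp add: fps_nth_power_0)
  have val: "fps_nth (ghost (?i m n ^ gcd m n)) k
      = (if m dvd Suc k then of_nat m * ?x m ^ (Suc k div m) else 0)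
      * (if n dvd Suc k then of_nat n * ?y n ^ (Suc k div n) else 0)" if "m \<ge> 1" "n \<ge> 1" for m n
  proof -
    have l: "lcm m n > 0" using that by (intro lcm_pos_nat) auto
    have "fps_nth (ghost (?i m n ^ gcd m n)) k = of_nat (gcd m n) * fps_nth (ghost (?i m n)) k"
      by (subst ghost_power) (simp_all add: fps_of_nat[symmetric])
    also have "\<dots> = of_nat (gcd m n) * (if lcm m n dvd Suc k
        then of_nat (lcm m n) * ?c m n ^ (Suc k div lcm m n) else 0)"
      by (subst ghost_geometric_power[OF l]) simp
    also have "\<dots> = (if m dvd Suc k \<and> n dvd Suc k
        then of_nat (gcd m n * lcm m n) * ?c m n ^ (Suc k div lcm m n) else 0)"
      by (cases "m dvd Suc k \<and> n dvd Suc k")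
         (simp_all only: lcm_least_iff of_nat_mult mult.assoc mult_zero_right simp_thms if_True if_False)
    also have "gcd m n * lcm m n = m * n" by (rule prod_gcd_lcm_nat[symmetric])
    also have "(if m dvd Suc k \<and> n dvd Suc k
        then of_nat (m * n) * ?c m n ^ (Suc k div lcm m n) else 0)
      = (if m dvd Suc k then of_nat m * ?x m ^ (Suc k div m) else 0)
      * (if n dvd Suc k then of_nat n * ?y n ^ (Suc k div n) else 0)"
    proof (cases "m dvd Suc k \<and> n dvd Suc k")
      case True
      then have "lcm m n dvd Suc k" by auto
      then obtain q where q: "Suc k = lcm m n * q" unfolding dvd_def by blast
      have e: "(b div gcd a b) * q = Suc k div a" if "lcm a b = lcm m n" "a \<ge> 1" for a b
      proof -
        have "lcm a b = a * (b div gcd a b)" by (simp add: lcm_nat_def div_mult_swap)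
        with q that have "Suc k = a * (b div gcd a b * q)" by (simp add: mult.assoc)
        then show ?thesis using that by (metis nonzero_mult_div_cancel_left not_one_le_zero)
      qed
      have "Suc k div lcm m n = q" using q l by (metis nonzero_mult_div_cancel_left less_not_refl)
      then have "?c m n ^ (Suc k div lcm m n) = ?x m ^ (Suc k div m) * ?y n ^ (Suc k div n)"
        using e[of m n] e[of n m] that
        by (simp add: power_mult_distrib gcd.commute lcm.commute flip: power_mult)
      with True show ?thesis by (simp only: simp_thms if_True of_nat_mult mult_ac)
    qed auto
    finally show ?thesis .
  qed
  have "fps_nth (ghost (witt_mult f g)) k
        = fps_nth (ghost (\<Prod>m\<in>?S. \<Prod>n\<in>?S. ?i m n ^ gcd m n)) k"
    by (intro ghost_agree witt_mult_agree witt_mult_nth_0)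
  also have "\<dots> = (\<Sum>m\<in>?S. \<Sum>n\<in>?S. fps_nth (ghost (?i m n ^ gcd m n)) k)"
    by (subst ghost_prod, simp add: fps_nth_prod_0 i0, subst ghost_prod, rule i0)
       (simp add: fps_sum_nth)
  also have "\<dots> = (\<Sum>m\<in>?S. \<Sum>n\<in>?S.
        (if m dvd Suc k then of_nat m * ?x m ^ (Suc k div m) else 0)
      * (if n dvd Suc k then of_nat n * ?y n ^ (Suc k div n) else 0))"
    by (intro sum.cong refl val) auto
  also have "\<dots> = fps_nth (ghost f) k * fps_nth (ghost g) k"
    by (simp only: ghost_witt_coord[OF assms(1)] ghost_witt_coord[OF assms(2)] sum_product)
  finally show ?thesis .
qed

section \<open>Exponentiability\<close>

lemma fps_int_pow_nth_0: "fps_nth f 0 = 1 \<Longrightarrow> fps_nth (fps_int_pow f k) 0 = 1"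
  by (simp add: fps_int_pow_def fps_nth_power_0)

lemma fps_int_pow_0 [simp]: "fps_int_pow f 0 = 1"
  by (simp add: fps_int_pow_def)

text \<open>Both exponents are written as differences of natural numbers, so that the single formula
  \<open>mixed\<close> replaces a case distinction on signs.\<close>

lemma fps_int_pow_add:
  fixes f :: "'a::comm_ring_1 fps"
  assumes "fps_nth f 0 = 1"
  shows "fps_int_pow f (a + b) = fps_int_pow f a * fps_int_pow f b"
proof -
  have inv: "f * fps_inv1 f = 1" using assms by (rule fps_inv1_mult)
  have c: "f ^ (m + j) * fps_inv1 f ^ j = f ^ m" "f ^ j * fps_inv1 f ^ (m + j) = fps_inv1 f ^ m" for m j
  proof -
    have "f ^ (m + j) * fps_inv1 f ^ j = f ^ m * (f * fps_inv1 f) ^ j"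
      by (simp add: power_add power_mult_distrib mult_ac)
    then show "f ^ (m + j) * fps_inv1 f ^ j = f ^ m" using inv by simp
    have "f ^ j * fps_inv1 f ^ (m + j) = fps_inv1 f ^ m * (f * fps_inv1 f) ^ j"
      by (simp add: power_add power_mult_distrib mult_ac)
    then show "f ^ j * fps_inv1 f ^ (m + j) = fps_inv1 f ^ m" using inv by simp
  qed
  have mixed: "fps_int_pow f (int m - int j) = f ^ m * fps_inv1 f ^ j" for m j
  proof (cases "j \<le> m")
    case True
    then show ?thesis using c(1)[of "m - j" j] by (simp add: fps_int_pow_def flip: of_nat_diff)
  next
    case False
    then have "nat (- (int m - int j)) = j - m" by simp
    with False show ?thesis using c(2)[of m "j - m"] by (simp add: fps_int_pow_def)
  qed
  obtain m j where a: "a = int m - int j" by (cases a rule: int_diff_cases)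
  obtain n l where b: "b = int n - int l" by (cases b rule: int_diff_cases)
  have "a + b = int (m + n) - int (j + l)" by (simp add: a b)
  then show ?thesis by (simp only: mixed a b) (simp add: power_add mult_ac)
qed

lemma ghost_int_pow:
  assumes "fps_nth f 0 = 1"
  shows "ghost (fps_int_pow f k) = of_int k * ghost f"
  using assms by (auto simp: fps_int_pow_def ghost_power ghost_inv1)

lemma kapranov_zeta_nth_0: "fps_nth (kapranov_zeta a) 0 = 1"
  by (simp add: kapranov_zeta_def fps_nth_prod_0 fps_int_pow_nth_0)

text \<open>The series of L^i has components (L^i)^(k+1) = (L^(k+1))^i. Thus the ghost components
  are the Adams operations L -> L^(k+1); being substitutions, they respect sums and
  products.\<close>

lemma ghost_kapranov_zeta:
  "fps_nth (ghost (kapranov_zeta a)) k = pcompose a (lefschetz ^ Suc k)"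
proof -
  let ?g = "\<lambda>i. fps_inv1 (1 - fps_const (lefschetz ^ i) * fps_X)"
  have "fps_nth (ghost (kapranov_zeta a)) k
        = (\<Sum>i\<le>degree a. fps_nth (ghost (fps_int_pow (?g i) (coeff a i))) k)"
    unfolding kapranov_zeta_def
    by (subst ghost_prod) (simp_all add: fps_int_pow_nth_0 fps_sum_nth)
  also have "\<dots> = (\<Sum>i\<le>degree a. of_int (coeff a i) * fps_nth (ghost (?g i)) k)"
    by (subst ghost_int_pow) (simp_all add: fps_of_int[symmetric])
  also have "\<dots> = (\<Sum>i\<le>degree a. of_int (coeff a i) * (lefschetz ^ Suc k) ^ i)"
  proof (intro sum.cong refl arg_cong2[where f = "(*)"])
    fix i
    have "fps_nth (ghost (?g i)) k = (lefschetz ^ i) ^ Suc k"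
      using ghost_geometric_power[of 1 "lefschetz ^ i" k] by simp
    then show "fps_nth (ghost (?g i)) k = (lefschetz ^ Suc k) ^ i"
      by (simp only: power_mult[symmetric] mult.commute)
  qed
  also have "\<dots> = pcompose a (lefschetz ^ Suc k)"
    by (simp add: pcompose_altdef poly_altdef of_int_poly coeff_map_poly degree_map_poly
          del: power_Suc)
  finally show ?thesis .
qed

lemma kapranov_zeta_add: "kapranov_zeta (a + b) = kapranov_zeta a * kapranov_zeta b"
  by (rule ghost_inj)
     (auto simp: fps_eq_iff ghost_kapranov_zeta ghost_mult kapranov_zeta_nth_0 pcompose_add)

lemma kapranov_zeta_mult: "kapranov_zeta (a * b) = witt_mult (kapranov_zeta a) (kapranov_zeta b)"
  by (rule ghost_inj)
     (auto simp: fps_eq_iff ghost_kapranov_zeta ghost_witt_mult kapranov_zeta_nth_0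
                 witt_mult_nth_0 pcompose_mult)

lemma motivic_measure_hom: "motivic_measure \<mu> \<Longrightarrow> comm_ring_hom \<mu>"
proof -
  assume m: "motivic_measure \<mu>"
  have a: "\<mu> (x + y) = \<mu> x + \<mu> y" "\<mu> (x * y) = \<mu> x * \<mu> y" "\<mu> 1 = 1" for x y
    using m by (auto simp: motivic_measure_def Ring.ring_hom_def)
  have "\<mu> 0 = 0" using a(1)[of 0 0] by simp
  with a show ?thesis by unfold_locales auto
qed

lemma zeta_one:
  fixes \<mu> :: "int poly \<Rightarrow> 'r::comm_ring_1"
  assumes "comm_ring_hom \<mu>"
  shows "zeta \<mu> 1 = fps_inv1 (1 - fps_X)"
proof -
  interpret comm_ring_hom \<mu> by fact
  have "kapranov_zeta 1 = Abs_fps (\<lambda>n. 1)"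
    using kapranov_zeta_lefschetz_power[of 0] fps_inv1_geometric_power[of 1 "1 :: int poly"] by simp
  moreover have "fps_inv1 (1 - fps_X) = Abs_fps (\<lambda>n. 1 :: 'r)"
    using fps_inv1_geometric_power[of 1 "1 :: 'r"] by simp
  ultimately show ?thesis by (simp add: zeta_def)
qed

lemma zeta_add:
  assumes "comm_ring_hom \<mu>"
  shows "zeta \<mu> (a + b) = zeta \<mu> a * zeta \<mu> b"
proof -
  interpret comm_ring_hom \<mu> by fact
  show ?thesis by (simp add: zeta_def kapranov_zeta_add fps_eq_iff fps_mult_nth hom_distribs)
qed

theorem exponentiable_hom:
  assumes "comm_ring_hom \<mu>"
  shows "exponentiable \<mu>"
proof -
  interpret comm_ring_hom \<mu> by fact
  show ?thesis
    unfolding exponentiable_def Ring.ring_hom_def witt_ring_def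
    using witt_mult_functorial[OF assms] zeta_add[OF assms] zeta_one[OF assms]
    by (auto simp: zeta_def kapranov_zeta_mult kapranov_zeta_nth_0)
qed

section \<open>Reversed characteristic polynomials\<close>

lemma det_four_block_one_right:
  fixes A :: "'a::comm_ring_1 mat"
  assumes A: "A \<in> carrier_mat n n"
  shows "det (four_block_mat A (0\<^sub>m n m) (0\<^sub>m m n) (1\<^sub>m m)) = det A"
proof (induction m)
  case 0
  have "four_block_mat A (0\<^sub>m n 0) (0\<^sub>m 0 n) (1\<^sub>m 0) = A"
    by (rule eq_matI) (use A in auto)
  then show ?case by simp
next
  case (Suc m)
  let ?B = "four_block_mat A (0\<^sub>m n m) (0\<^sub>m m n) (1\<^sub>m m)"
  have "four_block_mat A (0\<^sub>m n (Suc m)) (0\<^sub>m (Suc m) n) (1\<^sub>m (Suc m))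
        = four_block_mat ?B (0\<^sub>m (n + m) 1) (0\<^sub>m 1 (n + m)) (1\<^sub>m 1)"
    by (rule eq_matI) (use A in auto)
  also have "det \<dots> = det ?B * det (1\<^sub>m 1)"
    by (rule det_four_block_mat_upper_right_zero_col) (use A in auto)
  finally show ?case using Suc by simp
qed

lemma det_four_block_one_left:
  fixes D :: "'a::comm_ring_1 mat"
  assumes D: "D \<in> carrier_mat m m"
  shows "det (four_block_mat (1\<^sub>m n) (0\<^sub>m n m) (0\<^sub>m m n) D) = det D"
proof (induction n)
  case 0
  have "four_block_mat (1\<^sub>m 0) (0\<^sub>m 0 m) (0\<^sub>m m 0) D = D"
    by (rule eq_matI) (use D in auto)
  then show ?case by simp
next
  case (Suc n)
  let ?B = "four_block_mat (1\<^sub>m n) (0\<^sub>m n m) (0\<^sub>m m n) D"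
  have "four_block_mat (1\<^sub>m (Suc n)) (0\<^sub>m (Suc n) m) (0\<^sub>m m (Suc n)) D
        = four_block_mat (1\<^sub>m 1) (0\<^sub>m 1 (n + m)) (0\<^sub>m (n + m) 1) ?B"
    by (rule eq_matI) (use D in auto)
  also have "det \<dots> = det (1\<^sub>m 1) * det ?B"
    by (rule det_four_block_mat_lower_left_zero_col) (use D in auto)
  finally show ?case using Suc by simp
qed

text \<open>Rests on the factorisation [[A, B], [0, D]] = [[1, 0], [0, D]] [[1, B], [0, 1]] [[A, 0],
  [0, 1]], which involves no inverses and so holds over every commutative ring.\<close>

lemma det_four_block_upper:
  fixes A :: "'a::comm_ring_1 mat"
  assumes A: "A \<in> carrier_mat n n" and B: "B \<in> carrier_mat n m" and D: "D \<in> carrier_mat m m"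
  shows "det (four_block_mat A B (0\<^sub>m m n) D) = det A * det D"
proof -
  let ?D = "four_block_mat (1\<^sub>m n) (0\<^sub>m n m) (0\<^sub>m m n) D"
  let ?B = "four_block_mat (1\<^sub>m n) B (0\<^sub>m m n) (1\<^sub>m m)"
  let ?A = "four_block_mat A (0\<^sub>m n m) (0\<^sub>m m n) (1\<^sub>m m)"
  have c: "?D \<in> carrier_mat (n + m) (n + m)" "?B \<in> carrier_mat (n + m) (n + m)"
    "?A \<in> carrier_mat (n + m) (n + m)" using A B D by auto
  have "?B * ?A = four_block_mat A B (0\<^sub>m m n) (1\<^sub>m m)"
    by (subst mult_four_block_mat[of _ n n _ m _ m]) (use A B in auto)
  moreover have "?D * four_block_mat A B (0\<^sub>m m n) (1\<^sub>m m) = four_block_mat A B (0\<^sub>m m n) D"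
    by (subst mult_four_block_mat[of _ n n _ m _ m]) (use A B D in auto)
  ultimately have "four_block_mat A B (0\<^sub>m m n) D = ?D * (?B * ?A)" by simp
  also have "det \<dots> = det ?D * (det ?B * det ?A)"
    by (simp only: det_mult[OF c(1) mult_carrier_mat[OF c(2,3)]] det_mult[OF c(2,3)])
  also have "upper_triangular ?B" by (auto simp: upper_triangular_def)
  then have "det ?B = 1"
    using c(2) by (subst det_upper_triangular) (auto simp: prod_list_diag_prod intro!: prod.neutral)
  finally show ?thesis by (simp add: det_four_block_one_left[OF D] det_four_block_one_right[OF A])
qed

text \<open>Both sides arise from \<open>[[1, X], [Y, 1]]\<close> by multiplying
  with \<open>[[1, 0], [-Y, 1]]\<close> on the right or on the left.\<close>

lemma det_one_minus_commute:
  fixes X :: "'a::comm_ring_1 mat"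
  assumes X: "X \<in> carrier_mat n m" and Y: "Y \<in> carrier_mat m n"
  shows "det (1\<^sub>m n - X * Y) = det (1\<^sub>m m - Y * X)"
proof -
  let ?Z = "four_block_mat (1\<^sub>m n) X Y (1\<^sub>m m)"
  let ?L = "four_block_mat (1\<^sub>m n) (0\<^sub>m n m) (- Y) (1\<^sub>m m)"
  have c: "?Z \<in> carrier_mat (n + m) (n + m)" "?L \<in> carrier_mat (n + m) (n + m)"
    using X Y by auto
  have XY: "X * Y \<in> carrier_mat n n" and YX: "Y * X \<in> carrier_mat m m" using X Y by auto
  have "1\<^sub>m n + - (X * Y) = 1\<^sub>m n - X * Y" "- (Y * X) + 1\<^sub>m m = 1\<^sub>m m - Y * X"
    "Y + - Y = 0\<^sub>m m n" "- Y + Y = 0\<^sub>m m n"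
    using X Y by (auto intro!: eq_matI simp del: index_mult_mat(1))
  note e = this
  have "?Z * ?L = four_block_mat (1\<^sub>m n - X * Y) X (0\<^sub>m m n) (1\<^sub>m m)"
    by (subst mult_four_block_mat[of _ n n _ m _ m]) (use X Y XY e in auto)
  moreover have "?L * ?Z = four_block_mat (1\<^sub>m n) X (0\<^sub>m m n) (1\<^sub>m m - Y * X)"
    by (subst mult_four_block_mat[of _ n n _ m _ m]) (use X Y YX e in auto)
  moreover have "det (?Z * ?L) = det (?L * ?Z)"
    by (simp only: det_mult[OF c] det_mult[OF c(2,1)] mult.commute)
  moreover have "det (four_block_mat (1\<^sub>m n - X * Y) X (0\<^sub>m m n) (1\<^sub>m m)) = det (1\<^sub>m n - X * Y)"
    "det (four_block_mat (1\<^sub>m n) X (0\<^sub>m m n) (1\<^sub>m m - Y * X)) = det (1\<^sub>m m - Y * X)"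
    using X XY YX by (simp_all add: det_four_block_upper[of _ n _ m] minus_carrier_mat)
  ultimately show ?thesis by simp
qed

text \<open>The characteristic polynomial read backwards, taken as a power series because the value
  of L_R is its inverse.\<close>

definition rev_char :: "'a::comm_ring_1 mat \<Rightarrow> 'a fps" where
  "rev_char M = det (1\<^sub>m (dim_row M) - fps_X \<cdot>\<^sub>m map_mat fps_const M)"

lemma fps_const_comm_ring_hom: "comm_ring_hom (fps_const :: 'a::comm_ring_1 \<Rightarrow> 'a fps)"
  by unfold_locales auto

text \<open>Sylvester's identity for tX and Y. Since the factors may be rectangular, it also
  compares matrices of different sizes.\<close>

lemma rev_char_commute:
  assumes X: "X \<in> carrier_mat n m" and Y: "Y \<in> carrier_mat m n"
  shows "rev_char (X * Y) = rev_char (Y * X)"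
proof -
  interpret comm_ring_hom "fps_const :: 'a \<Rightarrow> 'a fps" by (rule fps_const_comm_ring_hom)
  let ?X = "map_mat fps_const X" and ?Y = "map_mat fps_const Y"
  have c: "?X \<in> carrier_mat n m" "?Y \<in> carrier_mat m n" using X Y by auto
  have "rev_char (X * Y) = det (1\<^sub>m n - (fps_X \<cdot>\<^sub>m ?X) * ?Y)"
    using X Y c by (simp add: rev_char_def mat_hom_mult[OF X Y] mult_smult_assoc_mat[OF c])
  also have "\<dots> = det (1\<^sub>m m - ?Y * (fps_X \<cdot>\<^sub>m ?X))"
    by (rule det_one_minus_commute) (use c in auto)
  also have "\<dots> = rev_char (Y * X)"
    using X Y c by (simp add: rev_char_def mat_hom_mult[OF Y X] mult_smult_distrib[OF c(2,1)])
  finally show ?thesis .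
qed

lemma rev_char_four_block:
  assumes A: "A \<in> carrier_mat n n" and B: "B \<in> carrier_mat n m" and D: "D \<in> carrier_mat m m"
  shows "rev_char (four_block_mat A B (0\<^sub>m m n) D) = rev_char A * rev_char D"
proof -
  let ?f = "map_mat fps_const"
  have "1\<^sub>m (n + m) - fps_X \<cdot>\<^sub>m ?f (four_block_mat A B (0\<^sub>m m n) D)
        = four_block_mat (1\<^sub>m n - fps_X \<cdot>\<^sub>m ?f A) (- (fps_X \<cdot>\<^sub>m ?f B)) (0\<^sub>m m n) (1\<^sub>m m - fps_X \<cdot>\<^sub>m ?f D)"
    by (rule eq_matI) (use A B D in auto)
  moreover have "det \<dots> = det (1\<^sub>m n - fps_X \<cdot>\<^sub>m ?f A) * det (1\<^sub>m m - fps_X \<cdot>\<^sub>m ?f D)"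
    by (rule det_four_block_upper) (use A B D in auto)
  ultimately show ?thesis using A D by (simp add: rev_char_def)
qed

text \<open>Setting t = 0 is a ring homomorphism and turns 1 - tM into the identity matrix.\<close>

lemma rev_char_nth_0:
  assumes "M \<in> carrier_mat n n"
  shows "fps_nth (rev_char M) 0 = 1"
proof -
  interpret comm_ring_hom "\<lambda>f :: 'a fps. fps_nth f 0"
    by unfold_locales (auto simp: fps_mult_nth)
  have "map_mat (\<lambda>f. fps_nth f 0) (1\<^sub>m n - fps_X \<cdot>\<^sub>m map_mat fps_const M) = 1\<^sub>m n"
    by (rule eq_matI) (use assms in auto)
  then show ?thesis using assms by (simp add: rev_char_def flip: hom_det)
qed

lemma rev_char_zero: "rev_char (0\<^sub>m n n :: 'a::comm_ring_1 mat) = 1"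
proof -
  have "1\<^sub>m n - fps_X \<cdot>\<^sub>m map_mat fps_const (0\<^sub>m n n :: 'a mat) = 1\<^sub>m n"
    by (rule eq_matI) auto
  then show ?thesis by (simp add: rev_char_def)
qed

section \<open>Kronecker products\<close>

lemma mult_mat_vec_smult:
  fixes A :: "'a::comm_ring_1 mat"
  assumes "A \<in> carrier_mat nr nc" "v \<in> carrier_vec nc"
  shows "A *\<^sub>v (k \<cdot>\<^sub>v v) = k \<cdot>\<^sub>v (A *\<^sub>v v)"
  using assms by (intro eq_vecI) (auto simp: scalar_prod_def sum_distrib_left mult_ac intro!: sum.cong)

lemma mat_eqI_unit_vec:
  fixes A :: "'a::comm_ring_1 mat"
  assumes "A \<in> carrier_mat n m" "B \<in> carrier_mat n m"
    and eq: "\<And>j. j < m \<Longrightarrow> A *\<^sub>v unit_vec m j = B *\<^sub>v unit_vec m j"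
  shows "A = B"
proof (rule eq_matI)
  fix i j assume "i < dim_row B" "j < dim_col B"
  then have "(A *\<^sub>v unit_vec m j) $ i = A $$ (i, j)" "(B *\<^sub>v unit_vec m j) $ i = B $$ (i, j)" "j < m"
    using assms(1,2) by auto
  with eq[of j] show "A $$ (i, j) = B $$ (i, j)" by simp
qed (use assms in auto)

lemma mat_eqI_vec:
  fixes A :: "'a::comm_ring_1 mat"
  assumes "A \<in> carrier_mat n m" "B \<in> carrier_mat n m"
    and "\<And>v. v \<in> carrier_vec m \<Longrightarrow> A *\<^sub>v v = B *\<^sub>v v"
  shows "A = B"
  by (rule mat_eqI_unit_vec[OF assms(1,2)]) (auto intro: assms(3))

text \<open>Pairs of indices are encoded by quotient and remainder exactly as in
  \<open>vec_tensor\<close>, so that these matrices act factorwise on pure tensors.\<close>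

definition kron :: "'a::comm_ring_1 mat \<Rightarrow> 'a mat \<Rightarrow> 'a mat" where
  "kron A B = mat (dim_row A * dim_row B) (dim_col A * dim_col B)
     (\<lambda>(i, j). A $$ (i div dim_row B, j div dim_col B) * B $$ (i mod dim_row B, j mod dim_col B))"

lemma kron_carrier [simp]:
  "A \<in> carrier_mat n m \<Longrightarrow> B \<in> carrier_mat k l \<Longrightarrow> kron A B \<in> carrier_mat (n * k) (m * l)"
  by (auto simp: kron_def)

lemma vec_tensor_carrier [simp]:
  "x \<in> carrier_vec n \<Longrightarrow> y \<in> carrier_vec m \<Longrightarrow> vec_tensor x y \<in> carrier_vec (n * m)"
  by (auto simp: vec_tensor_def)

lemma div_mod_bounds:
  assumes "k < (n::nat) * m"
  shows "k div m < n" "k mod m < m"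
proof -
  have "m > 0" using assms by (cases m) auto
  then show "k div m < n" "k mod m < m" using assms by (auto simp: less_mult_imp_div_less)
qed

lemma sum_div_mod:
  fixes f :: "nat \<Rightarrow> nat \<Rightarrow> 'a::comm_monoid_add"
  shows "(\<Sum>k\<in>{0..<n * m}. f (k div m) (k mod m)) = (\<Sum>i\<in>{0..<n}. \<Sum>j\<in>{0..<m}. f i j)"
proof -
  have "(\<Sum>i\<in>{0..<n}. \<Sum>j\<in>{0..<m}. f i j) = (\<Sum>(i, j)\<in>{0..<n} \<times> {0..<m}. f i j)"
    by (rule sum.cartesian_product)
  also have "\<dots> = (\<Sum>k\<in>{0..<n * m}. f (k div m) (k mod m))"
  proof (rule sum.reindex_bij_witness[where i = "\<lambda>k. (k div m, k mod m)" and j = "\<lambda>(i, j). i * m + j"])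
    fix p assume p: "p \<in> {0..<n} \<times> {0..<m}"
    then obtain i j where ij: "p = (i, j)" "i < n" "j < m" by auto
    have "i * m + j < Suc i * m" using ij by simp
    also have "\<dots> \<le> n * m" using ij by (intro mult_right_mono) auto
    finally show "(case p of (i, j) \<Rightarrow> i * m + j) \<in> {0..<n * m}" using ij by simp
  qed (auto dest: div_mod_bounds)
  finally show ?thesis ..
qed

lemma kron_mult_vec:
  assumes "A \<in> carrier_mat n m" "B \<in> carrier_mat k l" "x \<in> carrier_vec m" "y \<in> carrier_vec l"
  shows "kron A B *\<^sub>v vec_tensor x y = vec_tensor (A *\<^sub>v x) (B *\<^sub>v y)"
proof (rule eq_vecI)
  fix i assume "i < dim_vec (vec_tensor (A *\<^sub>v x) (B *\<^sub>v y))"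
  then have i: "i < n * k" using assms by (auto simp: vec_tensor_def)
  note b = div_mod_bounds[OF i]
  have "(kron A B *\<^sub>v vec_tensor x y) $ i = (\<Sum>j\<in>{0..<m * l}.
      (A $$ (i div k, j div l) * x $ (j div l)) * (B $$ (i mod k, j mod l) * y $ (j mod l)))"
    using assms i by (auto simp: kron_def vec_tensor_def scalar_prod_def mult_ac intro!: sum.cong)
  also have "\<dots> = (\<Sum>p\<in>{0..<m}. \<Sum>q\<in>{0..<l}.
      (A $$ (i div k, p) * x $ p) * (B $$ (i mod k, q) * y $ q))"
    by (rule sum_div_mod)
  also have "\<dots> = vec_tensor (A *\<^sub>v x) (B *\<^sub>v y) $ i"
    using assms i b by (simp add: vec_tensor_def scalar_prod_def sum_product)
  finally show "(kron A B *\<^sub>v vec_tensor x y) $ i = vec_tensor (A *\<^sub>v x) (B *\<^sub>v y) $ i" .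
qed (use assms in \<open>auto simp: vec_tensor_def kron_def\<close>)

lemma unit_vec_tensor:
  assumes "k < n * m"
  shows "(unit_vec (n * m) k :: 'a::comm_ring_1 vec)
         = vec_tensor (unit_vec n (k div m)) (unit_vec m (k mod m))"
proof (rule eq_vecI)
  fix i assume "i < dim_vec (vec_tensor (unit_vec n (k div m)) (unit_vec m (k mod m)) :: 'a vec)"
  then have i: "i < n * m" by (simp add: vec_tensor_def)
  have "i = k \<longleftrightarrow> i div m = k div m \<and> i mod m = k mod m" by (metis div_mult_mod_eq)
  then show "(unit_vec (n * m) k :: 'a vec) $ i
    = vec_tensor (unit_vec n (k div m)) (unit_vec m (k mod m)) $ i"
    using i assms div_mod_bounds[OF i] div_mod_bounds[OF assms] by (auto simp: vec_tensor_def)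
qed (simp add: vec_tensor_def)

text \<open>Both sides agree on tensors of unit vectors, and these are the unit vectors of the
  product space.\<close>

lemma kron_mult:
  assumes "A \<in> carrier_mat n m" "B \<in> carrier_mat k l" "C \<in> carrier_mat m p" "D \<in> carrier_mat l q"
  shows "kron A B * kron C D = kron (A * C) (B * D)"
proof (rule mat_eqI_unit_vec[where n = "n * k" and m = "p * q"])
  fix j assume j: "j < p * q"
  let ?x = "unit_vec p (j div q) :: 'a vec" and ?y = "unit_vec q (j mod q) :: 'a vec"
  have "(kron A B * kron C D) *\<^sub>v vec_tensor ?x ?y = kron A B *\<^sub>v (kron C D *\<^sub>v vec_tensor ?x ?y)"
    by (rule assoc_mult_mat_vec[of _ "n * k" "m * l" _ "p * q"]) (use assms in auto)
  also have "\<dots> = vec_tensor (A *\<^sub>v (C *\<^sub>v ?x)) (B *\<^sub>v (D *\<^sub>v ?y))"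
    using assms by (simp add: kron_mult_vec[of _ m p _ l q] kron_mult_vec[of _ n m _ k l])
  also have "\<dots> = kron (A * C) (B * D) *\<^sub>v vec_tensor ?x ?y"
    using assms by (simp add: kron_mult_vec[of _ n p _ k q] assoc_mult_mat_vec[of _ n m _ p]
        assoc_mult_mat_vec[of _ k l _ q])
  finally show "kron A B * kron C D *\<^sub>v unit_vec (p * q) j = kron (A * C) (B * D) *\<^sub>v unit_vec (p * q) j"
    by (simp add: unit_vec_tensor[OF j])
qed (use assms in \<open>auto intro!: mult_carrier_mat[of _ "n * k" "m * l"] kron_carrier[of _ n p]\<close>)

lemma kron_add_left:
  assumes "A \<in> carrier_mat n m" "A' \<in> carrier_mat n m" "B \<in> carrier_mat k l"
  shows "kron (A + A') B = kron A B + kron A' B"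
  by (rule eq_matI) (use assms in \<open>auto simp: kron_def div_mod_bounds distrib_right\<close>)

lemma kron_add_right:
  assumes "A \<in> carrier_mat n m" "B \<in> carrier_mat k l" "B' \<in> carrier_mat k l"
  shows "kron A (B + B') = kron A B + kron A B'"
  by (rule eq_matI) (use assms in \<open>auto simp: kron_def div_mod_bounds distrib_left\<close>)

lemma kron_zero_left: "B \<in> carrier_mat k l \<Longrightarrow> kron (0\<^sub>m n m) B = 0\<^sub>m (n * k) (m * l)"
  by (rule eq_matI) (auto simp: kron_def div_mod_bounds)

lemma kron_zero_right: "A \<in> carrier_mat n m \<Longrightarrow> kron A (0\<^sub>m k l) = 0\<^sub>m (n * k) (m * l)"
  by (rule eq_matI) (auto simp: kron_def div_mod_bounds)

section \<open>Endomorphisms as matrices\<close>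

declare assoc_mult_mat [simp del] assoc_mult_mat_vec [simp del]

lemma mult_mat_mat_vec:
  fixes A :: "'a::comm_ring_1 mat"
  shows "A \<in> carrier_mat n m \<Longrightarrow> B \<in> carrier_mat m k \<Longrightarrow> v \<in> carrier_vec k
    \<Longrightarrow> A *\<^sub>v (B *\<^sub>v v) = (A * B) *\<^sub>v v"
  by (rule assoc_mult_mat_vec[symmetric])

lemma smult_zero_vec: "v \<in> carrier_vec n \<Longrightarrow> (0 :: 'a::comm_ring_1) \<cdot>\<^sub>v v = 0\<^sub>v n"
  by (rule eq_vecI) auto

lemma zero_mat_mult_vec [simp]: "v \<in> carrier_vec m \<Longrightarrow> 0\<^sub>m n m *\<^sub>v v = (0\<^sub>v n :: 'a::comm_ring_1 vec)"
  by (rule eq_vecI) auto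

lemma mat_mult_zero_vec [simp]:
  "A \<in> carrier_mat n m \<Longrightarrow> A *\<^sub>v 0\<^sub>v m = (0\<^sub>v n :: 'a::comm_ring_1 vec)"
  by (rule eq_vecI) auto

lemma vec_unit_induct [consumes 1, case_names zero step]:
  fixes x :: "'a::comm_ring_1 vec"
  assumes x: "x \<in> carrier_vec n"
    and zero: "P (0\<^sub>v n)"
    and step: "\<And>y k c. y \<in> carrier_vec n \<Longrightarrow> P y \<Longrightarrow> k < n \<Longrightarrow> P (y + c \<cdot>\<^sub>v unit_vec n k)"
  shows "P x"
proof -
  \<comment> \<open>\<open>P\<close> is shown for the truncations of \<open>x\<close> to its first
    \<open>k\<close> coordinates, each obtained from the previous one by one
    \<open>step\<close>.\<close>
  have "P (vec n (\<lambda>j. if j < k then x $ j else 0))" if "k \<le> n" for k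
    using that
  proof (induction k)
    case 0
    have "vec n (\<lambda>j. if j < 0 then x $ j else 0) = 0\<^sub>v n" by (rule eq_vecI) auto
    then show ?case using zero by simp
  next
    case (Suc k)
    have "vec n (\<lambda>j. if j < Suc k then x $ j else 0)
          = vec n (\<lambda>j. if j < k then x $ j else 0) + x $ k \<cdot>\<^sub>v unit_vec n k"
      by (rule eq_vecI) (use Suc.prems in \<open>auto simp: less_Suc_eq\<close>)
    then show ?case using Suc step by simp
  qed
  moreover have "vec n (\<lambda>j. if j < n then x $ j else 0) = x" by (rule eq_vecI) (use x in auto)
  ultimately show ?thesis by (metis order_refl)
qed

lemma linear_eq_on_unit_vecs:
  fixes f g :: "'a::comm_ring_1 vec \<Rightarrow> 'a vec"
  assumes f: "\<And>x. x \<in> carrier_vec n \<Longrightarrow> f x \<in> carrier_vec m"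
    and add: "\<And>x y. x \<in> carrier_vec n \<Longrightarrow> y \<in> carrier_vec n \<Longrightarrow> f (x + y) = f x + f y"
    and smult: "\<And>c x. x \<in> carrier_vec n \<Longrightarrow> f (c \<cdot>\<^sub>v x) = c \<cdot>\<^sub>v f x"
    and M: "M \<in> carrier_mat m n" "\<And>j. j < n \<Longrightarrow> f (unit_vec n j) = M *\<^sub>v unit_vec n j"
    and x: "x \<in> carrier_vec n"
  shows "f x = M *\<^sub>v x"
  using x
proof (induction x rule: vec_unit_induct)
  case zero
  have "f (0 \<cdot>\<^sub>v 0\<^sub>v n) = 0 \<cdot>\<^sub>v f (0\<^sub>v n)" by (rule smult) simp
  moreover have "0 \<cdot>\<^sub>v 0\<^sub>v n = (0\<^sub>v n :: 'a vec)" by auto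
  ultimately have "f (0\<^sub>v n) = 0\<^sub>v m" using f[of "0\<^sub>v n"] by (simp add: smult_zero_vec)
  then show ?case using M by (auto simp: vec_eq_iff)
next
  case (step y k c)
  then show ?case using M
    by (simp add: add smult mult_add_distrib_mat_vec[of _ m n] mult_mat_vec_smult[of _ m n])
qed

lemma linear_matrix:
  fixes f :: "'a::comm_ring_1 vec \<Rightarrow> 'a vec"
  assumes f: "\<And>x. x \<in> carrier_vec n \<Longrightarrow> f x \<in> carrier_vec m"
    and add: "\<And>x y. x \<in> carrier_vec n \<Longrightarrow> y \<in> carrier_vec n \<Longrightarrow> f (x + y) = f x + f y"
    and smult: "\<And>c x. x \<in> carrier_vec n \<Longrightarrow> f (c \<cdot>\<^sub>v x) = c \<cdot>\<^sub>v f x"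
  shows "\<exists>M\<in>carrier_mat m n. \<forall>x\<in>carrier_vec n. f x = M *\<^sub>v x"
proof -
  let ?M = "mat m n (\<lambda>(i, j). f (unit_vec n j) $ i)"
  have M: "?M \<in> carrier_mat m n" by simp
  have *: "f (unit_vec n j) = ?M *\<^sub>v unit_vec n j" if "j < n" for j
    using f[of "unit_vec n j"] that by (auto simp: vec_eq_iff)
  have "f x = ?M *\<^sub>v x" if "x \<in> carrier_vec n" for x
    by (rule linear_eq_on_unit_vecs[OF f add smult M * that])
  then show ?thesis using M by blast
qed

lemma matrix_of_columns:
  assumes "\<And>j. j < n \<Longrightarrow> c j \<in> carrier_vec m"
  obtains M :: "'a::comm_ring_1 mat"
    where "M \<in> carrier_mat m n" "\<And>j. j < n \<Longrightarrow> M *\<^sub>v unit_vec n j = c j"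
proof -
  let ?M = "mat m n (\<lambda>(i, j). c j $ i)"
  have "?M *\<^sub>v unit_vec n j = c j" if "j < n" for j
    using assms[OF that] that by (auto simp: vec_eq_iff)
  then show ?thesis using that[of ?M] by simp
qed

section \<open>Direct summands of free modules as idempotent matrices\<close>

lemma module_hom_iff:
  "f \<in> module_hom class_ring (sub_vec n E) (sub_vec m F) \<longleftrightarrow>
     (\<forall>x\<in>E. f x \<in> F) \<and> (\<forall>x\<in>E. \<forall>y\<in>E. f (x + y) = f x + f y) \<and> (\<forall>c. \<forall>x\<in>E. f (c \<cdot>\<^sub>v x) = c \<cdot>\<^sub>v f x)"
  by (auto simp: LinearCombinations.module_hom_def module_vec_simps Pi_def)

lemma submodule_iff:
  fixes E :: "'r::comm_ring_1 vec set"
  shows "submodule class_ring E (module_vec TYPE('r) n) \<longleftrightarrow>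
    E \<subseteq> carrier_vec n \<and> 0\<^sub>v n \<in> E \<and> (\<forall>x\<in>E. \<forall>y\<in>E. x + y \<in> E) \<and> (\<forall>c. \<forall>x\<in>E. c \<cdot>\<^sub>v x \<in> E)"
proof -
  interpret vec_module "TYPE('r)" n .
  have "Module.module class_ring (module_vec TYPE('r) n)" ..
  then show ?thesis by (auto simp: LinearCombinations.submodule_def module_vec_simps)
qed

lemma submodule_minus:
  fixes E :: "'r::comm_ring_1 vec set"
  assumes "submodule class_ring E (module_vec TYPE('r) n)" "x \<in> E" "y \<in> E"
  shows "x - y \<in> E"
proof -
  have "x - y = x + (-1) \<cdot>\<^sub>v y"
    by (rule eq_vecI) (use assms in \<open>auto simp: submodule_iff\<close>)
  then show ?thesis using assms by (auto simp: submodule_iff)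
qed

text \<open>Direct summands of R^n are the images of idempotents. For an idempotent the image is the
  set of fixed vectors, which makes membership an equation.\<close>

definition fixed_vecs :: "'a::comm_ring_1 mat \<Rightarrow> 'a vec set" where
  "fixed_vecs p = {v \<in> carrier_vec (dim_row p). p *\<^sub>v v = v}"

text \<open>\<open>p\<close> is a projection of \<open>R\<^sup>n\<close> onto \<open>E\<close>, and \<open>M\<close> is the matrix of \<open>f \<circ> p\<close>.\<close>

definition endo_rep :: "'r::comm_ring_1 endo \<Rightarrow> 'r mat \<Rightarrow> 'r mat \<Rightarrow> bool" where
  "endo_rep x p M \<longleftrightarrow> (case x of (n, E, f) \<Rightarrow>
     p \<in> carrier_mat n n \<and> M \<in> carrier_mat n n \<and> p * p = p \<and> M * p = M \<and> p * M = M \<and>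
     E = fixed_vecs p \<and> (\<forall>v\<in>E. f v = M *\<^sub>v v))"

lemma endo_repD:
  assumes "endo_rep (n, E, f) p M"
  shows "p \<in> carrier_mat n n" "M \<in> carrier_mat n n" "p * p = p" "M * p = M" "p * M = M"
    "E = fixed_vecs p" "\<And>v. v \<in> E \<Longrightarrow> v \<in> carrier_vec n" "\<And>v. v \<in> E \<Longrightarrow> p *\<^sub>v v = v"
    "\<And>v. v \<in> E \<Longrightarrow> f v = M *\<^sub>v v"
    "\<And>v. v \<in> carrier_vec n \<Longrightarrow> p *\<^sub>v v \<in> E" "\<And>v. v \<in> carrier_vec n \<Longrightarrow> M *\<^sub>v v \<in> E"
proof -
  show *: "p \<in> carrier_mat n n" "M \<in> carrier_mat n n" "p * p = p" "M * p = M" "p * M = M"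
    "E = fixed_vecs p" "\<And>v. v \<in> E \<Longrightarrow> v \<in> carrier_vec n" "\<And>v. v \<in> E \<Longrightarrow> p *\<^sub>v v = v"
    "\<And>v. v \<in> E \<Longrightarrow> f v = M *\<^sub>v v"
    using assms by (auto simp: endo_rep_def fixed_vecs_def)
  show "p *\<^sub>v v \<in> E" if "v \<in> carrier_vec n" for v
    using that *(1,3,6) by (simp add: fixed_vecs_def mult_mat_mat_vec[of _ n n _ n])
  show "M *\<^sub>v v \<in> E" if "v \<in> carrier_vec n" for v
    using that *(1,2,5,6) by (simp add: fixed_vecs_def mult_mat_mat_vec[of _ n n _ n])
qed

lemma endo_rep_fixed_vecs:
  assumes "p \<in> carrier_mat n n" "M \<in> carrier_mat n n" "p * p = p" "M * p = M" "p * M = M"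
  shows "endo_rep (n, fixed_vecs p, \<lambda>v. M *\<^sub>v v) p M"
  using assms by (simp add: endo_rep_def)

text \<open>The kernel of the idempotent \<open>p\<close> is a complement, by v = pv + (v -
  pv).\<close>

lemma endo_rep_imp_endos:
  fixes x :: "'r::comm_ring_1 endo"
  assumes "endo_rep x p M"
  shows "x \<in> endos"
proof (cases x)
  case (fields n E f)
  note r = endo_repD[OF assms[unfolded fields]]
  let ?F = "{v \<in> carrier_vec n. p *\<^sub>v v = 0\<^sub>v n}"
  have E: "E = {v \<in> carrier_vec n. p *\<^sub>v v = v}" using r(1,6) by (auto simp: fixed_vecs_def)
  have p0: "p *\<^sub>v 0\<^sub>v n = 0\<^sub>v n" using r(1) by (auto simp: vec_eq_iff)
  have "submodule class_ring E (module_vec TYPE('r) n)"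
    unfolding submodule_iff E using r(1) p0
    by (auto simp: mult_add_distrib_mat_vec[of _ n n] mult_mat_vec_smult[of _ n n])
  moreover have "submodule class_ring ?F (module_vec TYPE('r) n)"
    unfolding submodule_iff using r(1) p0
    by (auto simp: mult_add_distrib_mat_vec[of _ n n] mult_mat_vec_smult[of _ n n])
  moreover have "E \<inter> ?F = {0\<^sub>v n}" unfolding E using p0 by auto
  moreover have "{x + y | x y. x \<in> E \<and> y \<in> ?F} = carrier_vec n"
  proof (intro equalityI subsetI)
    fix v :: "'r vec" assume v: "v \<in> carrier_vec n"
    have "v = p *\<^sub>v v + (v - p *\<^sub>v v)" using v r(1) by (auto simp: vec_eq_iff)
    moreover have "v - p *\<^sub>v v \<in> ?F" using v r(1,3)
      by (simp add: mult_minus_distrib_mat_vec[of _ n n] mult_mat_mat_vec[of _ n n _ n])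
    ultimately show "v \<in> {x + y | x y. x \<in> E \<and> y \<in> ?F}" using r(10)[OF v] by blast
  qed (use r(7) in auto)
  ultimately have "complementary n E ?F" by (simp add: complementary_def)
  moreover have "f \<in> module_hom class_ring (sub_vec n E) (sub_vec n E)"
  proof -
    have "x + y \<in> E" "c \<cdot>\<^sub>v x \<in> E" if "x \<in> E" "y \<in> E" for x y c
      using \<open>submodule class_ring E (module_vec TYPE('r) n)\<close> that by (auto simp: submodule_iff)
    then show ?thesis unfolding module_hom_iff
      using r(2,7,9,11) by (auto simp: mult_add_distrib_mat_vec[of _ n n] mult_mat_vec_smult[of _ n n])
  qed
  ultimately show ?thesis unfolding fields endos_def by blast
qed

lemma vec_add_swap:
  fixes a b c d :: "'a::comm_ring_1 vec"
  assumes "a \<in> carrier_vec n" "c \<in> carrier_vec n" "b \<in> carrier_vec n" "d \<in> carrier_vec n"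
  shows "(a + b) + (c + d) = (a + c) + (b + d)"
  by (rule eq_vecI) (use assms in \<open>auto simp: algebra_simps\<close>)

text \<open>The projection along \<open>F\<close> sends x + y to x. Uniqueness of the decomposition
  makes this well defined and linear, hence given by a matrix.\<close>

lemma complementary_projection:
  fixes E :: "'r::comm_ring_1 vec set"
  assumes "complementary n E F"
  obtains p where "p \<in> carrier_mat n n" "\<And>v. v \<in> carrier_vec n \<Longrightarrow> p *\<^sub>v v \<in> E"
    "\<And>v. v \<in> E \<Longrightarrow> p *\<^sub>v v = v" "\<And>v. v \<in> F \<Longrightarrow> p *\<^sub>v v = 0\<^sub>v n" "E = fixed_vecs p"
proof -
  have sE: "submodule class_ring E (module_vec TYPE('r) n)"
    and sF: "submodule class_ring F (module_vec TYPE('r) n)"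
    and EF: "E \<inter> F = {0\<^sub>v n}" and sum: "{x + y | x y. x \<in> E \<and> y \<in> F} = carrier_vec n"
    using assms by (auto simp: complementary_def)
  have Ec: "v \<in> E \<Longrightarrow> v \<in> carrier_vec n" and Fc: "v \<in> F \<Longrightarrow> v \<in> carrier_vec n" for v
    using sE sF by (auto simp: submodule_iff)
  have E: "\<And>x y. x \<in> E \<Longrightarrow> y \<in> E \<Longrightarrow> x + y \<in> E" "\<And>c x. x \<in> E \<Longrightarrow> c \<cdot>\<^sub>v x \<in> E"
    using sE by (auto simp: submodule_iff)
  have F: "\<And>x y. x \<in> F \<Longrightarrow> y \<in> F \<Longrightarrow> x + y \<in> F" "\<And>c x. x \<in> F \<Longrightarrow> c \<cdot>\<^sub>v x \<in> F"
    using sF by (auto simp: submodule_iff)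
  have "0\<^sub>v n \<in> E" "0\<^sub>v n \<in> F" using sE sF by (auto simp: submodule_iff)
  have unique: "x = x'" if "x \<in> E" "y \<in> F" "x' \<in> E" "y' \<in> F" "x + y = x' + y'" for x x' y y'
  proof -
    have c: "x \<in> carrier_vec n" "x' \<in> carrier_vec n" "y \<in> carrier_vec n" "y' \<in> carrier_vec n"
      using that Ec Fc by auto
    have "x - x' = y' - y"
    proof (rule eq_vecI)
      fix i assume i: "i < dim_vec (y' - y)"
      have "(x + y) $ i = (x' + y') $ i" using that by simp
      then show "(x - x') $ i = (y' - y) $ i" using i c by (simp add: algebra_simps)
    qed (use c in auto)
    moreover have "x - x' \<in> E" "y' - y \<in> F" using that sE sF by (auto intro: submodule_minus)
    ultimately have "x - x' = 0\<^sub>v n" using EF by auto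
    then show "x = x'" using c by (auto simp: vec_eq_iff)
  qed
  define e where "e v = (SOME x. x \<in> E \<and> (\<exists>y\<in>F. v = x + y))" for v
  have e: "e v \<in> E \<and> (\<exists>y\<in>F. v = e v + y)" if "v \<in> carrier_vec n" for v
    unfolding e_def by (rule someI_ex) (use that sum in blast)
  have eI: "e v = x" if "x \<in> E" "y \<in> F" "v = x + y" for v x y
  proof -
    have "v \<in> carrier_vec n" using that Ec Fc by auto
    with e[of v] obtain y' where "e v \<in> E" "y' \<in> F" "v = e v + y'" by blast
    then show ?thesis using unique[of "e v" y' x y] that by simp
  qed
  have "e v \<in> carrier_vec n" if "v \<in> carrier_vec n" for v using e[OF that] Ec by auto
  moreover have "e (v + w) = e v + e w" if vw: "v \<in> carrier_vec n" "w \<in> carrier_vec n" for v w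
  proof -
    obtain y z where yz: "y \<in> F" "v = e v + y" "z \<in> F" "w = e w + z"
      using e[OF vw(1)] e[OF vw(2)] by blast
    have ev: "e v \<in> E" "e w \<in> E" using e vw by auto
    have "(e v + y) + (e w + z) = (e v + e w) + (y + z)"
      using Ec[OF ev(1)] Ec[OF ev(2)] Fc[OF yz(1)] Fc[OF yz(3)] by (rule vec_add_swap)
    then have "v + w = (e v + e w) + (y + z)" by (simp only: yz(2,4)[symmetric])
    then show ?thesis using ev yz(1,3) by (intro eI[of _ "y + z"] E F)
  qed
  moreover have "e (c \<cdot>\<^sub>v v) = c \<cdot>\<^sub>v e v" if v: "v \<in> carrier_vec n" for c v
  proof -
    obtain y where y: "y \<in> F" "v = e v + y" using e[OF v] by blast
    have "c \<cdot>\<^sub>v (e v + y) = c \<cdot>\<^sub>v e v + c \<cdot>\<^sub>v y"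
      by (rule smult_add_distrib_vec[of _ n]) (use e[OF v] y Ec Fc in auto)
    then have "c \<cdot>\<^sub>v v = c \<cdot>\<^sub>v e v + c \<cdot>\<^sub>v y" by (simp only: y(2)[symmetric])
    then show ?thesis using e[OF v] y(1) by (intro eI[of _ "c \<cdot>\<^sub>v y"] E F) auto
  qed
  ultimately have "\<exists>M\<in>carrier_mat n n. \<forall>v\<in>carrier_vec n. e v = M *\<^sub>v v"
    by (rule linear_matrix)
  then obtain p where p: "p \<in> carrier_mat n n" "\<And>v. v \<in> carrier_vec n \<Longrightarrow> e v = p *\<^sub>v v"
    by blast
  have pE: "p *\<^sub>v v \<in> E" if "v \<in> carrier_vec n" for v using e[OF that] p(2)[OF that] by auto
  have pid: "p *\<^sub>v v = v" if "v \<in> E" for v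
  proof -
    have "e v = v" by (rule eI[of _ "0\<^sub>v n"]) (use that \<open>0\<^sub>v n \<in> F\<close> Ec in auto)
    then show ?thesis using p(2)[OF Ec[OF that]] by simp
  qed
  have pF: "p *\<^sub>v v = 0\<^sub>v n" if "v \<in> F" for v
  proof -
    have "e v = 0\<^sub>v n" by (rule eI[of _ v]) (use that \<open>0\<^sub>v n \<in> E\<close> Fc in auto)
    then show ?thesis using p(2)[OF Fc[OF that]] by simp
  qed
  have "E = fixed_vecs p"
  proof (intro equalityI subsetI)
    fix v assume "v \<in> fixed_vecs p"
    then show "v \<in> E" using p(1) pE[of v] by (auto simp: fixed_vecs_def)
  qed (use p(1) pid Ec in \<open>auto simp: fixed_vecs_def\<close>)
  then show ?thesis using that p(1) pE pid pF by blast
qed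

text \<open>A matrix extending \<open>f\<close> by zero on \<open>F\<close> equals f p for the
  projection p along \<open>F\<close>; the matrix identities follow by evaluation on vectors. It
  applies to any complement, also to the unspecified one in \<open>endo_mat\<close>.\<close>

lemma endo_rep_of_complement:
  assumes f: "f \<in> module_hom class_ring (sub_vec n E) (sub_vec n E)" and c: "complementary n E F"
    and M: "M \<in> carrier_mat n n" "\<forall>v\<in>E. M *\<^sub>v v = f v" "\<forall>v\<in>F. M *\<^sub>v v = 0\<^sub>v n"
  shows "\<exists>p. endo_rep (n, E, f) p M"
proof -
  obtain p where p: "p \<in> carrier_mat n n" "\<And>v. v \<in> carrier_vec n \<Longrightarrow> p *\<^sub>v v \<in> E"
    "\<And>v. v \<in> E \<Longrightarrow> p *\<^sub>v v = v" "\<And>v. v \<in> F \<Longrightarrow> p *\<^sub>v v = 0\<^sub>v n" "E = fixed_vecs p"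
    by (rule complementary_projection[OF c]) blast
  have Ec: "v \<in> carrier_vec n" if "v \<in> E" for v using that p(1,5) by (auto simp: fixed_vecs_def)
  have Fc: "v \<in> carrier_vec n" if "v \<in> F" for v using that c by (auto simp: complementary_def submodule_iff)
  have split: "M *\<^sub>v v = f (p *\<^sub>v v)" if "v \<in> carrier_vec n" for v
  proof -
    obtain x y where xy: "x \<in> E" "y \<in> F" "v = x + y"
      using c \<open>v \<in> carrier_vec n\<close> unfolding complementary_def by blast
    have "M *\<^sub>v v = f x + 0\<^sub>v n" using xy M Ec Fc by (simp add: mult_add_distrib_mat_vec[of _ n n])
    moreover have "p *\<^sub>v v = x + 0\<^sub>v n" using xy p Ec Fc by (simp add: mult_add_distrib_mat_vec[of _ n n])
    moreover have "f x \<in> E" using f xy by (auto simp: module_hom_iff)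
    ultimately show ?thesis using Ec xy by auto
  qed
  have fE: "f v \<in> E" if "v \<in> E" for v using f that by (auto simp: module_hom_iff)
  have "p * p = p"
  proof (rule mat_eqI_vec[of _ n n])
    fix v :: "'a vec" assume v: "v \<in> carrier_vec n"
    show "p * p *\<^sub>v v = p *\<^sub>v v"
      using p(3)[OF p(2)[OF v]] p(1) v by (simp add: assoc_mult_mat_vec[of _ n n _ n])
  qed (use p(1) in auto)
  moreover have "M * p = M"
  proof (rule mat_eqI_vec[of _ n n])
    fix v :: "'a vec" assume v: "v \<in> carrier_vec n"
    show "M * p *\<^sub>v v = M *\<^sub>v v"
      using split[OF v] M(2) p(2)[OF v] p(1) M(1) v by (simp add: assoc_mult_mat_vec[of _ n n _ n])
  qed (use p(1) M(1) in auto)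
  moreover have "p * M = M"
  proof (rule mat_eqI_vec[of _ n n])
    fix v :: "'a vec" assume v: "v \<in> carrier_vec n"
    show "p * M *\<^sub>v v = M *\<^sub>v v"
      using split[OF v] p(3)[OF fE[OF p(2)[OF v]]] p(1) M(1) v
      by (simp add: assoc_mult_mat_vec[of _ n n _ n])
  qed (use p(1) M(1) in auto)
  ultimately have "endo_rep (n, E, f) p M" using p(1,5) M by (simp add: endo_rep_def)
  then show ?thesis ..
qed

text \<open>The matrix of f p shows that the choice in \<open>endo_mat\<close> is possible. The
  chosen matrix may belong to a complement other than \<open>F\<close>, so its projection is
  recovered from the defining property of the choice.\<close>

lemma endo_rep_endo_mat:
  fixes x :: "'r::comm_ring_1 endo"
  assumes "x \<in> endos"
  obtains p where "endo_rep x p (endo_mat x)"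
proof (cases x)
  case (fields n E f)
  obtain F where F: "complementary n E F" and f: "f \<in> module_hom class_ring (sub_vec n E) (sub_vec n E)"
    using assms by (auto simp: fields endos_def)
  obtain p where p: "p \<in> carrier_mat n n" "\<And>v. v \<in> carrier_vec n \<Longrightarrow> p *\<^sub>v v \<in> E"
    "\<And>v. v \<in> E \<Longrightarrow> p *\<^sub>v v = v" "\<And>v. v \<in> F \<Longrightarrow> p *\<^sub>v v = 0\<^sub>v n" "E = fixed_vecs p"
    by (rule complementary_projection[OF F]) blast
  have E: "v \<in> carrier_vec n" "f v \<in> carrier_vec n" if "v \<in> E" for v
    using that p(1,5) f by (auto simp: fixed_vecs_def module_hom_iff)
  have E0: "0\<^sub>v n \<in> E" "v \<in> F \<Longrightarrow> v \<in> carrier_vec n" for v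
    using F by (auto simp: complementary_def submodule_iff)
  have "f (0 \<cdot>\<^sub>v 0\<^sub>v n) = 0 \<cdot>\<^sub>v f (0\<^sub>v n)" using f E0 unfolding module_hom_iff by blast
  moreover have "0 \<cdot>\<^sub>v 0\<^sub>v n = (0\<^sub>v n :: 'r vec)" by auto
  ultimately have f0: "f (0\<^sub>v n) = 0\<^sub>v n" using E(2)[OF E0(1)] by (simp add: smult_zero_vec)
  have "\<exists>M\<in>carrier_mat n n. \<forall>v\<in>carrier_vec n. f (p *\<^sub>v v) = M *\<^sub>v v"
  proof (rule linear_matrix)
    fix v w :: "'r vec" and c assume v: "v \<in> carrier_vec n"
    show "f (p *\<^sub>v v) \<in> carrier_vec n" using E p v by auto
    show "f (p *\<^sub>v (c \<cdot>\<^sub>v v)) = c \<cdot>\<^sub>v f (p *\<^sub>v v)"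
      using p(1,2) v f by (simp add: mult_mat_vec_smult[of _ n n] module_hom_iff)
    assume w: "w \<in> carrier_vec n"
    show "f (p *\<^sub>v (v + w)) = f (p *\<^sub>v v) + f (p *\<^sub>v w)"
      using p(1,2) v w f by (simp add: mult_add_distrib_mat_vec[of _ n n] module_hom_iff)
  qed
  then obtain M where M: "M \<in> carrier_mat n n"
    "\<And>v. v \<in> carrier_vec n \<Longrightarrow> f (p *\<^sub>v v) = M *\<^sub>v v" by blast
  have M1: "\<forall>v\<in>E. M *\<^sub>v v = f v" using M(2) E p(3) by metis
  have M2: "\<forall>v\<in>F. M *\<^sub>v v = 0\<^sub>v n" using M(2) E0 p(4) f0 by metis
  have "endo_mat x \<in> carrier_mat n n \<and> (\<exists>F. complementary n E F \<and>
      (\<forall>v\<in>E. endo_mat x *\<^sub>v v = f v) \<and> (\<forall>v\<in>F. endo_mat x *\<^sub>v v = 0\<^sub>v n))"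
    unfolding fields endo_mat.simps by (rule someI_ex) (use M(1) M1 M2 F in blast)
  then show ?thesis using endo_rep_of_complement[OF f] that unfolding fields by blast
qed

text \<open>A short exact sequence of projective modules splits (over \<open>R\<close>): \<open>I\<close> and \<open>P\<close> are the matrices of its
  maps, \<open>S\<close> that of a section of \<open>P\<close> and \<open>J\<close> that of the corresponding retraction of \<open>I\<close>.\<close>

definition matrix_exact ::
  "'r::comm_ring_1 mat \<Rightarrow> 'r mat \<Rightarrow> 'r mat \<Rightarrow> 'r mat \<Rightarrow> 'r mat \<Rightarrow> 'r mat \<Rightarrow>
   'r mat \<Rightarrow> 'r mat \<Rightarrow> 'r mat \<Rightarrow> 'r mat \<Rightarrow> bool" where
  "matrix_exact p1 M1 p M p2 M2 I P S J \<longleftrightarrow>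
     I \<in> carrier_mat (dim_row p) (dim_row p1) \<and> P \<in> carrier_mat (dim_row p2) (dim_row p) \<and>
     S \<in> carrier_mat (dim_row p) (dim_row p2) \<and> J \<in> carrier_mat (dim_row p1) (dim_row p) \<and>
     J * I = p1 \<and> P * S = p2 \<and> P * I = 0\<^sub>m (dim_row p2) (dim_row p1) \<and> I * J + S * P = p \<and>
     I * p1 = I \<and> p2 * P = P \<and> M * I = I * M1 \<and> P * M = M2 * P"

text \<open>All but the last two facts are the definition with dimensions filled in. The identities
  p I = I and P p = P come from multiplying IJ + SP = p by I on the right and by P on the
  left.\<close>

lemma matrix_exactD:
  assumes "matrix_exact p1 M1 p M p2 M2 I P S J"
    and p: "p1 \<in> carrier_mat n1 n1" "p \<in> carrier_mat n n" "p2 \<in> carrier_mat n2 n2"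
  shows "I \<in> carrier_mat n n1" "P \<in> carrier_mat n2 n" "S \<in> carrier_mat n n2" "J \<in> carrier_mat n1 n"
    "J * I = p1" "P * S = p2" "P * I = 0\<^sub>m n2 n1" "I * J + S * P = p"
    "I * p1 = I" "p2 * P = P" "M * I = I * M1" "P * M = M2 * P" "p * I = I" "P * p = P"
proof -
  show *: "I \<in> carrier_mat n n1" "P \<in> carrier_mat n2 n" "S \<in> carrier_mat n n2" "J \<in> carrier_mat n1 n"
    "J * I = p1" "P * S = p2" "P * I = 0\<^sub>m n2 n1" "I * J + S * P = p"
    "I * p1 = I" "p2 * P = P" "M * I = I * M1" "P * M = M2 * P"
    using assms by (auto simp: matrix_exact_def)
  note c = *(1-4)
  have "p * I = I * J * I + S * P * I"
    using c by (simp add: *(8)[symmetric] add_mult_distrib_mat[of _ n n])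
  also have "\<dots> = I * (J * I) + S * (P * I)"
    using c by (simp add: assoc_mult_mat[of I n n1 J n I n1] assoc_mult_mat[of S n n2 P n I n1])
  also have "\<dots> = I" using c by (simp add: *(5,7,9))
  finally show "p * I = I" .
  have "P * p = P * (I * J) + P * (S * P)"
    using c by (simp add: *(8)[symmetric] mult_add_distrib_mat[of P n2 n "I * J" n "S * P"])
  also have "\<dots> = P * I * J + P * S * P"
    using c by (simp add: assoc_mult_mat[of P n2 n I n1 J n] assoc_mult_mat[of P n2 n S n2 P n])
  also have "\<dots> = P" using c by (simp add: *(6,7,10))
  finally show "P * p = P" .
qed

text \<open>\<open>J\<close> inverts \<open>I\<close> on the first module, IJ + SP = p shows that a
  vector killed by \<open>P\<close> comes from \<open>I\<close>, and p S y is a preimage of y under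
  \<open>P\<close>.\<close>

lemma short_exactI:
  assumes r1: "endo_rep x1 p1 M1" and r: "endo_rep x p M" and r2: "endo_rep x2 p2 M2"
    and ex: "matrix_exact p1 M1 p M p2 M2 I P S J"
  shows "short_exact x1 x x2"
proof -
  obtain n1 E1 f1 n E f n2 E2 f2 where x: "x1 = (n1, E1, f1)" "x = (n, E, f)" "x2 = (n2, E2, f2)"
    by (metis prod_cases3)
  note r1 = endo_repD[OF r1[unfolded x(1)]] and r = endo_repD[OF r[unfolded x(2)]]
    and r2 = endo_repD[OF r2[unfolded x(3)]]
  note e = matrix_exactD[OF ex r1(1) r(1) r2(1)]
  have E: "v \<in> E \<longleftrightarrow> v \<in> carrier_vec n \<and> p *\<^sub>v v = v" for v
    using r(1,6) by (auto simp: fixed_vecs_def)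
  have E1: "v \<in> E1 \<longleftrightarrow> v \<in> carrier_vec n1 \<and> p1 *\<^sub>v v = v" for v
    using r1(1,6) by (auto simp: fixed_vecs_def)
  have E2: "v \<in> E2 \<longleftrightarrow> v \<in> carrier_vec n2 \<and> p2 *\<^sub>v v = v" for v
    using r2(1,6) by (auto simp: fixed_vecs_def)
  have IE: "I *\<^sub>v v \<in> E" if "v \<in> carrier_vec n1" for v
    unfolding E using that e(1,13) r(1) by (simp add: mult_mat_mat_vec[of _ n n _ n1])
  have PE: "P *\<^sub>v v \<in> E2" if "v \<in> carrier_vec n" for v
    unfolding E2 using that e(2,10) r2(1) by (simp add: mult_mat_mat_vec[of _ n2 n2 _ n])
  have JI: "J *\<^sub>v (I *\<^sub>v v) = v" if "v \<in> E1" for v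
    using that e(1,4,5) unfolding E1 by (simp add: mult_mat_mat_vec[of _ n1 n _ n1])
  have "(\<lambda>v. I *\<^sub>v v) \<in> module_hom class_ring (sub_vec n1 E1) (sub_vec n E)"
    unfolding module_hom_iff using IE e(1) r1(7)
    by (auto simp: mult_add_distrib_mat_vec[of _ n n1] mult_mat_vec_smult[of _ n n1])
  moreover have "(\<lambda>v. P *\<^sub>v v) \<in> module_hom class_ring (sub_vec n E) (sub_vec n2 E2)"
    unfolding module_hom_iff using PE e(2) r(7)
    by (auto simp: mult_add_distrib_mat_vec[of _ n2 n] mult_mat_vec_smult[of _ n2 n])
  moreover have "inj_on (\<lambda>v. I *\<^sub>v v) E1" by (rule inj_on_inverseI[where g = "\<lambda>v. J *\<^sub>v v"], rule JI)
  moreover have "(\<lambda>v. I *\<^sub>v v) ` E1 = {x \<in> E. P *\<^sub>v x = 0\<^sub>v n2}"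
  proof (intro equalityI subsetI)
    fix y assume "y \<in> (\<lambda>v. I *\<^sub>v v) ` E1"
    then obtain v where v: "v \<in> E1" "y = I *\<^sub>v v" by blast
    have "P *\<^sub>v y = 0\<^sub>v n2"
      using v r1(7) e(1,2,7) by (simp add: mult_mat_mat_vec[of P n2 n I n1])
    with v IE r1(7) show "y \<in> {x \<in> E. P *\<^sub>v x = 0\<^sub>v n2}" by simp
  next
    fix y assume "y \<in> {x \<in> E. P *\<^sub>v x = 0\<^sub>v n2}"
    then have y: "y \<in> carrier_vec n" "p *\<^sub>v y = y" "P *\<^sub>v y = 0\<^sub>v n2" by (auto simp: E)
    have "y = (I * J + S * P) *\<^sub>v y" using y e(8) by simp
    also have "\<dots> = I *\<^sub>v (J *\<^sub>v y) + S *\<^sub>v (P *\<^sub>v y)"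
      using y(1) e(1-4) by (simp add: add_mult_distrib_mat_vec[of _ n n]
          assoc_mult_mat_vec[of I n n1] assoc_mult_mat_vec[of S n n2])
    also have "\<dots> = I *\<^sub>v (J *\<^sub>v y)" using y e(1-4) by simp
    also have "\<dots> = I *\<^sub>v (p1 *\<^sub>v (J *\<^sub>v y))"
      using y(1) e(1,4,9) r1(1) by (simp add: mult_mat_mat_vec[of I n n1 p1 n1])
    finally have eq: "y = I *\<^sub>v (p1 *\<^sub>v (J *\<^sub>v y))" .
    show "y \<in> (\<lambda>v. I *\<^sub>v v) ` E1"
      by (rule image_eqI[where f = "\<lambda>v. I *\<^sub>v v", OF eq r1(10)]) (use y(1) e(4) in simp)
  qed
  moreover have "(\<lambda>v. P *\<^sub>v v) ` E = E2"
  proof (intro equalityI subsetI)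
    fix y assume y: "y \<in> E2"
    have "P *\<^sub>v (p *\<^sub>v (S *\<^sub>v y)) = y"
      using y e(2,3,6,14) r(1) r2(7,8)
      by (simp add: mult_mat_mat_vec[of P n2 n p n] mult_mat_mat_vec[of P n2 n S n2])
    moreover have "p *\<^sub>v (S *\<^sub>v y) \<in> E" using r(10) y r2(7) e(3) by simp
    ultimately show "y \<in> (\<lambda>v. P *\<^sub>v v) ` E" by (intro image_eqI[where x = "p *\<^sub>v (S *\<^sub>v y)"]) simp_all
  qed (use PE r(7) in auto)
  moreover have "\<forall>v\<in>E1. I *\<^sub>v f1 v = f (I *\<^sub>v v)"
  proof
    fix v assume v: "v \<in> E1"
    have "f (I *\<^sub>v v) = M *\<^sub>v (I *\<^sub>v v)" by (rule r(9)[OF IE[OF r1(7)[OF v]]])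
    then show "I *\<^sub>v f1 v = f (I *\<^sub>v v)"
      using r1(7)[OF v] r1(9)[OF v] e(1,11) r(2) r1(2)
      by (simp add: mult_mat_mat_vec[of M n n I n1] mult_mat_mat_vec[of I n n1 M1 n1])
  qed
  moreover have "\<forall>v\<in>E. P *\<^sub>v f v = f2 (P *\<^sub>v v)"
  proof
    fix v assume v: "v \<in> E"
    have "f2 (P *\<^sub>v v) = M2 *\<^sub>v (P *\<^sub>v v)" by (rule r2(9)[OF PE[OF r(7)[OF v]]])
    then show "P *\<^sub>v f v = f2 (P *\<^sub>v v)"
      using r(7)[OF v] r(9)[OF v] e(2,12) r(2) r2(2)
      by (simp add: mult_mat_mat_vec[of M2 n2 n2 P n] mult_mat_mat_vec[of P n2 n M n])
  qed
  ultimately show ?thesis unfolding x short_exact.simps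
    by - (rule bexI[where x = "\<lambda>v. I *\<^sub>v v"], rule bexI[where x = "\<lambda>v. P *\<^sub>v v"], intro conjI)
qed

text \<open>Projectivity is used concretely: a section is chosen on the projected unit vectors of
  the ambient free module, and p - SP, whose values are killed by \<open>q\<close>, is lifted
  through \<open>i\<close> column by column to give \<open>J\<close>.\<close>

lemma short_exactD:
  fixes x :: "'r::comm_ring_1 endo"
  assumes r1: "endo_rep x1 p1 M1" and r: "endo_rep x p M" and r2: "endo_rep x2 p2 M2"
    and ex: "short_exact x1 x x2"
  shows "\<exists>I P S J. matrix_exact p1 M1 p M p2 M2 I P S J"
proof -
  obtain n1 E1 f1 n E f n2 E2 f2 where x: "x1 = (n1, E1, f1)" "x = (n, E, f)" "x2 = (n2, E2, f2)"
    by (metis prod_cases3)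
  note r1 = endo_repD[OF r1[unfolded x(1)]] and r = endo_repD[OF r[unfolded x(2)]]
    and r2 = endo_repD[OF r2[unfolded x(3)]]
  obtain i q where i: "i \<in> module_hom class_ring (sub_vec n1 E1) (sub_vec n E)"
    and q: "q \<in> module_hom class_ring (sub_vec n E) (sub_vec n2 E2)"
    and inj: "inj_on i E1" and ker: "i ` E1 = {x \<in> E. q x = 0\<^sub>v n2}" and surj: "q ` E = E2"
    and if1: "\<And>v. v \<in> E1 \<Longrightarrow> i (f1 v) = f (i v)" and qf: "\<And>v. v \<in> E \<Longrightarrow> q (f v) = f2 (q v)"
    using ex unfolding x short_exact.simps by blast
  have iE: "i v \<in> E" if "v \<in> E1" for v using i that by (simp add: module_hom_iff)
  have qE: "q v \<in> E2" if "v \<in> E" for v using q that by (simp add: module_hom_iff)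
  \<comment> \<open>A homomorphism is given on its summand only; composing it with a projection
    extends it to the whole free module, where it has a matrix.\<close>
  have ext: "\<exists>I. I \<in> carrier_mat m k \<and> (\<forall>v\<in>carrier_vec k. I *\<^sub>v v = h (\<pi> *\<^sub>v v))"
    if h: "h \<in> module_hom class_ring (sub_vec k F) (sub_vec m G)" and G: "G \<subseteq> carrier_vec m"
      and \<pi>: "\<pi> \<in> carrier_mat k k" "\<And>v. v \<in> carrier_vec k \<Longrightarrow> \<pi> *\<^sub>v v \<in> F"
    for h :: "'r vec \<Rightarrow> 'r vec" and k m F G \<pi>
  proof -
    have "\<exists>I\<in>carrier_mat m k. \<forall>v\<in>carrier_vec k. h (\<pi> *\<^sub>v v) = I *\<^sub>v v"
    proof (rule linear_matrix)
      fix v w :: "'r vec" and c assume v: "v \<in> carrier_vec k"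
      show "h (\<pi> *\<^sub>v v) \<in> carrier_vec m" using h \<pi>(2)[OF v] G by (auto simp: module_hom_iff)
      show "h (\<pi> *\<^sub>v (c \<cdot>\<^sub>v v)) = c \<cdot>\<^sub>v h (\<pi> *\<^sub>v v)"
        using \<pi> v h by (simp add: mult_mat_vec_smult[of _ k k] module_hom_iff)
      assume w: "w \<in> carrier_vec k"
      show "h (\<pi> *\<^sub>v (v + w)) = h (\<pi> *\<^sub>v v) + h (\<pi> *\<^sub>v w)"
        using \<pi> v w h by (simp add: mult_add_distrib_mat_vec[of _ k k] module_hom_iff)
    qed
    then show ?thesis by auto
  qed
  have E2c: "E2 \<subseteq> carrier_vec n2" and Ec: "E \<subseteq> carrier_vec n" using r(7) r2(7) by auto
  obtain I where I: "I \<in> carrier_mat n n1" "\<And>v. v \<in> carrier_vec n1 \<Longrightarrow> I *\<^sub>v v = i (p1 *\<^sub>v v)"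
    using ext[OF i Ec r1(1,10)] by blast
  obtain P where P: "P \<in> carrier_mat n2 n" "\<And>v. v \<in> carrier_vec n \<Longrightarrow> P *\<^sub>v v = q (p *\<^sub>v v)"
    using ext[OF q E2c r(1,10)] by blast
  have Pq: "P *\<^sub>v v = q v" if "v \<in> E" for v using P(2)[OF r(7)[OF that]] r(8)[OF that] by simp
  have Ii: "I *\<^sub>v v = i v" if "v \<in> E1" for v using I(2)[OF r1(7)[OF that]] r1(8)[OF that] by simp
  have "\<exists>v. v \<in> E \<and> q v = p2 *\<^sub>v unit_vec n2 j" for j
    using r2(10)[OF unit_vec_carrier[of n2 j]] surj by (metis imageE)
  then obtain s where s: "\<And>j. s j \<in> E" "\<And>j. q (s j) = p2 *\<^sub>v unit_vec n2 j" by metis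
  obtain S0 where S0: "S0 \<in> carrier_mat n n2" "\<And>j. j < n2 \<Longrightarrow> S0 *\<^sub>v unit_vec n2 j = s j"
    by (rule matrix_of_columns[of n2 s n]) (use s(1) r(7) in auto)
  \<comment> \<open>The columns of \<open>S0\<close> lie in the summand already; the factor
    \<open>p\<close> makes this visible for all vectors.\<close>
  define S where "S = p * S0"
  have S: "S \<in> carrier_mat n n2" "\<And>j. j < n2 \<Longrightarrow> S *\<^sub>v unit_vec n2 j = s j"
    using S0 r(1) r(8)[OF s(1)] by (simp_all add: S_def assoc_mult_mat_vec[of p n n S0 n2])
  have SE: "S *\<^sub>v v \<in> E" if "v \<in> carrier_vec n2" for v
    using that S0(1) r(1,10) by (simp add: S_def assoc_mult_mat_vec[of p n n S0 n2])
  have PS: "P * S = p2"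
    by (rule mat_eqI_unit_vec[of _ n2 n2]) (use P(1) S s Pq r2(1) in \<open>simp_all add: assoc_mult_mat_vec[of P n2 n S n2]\<close>)
  have p2P: "p2 * P = P"
  proof (rule mat_eqI_vec[of _ n2 n])
    fix v :: "'r vec" assume v: "v \<in> carrier_vec n"
    show "p2 * P *\<^sub>v v = P *\<^sub>v v" using v P(1) P(2)[OF v] r2(1) r2(8)[OF qE[OF r(10)[OF v]]]
      by (simp add: assoc_mult_mat_vec[of p2 n2 n2 P n])
  qed (use P(1) r2(1) in auto)
  have pI: "p *\<^sub>v (I *\<^sub>v v) = I *\<^sub>v v" if "v \<in> carrier_vec n1" for v
    using I(2)[OF that] r(8) iE r1(10)[OF that] by simp
  have Pp: "P *\<^sub>v (p *\<^sub>v v) = P *\<^sub>v v" if "v \<in> carrier_vec n" for v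
    using Pq[OF r(10)[OF that]] P(2)[OF that] by simp
  have PI: "P *\<^sub>v (I *\<^sub>v v) = 0\<^sub>v n2" if "v \<in> carrier_vec n1" for v
    using I(2)[OF that] Pq iE r1(10)[OF that] ker by auto
  let ?K = "p - S * P"
  have K: "?K \<in> carrier_mat n n" using S(1) P(1) r(1) by auto
  have "\<exists>w. w \<in> E1 \<and> i w = ?K *\<^sub>v v" if v: "v \<in> carrier_vec n" for v
  proof -
    have Kv: "?K *\<^sub>v v = p *\<^sub>v v - S *\<^sub>v (P *\<^sub>v v)"
      using v r(1) S(1) P(1)
      by (simp add: minus_mult_distrib_mat_vec[of _ n n] assoc_mult_mat_vec[of S n n2 P n])
    have "p *\<^sub>v (?K *\<^sub>v v) = ?K *\<^sub>v v" unfolding Kv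
      using v r(1) S(1) P(1) r(8)[OF r(10)[OF v]] r(8)[OF SE[of "P *\<^sub>v v"]]
      by (simp add: mult_minus_distrib_mat_vec[of p n n])
    then have KE: "?K *\<^sub>v v \<in> E" using r(1,6) v K by (auto simp: fixed_vecs_def)
    have PSP: "P *\<^sub>v (S *\<^sub>v (P *\<^sub>v v)) = P *\<^sub>v v"
      using v P(1) S(1) PS p2P r2(1)
      by (simp add: mult_mat_mat_vec[of P n2 n S n2] mult_mat_mat_vec[of p2 n2 n2 P n])
    have "q (?K *\<^sub>v v) = P *\<^sub>v (?K *\<^sub>v v)" using Pq[OF KE] by simp
    also have "\<dots> = P *\<^sub>v (p *\<^sub>v v) - P *\<^sub>v (S *\<^sub>v (P *\<^sub>v v))" unfolding Kv
      using v P(1) S(1) r(1) by (simp add: mult_minus_distrib_mat_vec[of P n2 n])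
    also have "\<dots> = 0\<^sub>v n2" using P(1) v by (simp add: PSP Pp)
    finally have "?K *\<^sub>v v \<in> i ` E1" unfolding ker using KE by simp
    then obtain w where "?K *\<^sub>v v = i w" "w \<in> E1" by (rule imageE)
    then show ?thesis by (intro exI[of _ w]) simp
  qed
  then obtain t where t: "\<And>v. v \<in> carrier_vec n \<Longrightarrow> t v \<in> E1 \<and> i (t v) = ?K *\<^sub>v v" by metis
  \<comment> \<open>The lifts \<open>t\<close> are chosen pointwise and not known to be linear, so
    only their values on unit vectors are kept.\<close>
  obtain J where J: "J \<in> carrier_mat n1 n" "\<And>j. j < n \<Longrightarrow> J *\<^sub>v unit_vec n j = t (unit_vec n j)"
    by (rule matrix_of_columns[of n "\<lambda>j. t (unit_vec n j)" n1]) (use t r1(7) in auto)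
  have IJ: "I * J = ?K"
    by (rule mat_eqI_unit_vec[of _ n n])
       (use I(1) J K t Ii in \<open>simp_all add: assoc_mult_mat_vec[of I n n1 J n]\<close>)
  have sum: "I * J + S * P = p" unfolding IJ
    by (rule eq_matI) (use r(1) S(1) P(1) in \<open>auto simp del: index_mult_mat(1)\<close>)
  have p1J: "p1 * J = J"
    by (rule mat_eqI_unit_vec[of _ n1 n])
       (use r1(1,8) J t in \<open>simp_all add: assoc_mult_mat_vec[of p1 n1 n1 J n]\<close>)
  have Ip1: "I * p1 = I"
  proof (rule mat_eqI_vec[of _ n n1])
    fix v :: "'r vec" assume v: "v \<in> carrier_vec n1"
    show "I * p1 *\<^sub>v v = I *\<^sub>v v" using v I(1) I(2)[OF v] Ii[OF r1(10)[OF v]] r1(1)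
      by (simp add: assoc_mult_mat_vec[of I n n1 p1 n1])
  qed (use I(1) r1(1) in auto)
  have JI: "J * I = p1"
  proof (rule mat_eqI_vec[of _ n1 n1])
    fix v :: "'r vec" assume v: "v \<in> carrier_vec n1"
    let ?w = "J *\<^sub>v (I *\<^sub>v v)"
    have wc: "?w \<in> carrier_vec n1" using v I(1) J(1) by simp
    have w: "?w \<in> E1"
      using r1(10)[OF wc] v I(1) J(1) r1(1) p1J by (simp add: mult_mat_mat_vec[of p1 n1 n1 J n])
    have "i ?w = I *\<^sub>v (J *\<^sub>v (I *\<^sub>v v))" using Ii[OF w] by simp
    also have "\<dots> = ?K *\<^sub>v (I *\<^sub>v v)" using v I(1) J(1) IJ by (simp add: mult_mat_mat_vec[of I n n1 J n])
    also have "\<dots> = p *\<^sub>v (I *\<^sub>v v) - S *\<^sub>v (P *\<^sub>v (I *\<^sub>v v))"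
      using v r(1) S(1) P(1) I(1)
      by (simp add: minus_mult_distrib_mat_vec[of _ n n] assoc_mult_mat_vec[of S n n2 P n])
    also have "\<dots> = i (p1 *\<^sub>v v)" unfolding pI[OF v] PI[OF v]
      using v S(1) I(2)[OF v] r(7)[OF iE[OF r1(10)[OF v]]] by simp
    finally have "?w = p1 *\<^sub>v v" using inj w r1(10)[OF v] by (auto dest: inj_onD)
    then show "J * I *\<^sub>v v = p1 *\<^sub>v v" using v J(1) I(1) by (simp add: assoc_mult_mat_vec[of J n1 n I n1])
  qed (use J(1) I(1) r1(1) in auto)
  have "P * I = 0\<^sub>m n2 n1"
  proof (rule mat_eqI_vec[of _ n2 n1])
    fix v :: "'r vec" assume v: "v \<in> carrier_vec n1"
    show "P * I *\<^sub>v v = 0\<^sub>m n2 n1 *\<^sub>v v" using v P(1) I(1) PI[OF v]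
      by (simp add: assoc_mult_mat_vec[of P n2 n I n1])
  qed (use I(1) P(1) in auto)
  moreover have "M * I = I * M1"
  proof (rule mat_eqI_vec[of _ n n1])
    fix v :: "'r vec" assume v: "v \<in> carrier_vec n1"
    have "M *\<^sub>v (I *\<^sub>v v) = f (i (p1 *\<^sub>v v))"
      using r(9)[OF iE[OF r1(10)[OF v]]] I(2)[OF v] by simp
    also have "\<dots> = i (M1 *\<^sub>v (p1 *\<^sub>v v))" using if1[OF r1(10)[OF v]] r1(9)[OF r1(10)[OF v]] by simp
    also have "\<dots> = i (M1 *\<^sub>v v)"
      using v r1(1,2,4) by (simp add: mult_mat_mat_vec[of M1 n1 n1 p1 n1])
    also have "\<dots> = I *\<^sub>v (M1 *\<^sub>v v)" using Ii[OF r1(11)[OF v]] by simp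
    finally show "M * I *\<^sub>v v = I * M1 *\<^sub>v v" using v r(2) r1(2) I(1)
      by (simp add: assoc_mult_mat_vec[of M n n I n1] assoc_mult_mat_vec[of I n n1 M1 n1])
  qed (use I(1) r(2) r1(2) in auto)
  moreover have "P * M = M2 * P"
  proof (rule mat_eqI_vec[of _ n2 n])
    fix v :: "'r vec" assume v: "v \<in> carrier_vec n"
    have "P *\<^sub>v (M *\<^sub>v v) = q (M *\<^sub>v (p *\<^sub>v v))"
      using Pq[OF r(11)[OF v]] v r(1,2,4) by (simp add: mult_mat_mat_vec[of M n n p n])
    also have "\<dots> = f2 (q (p *\<^sub>v v))" using qf[OF r(10)[OF v]] r(9)[OF r(10)[OF v]] by simp
    also have "\<dots> = M2 *\<^sub>v (P *\<^sub>v v)" using r2(9)[OF qE[OF r(10)[OF v]]] P(2)[OF v] by simp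
    finally show "P * M *\<^sub>v v = M2 * P *\<^sub>v v" using v r(2) r2(2) P(1)
      by (simp add: assoc_mult_mat_vec[of P n2 n M n] assoc_mult_mat_vec[of M2 n2 n2 P n])
  qed (use P(1) r(2) r2(2) in auto)
  ultimately have "matrix_exact p1 M1 p M p2 M2 I P S J"
    unfolding matrix_exact_def using r1(1) r(1) r2(1) I(1) P(1) S(1) J(1) PS JI sum Ip1 p2P by simp
  then show ?thesis by blast
qed

text \<open>For \<open>X = (I S)\<close> and \<open>Y\<close> with rows \<open>J\<close> and \<open>P\<close>, we have \<open>X Y = p\<close>, and \<open>Y M X\<close> is block
  triangular with diagonal blocks \<open>M1\<close> and \<open>M2\<close>. The block matrices with an empty row or column only serve
  to write \<open>X\<close> and \<open>Y\<close> as four-block matrices.\<close>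

lemma rev_char_short_exact:
  assumes r1: "endo_rep x1 p1 M1" and r: "endo_rep x p M" and r2: "endo_rep x2 p2 M2"
    and ex: "short_exact x1 x x2"
  shows "rev_char M = rev_char M1 * rev_char M2"
proof -
  obtain n1 E1 f1 n E f n2 E2 f2 where x: "x1 = (n1, E1, f1)" "x = (n, E, f)" "x2 = (n2, E2, f2)"
    by (metis prod_cases3)
  obtain I P S J where me: "matrix_exact p1 M1 p M p2 M2 I P S J"
    using short_exactD[OF assms] by blast
  note r1 = endo_repD[OF r1[unfolded x(1)]] and r = endo_repD[OF r[unfolded x(2)]]
    and r2 = endo_repD[OF r2[unfolded x(3)]]
  note e = matrix_exactD[OF me r1(1) r(1) r2(1)]
  let ?Z = "0\<^sub>m 0 n :: 'a mat"
  let ?X = "four_block_mat I S (0\<^sub>m 0 n1) (0\<^sub>m 0 n2)" and ?Y = "four_block_mat J (0\<^sub>m n1 0) P (0\<^sub>m n2 0)"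
  let ?M = "four_block_mat M (0\<^sub>m n 0) (0\<^sub>m 0 n) (0\<^sub>m 0 0)"
  have X: "?X \<in> carrier_mat n (n1 + n2)" and Y: "?Y \<in> carrier_mat (n1 + n2) n"
    using e(1-4) by auto
  have MM: "?M = M" by (rule eq_matI) (use r(2) in auto)
  have "?X * ?Y = four_block_mat (I * J + S * P) (0\<^sub>m n 0) (0\<^sub>m 0 n) (0\<^sub>m 0 0)"
    by (subst mult_four_block_mat[of _ n n1 _ n2 _ 0 _ _ n _ 0]) (use e(1-4) in auto)
  also have "\<dots> = p" unfolding e(8) by (rule eq_matI) (use r(1) in auto)
  finally have XY: "?X * ?Y = p" .
  have "?M * ?X = four_block_mat (M * I) (M * S) (0\<^sub>m 0 n1) (0\<^sub>m 0 n2)"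
    by (subst mult_four_block_mat[of _ n n _ 0 _ 0 _ _ n1 _ n2]) (use e(1-4) r(2) in auto)
  then have MX: "M * ?X = four_block_mat (M * I) (M * S) (0\<^sub>m 0 n1) (0\<^sub>m 0 n2)"
    by (simp only: MM)
  have a1: "J * (M * I) = M1" unfolding e(11) using e(1,4,5) r1(2,5)
    by (simp add: assoc_mult_mat[of J n1 n I n1 M1 n1, symmetric])
  have a2: "P * (M * I) = 0\<^sub>m n2 n1" unfolding e(11) using e(1,2,7) r1(2)
    by (simp add: assoc_mult_mat[of P n2 n I n1 M1 n1, symmetric])
  have a3: "P * (M * S) = M2"
  proof -
    have "P * (M * S) = P * M * S" using e(2,3) r(2) by (simp add: assoc_mult_mat[of P n2 n M n S n2])
    also have "\<dots> = M2 * (P * S)" unfolding e(12) using e(2,3) r2(2)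
      by (simp add: assoc_mult_mat[of M2 n2 n2 P n S n2])
    finally show ?thesis using e(6) r2(4) by simp
  qed
  have "?Y * (M * ?X) = four_block_mat M1 (J * (M * S)) (0\<^sub>m n2 n1) M2"
    unfolding MX by (subst mult_four_block_mat[of _ n1 n _ 0 _ n2 _ _ n1 _ n2])
      (use e(1-4) r(2) r1(2) r2(2) in \<open>auto simp: a1 a2 a3\<close>)
  then have "rev_char (?Y * (M * ?X)) = rev_char M1 * rev_char M2"
    using r1(2) r2(2) e(3,4) r(2) by (simp add: rev_char_four_block[of _ n1 _ n2])
  moreover have "rev_char (?Y * (M * ?X)) = rev_char ((M * ?X) * ?Y)"
    by (rule rev_char_commute[of _ "n1 + n2" n]) (use X Y r(2) in auto)
  moreover have "(M * ?X) * ?Y = M"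
    using assoc_mult_mat[OF r(2) X Y] XY r(4) by simp
  ultimately show ?thesis by simp
qed

section \<open>Tensor products of endomorphisms\<close>

lemma dim_kron [simp]: "dim_row (kron A B) = dim_row A * dim_row B" "dim_col (kron A B) = dim_col A * dim_col B"
  by (simp_all add: kron_def)

text \<open>Associativity holds as an equation of matrices, so both bracketings of a triple tensor
  product of endomorphisms share one pair of matrices.\<close>

lemma kron_assoc: "kron (kron A B) C = kron A (kron B C)"
proof (rule eq_matI)
  have dm: "i div c div b = i div (b * c)" "i div c mod b = i mod (b * c) div c" "i mod (b * c) mod c = i mod c"
    for i b c :: nat
  proof -
    show "i div c div b = i div (b * c)" by (simp add: mult.commute[of b c] div_mult2_eq)
    show "i div c mod b = i mod (b * c) div c"
      by (cases "c = 0") (simp_all add: mult.commute[of b c] mod_mult2_eq)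
    show "i mod (b * c) mod c = i mod c" by (simp add: mod_mod_cancel)
  qed
  fix i j assume "i < dim_row (kron A (kron B C))" "j < dim_col (kron A (kron B C))"
  then have ij: "i < dim_row A * dim_row B * dim_row C" "j < dim_col A * dim_col B * dim_col C"
    by (auto simp: kron_def mult.assoc)
  then have ij': "i < dim_row A * (dim_row B * dim_row C)" "j < dim_col A * (dim_col B * dim_col C)"
    by (auto simp: mult.assoc)
  note b = div_mod_bounds[OF ij(1)] div_mod_bounds[OF ij(2)] div_mod_bounds[OF ij'(1)] div_mod_bounds[OF ij'(2)]
  show "kron (kron A B) C $$ (i, j) = kron A (kron B C) $$ (i, j)"
    using ij ij' b by (simp add: kron_def dm mult.assoc)
qed (auto simp: kron_def)

lemma kron_one_left: "kron (1\<^sub>m 1) A = A"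
  by (rule eq_matI) (auto simp: kron_def)

lemma kron_one_right: "kron A (1\<^sub>m 1) = A"
  by (rule eq_matI) (auto simp: kron_def)

lemma submodule_fixed_vecs:
  fixes p :: "'r::comm_ring_1 mat"
  assumes "p \<in> carrier_mat n n"
  shows "submodule class_ring (fixed_vecs p) (module_vec TYPE('r) n)"
  unfolding submodule_iff using assms
  by (auto simp: fixed_vecs_def mult_add_distrib_mat_vec[of _ n n] mult_mat_vec_smult[of _ n n])

text \<open>Tensors of fixed vectors are fixed by \<open>kron p q\<close>. Conversely
  \<open>kron p q\<close> sends each unit vector to a tensor of fixed vectors, so its whole image,
  and with it every fixed vector, lies in the span.\<close>

lemma tensor_space_fixed_vecs:
  fixes p q :: "'r::comm_ring_1 mat"
  assumes p: "p \<in> carrier_mat n n" "p * p = p" and q: "q \<in> carrier_mat m m" "q * q = q"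
  shows "tensor_space n (fixed_vecs p) m (fixed_vecs q) = fixed_vecs (kron p q)"
proof -
  interpret V: vec_module "TYPE('r)" "n * m" .
  let ?G = "{vec_tensor x y | x y. x \<in> fixed_vecs p \<and> y \<in> fixed_vecs q}"
  have k: "kron p q \<in> carrier_mat (n * m) (n * m)" using p q by simp
  have G: "?G \<subseteq> fixed_vecs (kron p q)"
  proof
    fix z assume "z \<in> ?G"
    then obtain x y where z: "z = vec_tensor x y" "x \<in> carrier_vec n" "y \<in> carrier_vec m"
      "p *\<^sub>v x = x" "q *\<^sub>v y = y" using p q by (auto simp: fixed_vecs_def)
    then show "z \<in> fixed_vecs (kron p q)"
      using p q k by (simp add: fixed_vecs_def kron_mult_vec[of _ n n _ m m])
  qed
  have Gc: "?G \<subseteq> carrier_vec (n * m)"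
  proof -
    have "fixed_vecs (kron p q) \<subseteq> carrier_vec (n * m)" using k by (auto simp: fixed_vecs_def)
    with G show ?thesis by (rule subset_trans)
  qed
  have "submodule class_ring (V.span ?G) (module_vec TYPE('r) (n * m))"
    by (rule V.span_is_submodule[OF Gc])
  then have sp: "0\<^sub>v (n * m) \<in> V.span ?G" "\<And>x y. x \<in> V.span ?G \<Longrightarrow> y \<in> V.span ?G \<Longrightarrow> x + y \<in> V.span ?G"
    "\<And>c x. x \<in> V.span ?G \<Longrightarrow> c \<cdot>\<^sub>v x \<in> V.span ?G" by (auto simp: submodule_iff)
  have in_span: "kron p q *\<^sub>v z \<in> V.span ?G" if "z \<in> carrier_vec (n * m)" for z
    using that
  proof (induction z rule: vec_unit_induct)
    case zero
    then show ?case using k sp(1) by simp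
  next
    case (step y i c)
    let ?u = "unit_vec n (i div m) :: 'r vec" and ?w = "unit_vec m (i mod m) :: 'r vec"
    have "kron p q *\<^sub>v unit_vec (n * m) i = vec_tensor (p *\<^sub>v ?u) (q *\<^sub>v ?w)"
      using p q by (simp add: unit_vec_tensor[OF step(2)] kron_mult_vec[of _ n n _ m m])
    moreover have "p *\<^sub>v ?u \<in> fixed_vecs p" "q *\<^sub>v ?w \<in> fixed_vecs q"
      using p q by (auto simp: fixed_vecs_def mult_mat_mat_vec[of _ n n _ n] mult_mat_mat_vec[of _ m m _ m])
    ultimately have "kron p q *\<^sub>v unit_vec (n * m) i \<in> ?G" by blast
    then have "kron p q *\<^sub>v unit_vec (n * m) i \<in> V.span ?G" using V.in_own_span[OF Gc] by blast
    then show ?case using step(1,3) k sp(2,3)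
      by (simp add: mult_add_distrib_mat_vec[of _ "n * m" "n * m"] mult_mat_vec_smult[of _ "n * m" "n * m"])
  qed
  have "V.span ?G = fixed_vecs (kron p q)"
  proof (intro equalityI)
    show "V.span ?G \<subseteq> fixed_vecs (kron p q)"
      by (rule V.span_is_subset[OF G submodule_fixed_vecs[OF k]])
    show "fixed_vecs (kron p q) \<subseteq> V.span ?G"
    proof
      fix z assume "z \<in> fixed_vecs (kron p q)"
      then have "z \<in> carrier_vec (n * m)" "kron p q *\<^sub>v z = z" using k by (auto simp: fixed_vecs_def)
      then show "z \<in> V.span ?G" using in_span[of z] by simp
    qed
  qed
  then show ?thesis by (simp add: tensor_space_def)
qed

text \<open>The map in \<open>endo_tensor\<close> is a choice, possible because
  \<open>kron M N\<close> qualifies. It agrees with \<open>kron M N\<close> on tensors of projected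
  unit vectors and therefore on the whole tensor space.\<close>

lemma endo_rep_tensor:
  fixes x y :: "'r::comm_ring_1 endo"
  assumes r: "endo_rep x p M" and s: "endo_rep y q N"
  shows "endo_rep (endo_tensor x y) (kron p q) (kron M N)"
proof -
  obtain n E f m F g where x: "x = (n, E, f)" "y = (m, F, g)" by (metis prod_cases3)
  note r = endo_repD[OF r[unfolded x(1)]] and s = endo_repD[OF s[unfolded x(2)]]
  let ?p = "kron p q" and ?M = "kron M N" and ?T = "tensor_space n E m F"
  have c: "?p \<in> carrier_mat (n * m) (n * m)" "?M \<in> carrier_mat (n * m) (n * m)" using r(1,2) s(1,2) by auto
  have id: "?p * ?p = ?p" "?M * ?p = ?M" "?p * ?M = ?M"
    using r(1-5) s(1-5) by (simp_all add: kron_mult[of _ n n _ m m _ n _ m])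
  have T: "?T = fixed_vecs ?p" unfolding r(6) s(6) by (rule tensor_space_fixed_vecs) (use r(1,3) s(1,3) in auto)
  have rep: "endo_rep (n * m, ?T, \<lambda>z. ?M *\<^sub>v z) ?p ?M" unfolding T
    using endo_rep_fixed_vecs[OF c id] .
  define h where "h = (SOME h. h \<in> module_hom class_ring (sub_vec (n * m) ?T) (sub_vec (n * m) ?T) \<and>
              (\<forall>x\<in>E. \<forall>y\<in>F. h (vec_tensor x y) = vec_tensor (f x) (g y)))"
  have t: "endo_tensor x y = (n * m, ?T, h)" by (simp add: x h_def)
  have "\<exists>h. h \<in> module_hom class_ring (sub_vec (n * m) ?T) (sub_vec (n * m) ?T) \<and>
              (\<forall>x\<in>E. \<forall>y\<in>F. h (vec_tensor x y) = vec_tensor (f x) (g y))"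
  proof (rule exI[of _ "\<lambda>z. ?M *\<^sub>v z"], rule conjI)
    show "(\<lambda>z. ?M *\<^sub>v z) \<in> module_hom class_ring (sub_vec (n * m) ?T) (sub_vec (n * m) ?T)"
      using endo_rep_imp_endos[OF rep] by (simp add: endos_def)
    show "\<forall>x\<in>E. \<forall>y\<in>F. ?M *\<^sub>v vec_tensor x y = vec_tensor (f x) (g y)"
      using r(2,7,9) s(2,7,9) by (simp add: kron_mult_vec[of _ n n _ m m])
  qed
  from someI_ex[OF this] have h: "\<And>z. z \<in> ?T \<Longrightarrow> h z \<in> ?T" "\<And>z w. z \<in> ?T \<Longrightarrow> w \<in> ?T \<Longrightarrow> h (z + w) = h z + h w"
    "\<And>c z. z \<in> ?T \<Longrightarrow> h (c \<cdot>\<^sub>v z) = c \<cdot>\<^sub>v h z"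
    "\<And>x y. x \<in> E \<Longrightarrow> y \<in> F \<Longrightarrow> h (vec_tensor x y) = vec_tensor (f x) (g y)"
    unfolding h_def[symmetric] by (auto simp: module_hom_iff)
  note R = endo_repD[OF rep]
  have hM: "h (?p *\<^sub>v z) = ?M *\<^sub>v z" if z: "z \<in> carrier_vec (n * m)" for z
  proof (rule linear_eq_on_unit_vecs[where f = "\<lambda>z. h (?p *\<^sub>v z)", OF _ _ _ c(2) _ z])
    fix z w :: "'r vec" and a assume z: "z \<in> carrier_vec (n * m)"
    show "h (?p *\<^sub>v z) \<in> carrier_vec (n * m)" using R(7)[OF h(1)[OF R(10)[OF z]]] .
    show "h (?p *\<^sub>v (a \<cdot>\<^sub>v z)) = a \<cdot>\<^sub>v h (?p *\<^sub>v z)"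
      using h(3)[OF R(10)[OF z]] z c by (simp add: mult_mat_vec_smult[of _ "n * m" "n * m"])
    assume w: "w \<in> carrier_vec (n * m)"
    show "h (?p *\<^sub>v (z + w)) = h (?p *\<^sub>v z) + h (?p *\<^sub>v w)"
      using h(2)[OF R(10)[OF z] R(10)[OF w]] z w c by (simp add: mult_add_distrib_mat_vec[of _ "n * m" "n * m"])
  next
    fix j assume j: "j < n * m"
    let ?u = "unit_vec n (j div m) :: 'r vec" and ?w = "unit_vec m (j mod m) :: 'r vec"
    have pu: "p *\<^sub>v ?u \<in> E" "q *\<^sub>v ?w \<in> F" using r(10) s(10) by auto
    have "?p *\<^sub>v unit_vec (n * m) j = vec_tensor (p *\<^sub>v ?u) (q *\<^sub>v ?w)"
      using r(1) s(1) by (simp add: unit_vec_tensor[OF j] kron_mult_vec[of _ n n _ m m])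
    then have "h (?p *\<^sub>v unit_vec (n * m) j) = vec_tensor (M *\<^sub>v (p *\<^sub>v ?u)) (N *\<^sub>v (q *\<^sub>v ?w))"
      using h(4)[OF pu] r(9)[OF pu(1)] s(9)[OF pu(2)] by simp
    also have "\<dots> = ?M *\<^sub>v unit_vec (n * m) j"
      using r(1,2,4) s(1,2,4)
      by (simp add: unit_vec_tensor[OF j] kron_mult_vec[of _ n n _ m m]
          mult_mat_mat_vec[of _ n n _ n] mult_mat_mat_vec[of _ m m _ m])
    finally show "h (?p *\<^sub>v unit_vec (n * m) j) = ?M *\<^sub>v unit_vec (n * m) j" .
  qed
  have "h z = ?M *\<^sub>v z" if "z \<in> ?T" for z
    using hM[OF R(7)[OF that]] R(8)[OF that] by simp
  then show ?thesis unfolding t using R(1-6) by (simp add: endo_rep_def)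
qed

text \<open>As the sequence splits, each of its identities can be tensored with q q = q. The maps
  are tensored with \<open>q\<close> rather than with the identity so that they stay supported on
  the summand in the second factor.\<close>

lemma matrix_exact_kron_right:
  assumes ex: "matrix_exact p1 M1 p M p2 M2 I P S J"
    and p: "p1 \<in> carrier_mat n1 n1" "p \<in> carrier_mat n n" "p2 \<in> carrier_mat n2 n2"
    and M: "M1 \<in> carrier_mat n1 n1" "M \<in> carrier_mat n n" "M2 \<in> carrier_mat n2 n2"
    and q: "q \<in> carrier_mat m m" "q * q = q" and N: "N \<in> carrier_mat m m" "N * q = N" "q * N = N"
  shows "matrix_exact (kron p1 q) (kron M1 N) (kron p q) (kron M N) (kron p2 q) (kron M2 N)
           (kron I q) (kron P q) (kron S q) (kron J q)"
proof -
  note e = matrix_exactD[OF ex p]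
  have "kron (I * J) q + kron (S * P) q = kron p q"
    using e(1-4,8) q by (simp flip: kron_add_left[of _ n n _ _ m m])
  then show ?thesis unfolding matrix_exact_def
    using e p M q N
    by (simp add: kron_mult[of _ n1 n _ m m _ n1 _ m] kron_mult[of _ n2 n _ m m _ n2 _ m]
        kron_mult[of _ n2 n _ m m _ n1 _ m] kron_mult[of _ n n1 _ m m _ n _ m]
        kron_mult[of _ n n2 _ m m _ n _ m] kron_mult[of _ n n1 _ m m _ n1 _ m]
        kron_mult[of _ n2 n2 _ m m _ n _ m] kron_mult[of _ n n _ m m _ n1 _ m]
        kron_mult[of _ n2 n _ m m _ n _ m] kron_zero_left[of _ m m])
qed

lemma matrix_exact_kron_left:
  assumes ex: "matrix_exact p1 M1 p M p2 M2 I P S J"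
    and p: "p1 \<in> carrier_mat n1 n1" "p \<in> carrier_mat n n" "p2 \<in> carrier_mat n2 n2"
    and M: "M1 \<in> carrier_mat n1 n1" "M \<in> carrier_mat n n" "M2 \<in> carrier_mat n2 n2"
    and q: "q \<in> carrier_mat m m" "q * q = q" and N: "N \<in> carrier_mat m m" "N * q = N" "q * N = N"
  shows "matrix_exact (kron q p1) (kron N M1) (kron q p) (kron N M) (kron q p2) (kron N M2)
           (kron q I) (kron q P) (kron q S) (kron q J)"
proof -
  note e = matrix_exactD[OF ex p]
  have "kron q (I * J) + kron q (S * P) = kron q p"
    using e(1-4,8) q by (simp flip: kron_add_right[of _ m m _ n n])
  then show ?thesis unfolding matrix_exact_def
    using e p M q N
    by (simp add: kron_mult[of _ m m _ n1 n _ m _ n1] kron_mult[of _ m m _ n2 n _ m _ n2]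
        kron_mult[of _ m m _ n2 n _ m _ n1] kron_mult[of _ m m _ n n1 _ m _ n]
        kron_mult[of _ m m _ n n2 _ m _ n] kron_mult[of _ m m _ n n1 _ m _ n1]
        kron_mult[of _ m m _ n2 n2 _ m _ n] kron_mult[of _ m m _ n n _ m _ n1]
        kron_mult[of _ m m _ n2 n _ m _ n] kron_zero_right[of _ m m])
qed

lemma endo_rep_endos_ex:
  assumes "x \<in> endos"
  obtains p M where "endo_rep x p M"
  using endo_rep_endo_mat[OF assms] by blast

lemma endo_tensor_endos: "x \<in> endos \<Longrightarrow> y \<in> endos \<Longrightarrow> endo_tensor x y \<in> endos"
  by (meson endo_rep_endos_ex endo_rep_imp_endos endo_rep_tensor)

lemma short_exact_tensor:
  assumes "x1 \<in> endos" "x \<in> endos" "x2 \<in> endos" "y \<in> endos" and ex: "short_exact x1 x x2"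
  shows "short_exact (endo_tensor x1 y) (endo_tensor x y) (endo_tensor x2 y)"
    and "short_exact (endo_tensor y x1) (endo_tensor y x) (endo_tensor y x2)"
proof -
  obtain p1 M1 p M p2 M2 q N where r: "endo_rep x1 p1 M1" "endo_rep x p M" "endo_rep x2 p2 M2" "endo_rep y q N"
    using assms(1-4) by (meson endo_rep_endos_ex)
  obtain I P S J where me: "matrix_exact p1 M1 p M p2 M2 I P S J"
    using short_exactD[OF r(1-3) ex] by blast
  obtain n1 E1 f1 n E f n2 E2 f2 m F g where x: "x1 = (n1, E1, f1)" "x = (n, E, f)" "x2 = (n2, E2, f2)" "y = (m, F, g)"
    by (metis prod_cases3)
  note d = endo_repD[OF r(1)[unfolded x]] endo_repD[OF r(2)[unfolded x]] endo_repD[OF r(3)[unfolded x]]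
  note y = endo_repD[OF r(4)[unfolded x]]
  show "short_exact (endo_tensor x1 y) (endo_tensor x y) (endo_tensor x2 y)"
    by (rule short_exactI[OF endo_rep_tensor[OF r(1,4)] endo_rep_tensor[OF r(2,4)] endo_rep_tensor[OF r(3,4)]
          matrix_exact_kron_right[OF me d(1) d(12) d(23) d(2) d(13) d(24) y(1,3,2,4,5)]])
  show "short_exact (endo_tensor y x1) (endo_tensor y x) (endo_tensor y x2)"
    by (rule short_exactI[OF endo_rep_tensor[OF r(4,1)] endo_rep_tensor[OF r(4,2)] endo_rep_tensor[OF r(4,3)]
          matrix_exact_kron_left[OF me d(1) d(12) d(23) d(2) d(13) d(24) y(1,3,2,4,5)]])
qed

section \<open>The Grothendieck ring of endomorphisms\<close>

lemma group_closure_subset: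
  assumes "S \<subseteq> group_closure T"
  shows "group_closure S \<subseteq> group_closure T"
proof
  fix x assume "x \<in> group_closure S"
  then show "x \<in> group_closure T"
    by induction (use assms in \<open>auto intro: group_closure.diff\<close>)
qed

lemma carrier_free_endos: "c \<in> carrier free_endos \<longleftrightarrow> Poly_Mapping.keys c \<subseteq> endos"
  by (simp add: free_endos_def)

lemma free_endos_closed:
  "0 \<in> carrier free_endos"
  "a \<in> carrier free_endos \<Longrightarrow> b \<in> carrier free_endos \<Longrightarrow> a + b \<in> carrier free_endos"
  "a \<in> carrier free_endos \<Longrightarrow> b \<in> carrier free_endos \<Longrightarrow> a - b \<in> carrier free_endos"
  "a \<in> carrier free_endos \<Longrightarrow> - a \<in> carrier free_endos"
  "x \<in> endos \<Longrightarrow> frag_of x \<in> carrier free_endos"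
  using Poly_Mapping.keys_add[of a b] keys_diff[of a b]
  by (auto simp: carrier_free_endos keys_frag_of)

lemma free_endos_induct [consumes 1, case_names zero one diff]:
  assumes "c \<in> carrier free_endos" "P 0" "\<And>x. x \<in> endos \<Longrightarrow> P (frag_of x)"
    and "\<And>a b. a \<in> carrier free_endos \<Longrightarrow> b \<in> carrier free_endos \<Longrightarrow> P a \<Longrightarrow> P b \<Longrightarrow> P (a - b)"
  shows "P c"
proof -
  have "c \<in> carrier free_endos \<and> P c"
    using assms(1)[unfolded carrier_free_endos]
    by (rule frag_induction) (use assms(2-4) in \<open>auto intro: free_endos_closed\<close>)
  then show ?thesis by simp
qed

lemma free_endos_simps:
  "zero free_endos = 0" "add free_endos = (+)" "one free_endos = frag_of (1, carrier_vec 1, \<lambda>x. x)"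
  by (simp_all add: free_endos_def)

lemma abelian_group_free_endos: "abelian_group (free_endos :: ('r::comm_ring_1 endo \<Rightarrow>\<^sub>0 int) ring)"
proof (rule abelian_groupI)
  fix a :: "'r endo \<Rightarrow>\<^sub>0 int" assume "a \<in> carrier free_endos"
  then show "\<exists>b\<in>carrier free_endos. b \<oplus>\<^bsub>free_endos\<^esub> a = \<zero>\<^bsub>free_endos\<^esub>"
    by (intro bexI[of _ "- a"]) (auto simp: free_endos_simps intro: free_endos_closed)
qed (auto simp: free_endos_simps algebra_simps intro: free_endos_closed)

definition exact_gens :: "('r::comm_ring_1 endo \<Rightarrow>\<^sub>0 int) set" where
  "exact_gens = {frag_of y - frag_of x - frag_of z | x y z.
        x \<in> endos \<and> y \<in> endos \<and> z \<in> endos \<and> short_exact x y z}"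

lemma exact_gens_carrier: "exact_gens \<subseteq> carrier free_endos"
  by (auto simp: exact_gens_def intro!: free_endos_closed)

text \<open>\<open>group_closure\<close> is built from differences, so inductions over relations
  have a single step, settled by additivity.\<close>

lemma exact_rels_eq: "exact_rels = (group_closure exact_gens :: ('r::comm_ring_1 endo \<Rightarrow>\<^sub>0 int) set)"
proof -
  let ?G = "add_monoid (free_endos :: ('r endo \<Rightarrow>\<^sub>0 int) ring)"
  interpret abelian_group "free_endos :: ('r endo \<Rightarrow>\<^sub>0 int) ring" by (rule abelian_group_free_endos)
  let ?S = "exact_gens :: ('r endo \<Rightarrow>\<^sub>0 int) set"
  have inv: "inv\<^bsub>?G\<^esub> a = - a" if "a \<in> carrier free_endos" for a
    unfolding a_inv_def[symmetric] using that
    by (intro minus_equality) (auto simp: free_endos_simps intro: free_endos_closed)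
  have S: "?S \<subseteq> carrier free_endos" by (rule exact_gens_carrier)
  have sub: "generate ?G ?S \<subseteq> carrier free_endos" by (rule add.generate_incl[OF S])
  have "generate ?G ?S \<subseteq> group_closure ?S"
  proof
    fix a assume "a \<in> generate ?G ?S"
    then show "a \<in> group_closure ?S"
    proof induction
      case (inv h)
      then have "h \<in> carrier free_endos" using S by auto
      then show ?case using inv \<open>\<And>a. a \<in> carrier free_endos \<Longrightarrow> inv\<^bsub>?G\<^esub> a = - a\<close>
        by (simp add: group_closure.base)
    qed (auto simp: free_endos_simps intro: group_closure.base group_closure_add)
  qed
  moreover have "group_closure ?S \<subseteq> generate ?G ?S"
  proof
    fix a assume "a \<in> group_closure ?S"
    then show "a \<in> generate ?G ?S"
    proof induction
      case (base s)
      then show ?case using generate.one[of ?G ?S]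
        by (auto simp: free_endos_simps intro: generate.incl)
    next
      case (diff s t)
      have t: "t \<in> carrier free_endos" using diff sub by blast
      have "inv\<^bsub>?G\<^esub> t \<in> generate ?G ?S"
        by (rule group.generate_m_inv_closed[OF a_group]) (use S diff in auto)
      then have "- t \<in> generate ?G ?S" using inv[OF t] by simp
      moreover have "s \<in> generate ?G ?S" using diff by blast
      ultimately have "s \<otimes>\<^bsub>?G\<^esub> (- t) \<in> generate ?G ?S" by (intro generate.eng)
      then show ?case by (simp add: free_endos_simps)
    qed
  qed
  ultimately show ?thesis by (simp add: exact_rels_def exact_gens_def)
qed

lemma exact_rels_closed:
  "0 \<in> exact_rels" "a \<in> exact_rels \<Longrightarrow> b \<in> exact_rels \<Longrightarrow> a - b \<in> exact_rels"
  "a \<in> exact_rels \<Longrightarrow> b \<in> exact_rels \<Longrightarrow> a + b \<in> exact_rels" "a \<in> exact_rels \<Longrightarrow> - a \<in> exact_rels"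
  by (auto simp: exact_rels_eq intro: group_closure.diff group_closure_add)

lemma exact_rels_carrier: "exact_rels \<subseteq> carrier free_endos"
proof
  fix a :: "'a endo \<Rightarrow>\<^sub>0 int" assume "a \<in> exact_rels"
  then show "a \<in> carrier free_endos" unfolding exact_rels_eq
    by induction (use exact_gens_carrier in \<open>auto intro: free_endos_closed\<close>)
qed

lemma exact_relI:
  "x \<in> endos \<Longrightarrow> y \<in> endos \<Longrightarrow> z \<in> endos \<Longrightarrow> short_exact x y z
    \<Longrightarrow> frag_of y - frag_of x - frag_of z \<in> exact_rels"
  unfolding exact_rels_eq exact_gens_def by (rule group_closure.base) blast

text \<open>With all three terms equal to the zero module, the relation reads [0] - [0] - [0] =
  -[0].\<close>

lemma frag_of_zero_module: "frag_of ((0, fixed_vecs (0\<^sub>m 0 0), \<lambda>v. 0\<^sub>m 0 0 *\<^sub>v v) :: 'r::comm_ring_1 endo) \<in> exact_rels"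
proof -
  let ?z = "(0, fixed_vecs (0\<^sub>m 0 0), \<lambda>v. 0\<^sub>m 0 0 *\<^sub>v v) :: 'r endo"
  have r: "endo_rep ?z (0\<^sub>m 0 0) (0\<^sub>m 0 0)" by (rule endo_rep_fixed_vecs) auto
  have "matrix_exact (0\<^sub>m 0 0 :: 'r mat) (0\<^sub>m 0 0) (0\<^sub>m 0 0) (0\<^sub>m 0 0) (0\<^sub>m 0 0) (0\<^sub>m 0 0)
      (0\<^sub>m 0 0) (0\<^sub>m 0 0) (0\<^sub>m 0 0) (0\<^sub>m 0 0)" by (simp add: matrix_exact_def)
  from short_exactI[OF r r r this] endo_rep_imp_endos[OF r]
  have "frag_of ?z - frag_of ?z - frag_of ?z \<in> exact_rels" by (intro exact_relI)
  then show ?thesis using exact_rels_closed(4) by fastforce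
qed

text \<open>An isomorphism with inverse \<open>J\<close> is an exact sequence whose third term is
  the zero module.\<close>

lemma frag_of_iso:
  fixes x y :: "'r::comm_ring_1 endo"
  assumes r: "endo_rep x p M" "endo_rep y q N"
    and p: "p \<in> carrier_mat n n" "q \<in> carrier_mat m m"
    and IJ: "I \<in> carrier_mat m n" "J \<in> carrier_mat n m" "J * I = p" "I * J = q" "I * p = I" "N * I = I * M"
  shows "frag_of y - frag_of x \<in> exact_rels"
proof -
  let ?z = "(0, fixed_vecs (0\<^sub>m 0 0), \<lambda>v. 0\<^sub>m 0 0 *\<^sub>v v) :: 'r endo"
  have rz: "endo_rep ?z (0\<^sub>m 0 0) (0\<^sub>m 0 0)" by (rule endo_rep_fixed_vecs) auto
  have M: "N \<in> carrier_mat m m" using endo_repD(1,2)[of "fst y" "fst (snd y)" "snd (snd y)" q N] r(2) p(2)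
    by auto
  have "matrix_exact p M q N (0\<^sub>m 0 0) (0\<^sub>m 0 0) I (0\<^sub>m 0 m) (0\<^sub>m m 0) J"
    using p IJ M by (auto simp: matrix_exact_def)
  from short_exactI[OF r rz this] have "frag_of y - frag_of x - frag_of ?z \<in> exact_rels"
    by (intro exact_relI endo_rep_imp_endos[OF r(1)] endo_rep_imp_endos[OF r(2)] endo_rep_imp_endos[OF rz])
  from exact_rels_closed(3)[OF this frag_of_zero_module] show ?thesis by simp
qed

text \<open>The triples themselves may differ, since the underlying functions are arbitrary outside
  the summand; \<open>p\<close> serves as the isomorphism in both directions.\<close>

lemma frag_of_same_rep:
  assumes "endo_rep x p M" "endo_rep y p M"
  shows "frag_of y - frag_of x \<in> exact_rels"
proof -
  obtain n E f where x: "x = (n, E, f)" by (metis prod_cases3)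
  note d = endo_repD[OF assms(1)[unfolded x]]
  show ?thesis by (rule frag_of_iso[OF assms d(1) d(1) d(1) d(1)]) (use d in auto)
qed

section \<open>Products of formal combinations\<close>

definition frag_tensor :: "('r::comm_ring_1 endo \<Rightarrow>\<^sub>0 int) \<Rightarrow> ('r endo \<Rightarrow>\<^sub>0 int) \<Rightarrow> ('r endo \<Rightarrow>\<^sub>0 int)" where
  "frag_tensor a b = a \<otimes>\<^bsub>free_endos\<^esub> b"

lemma frag_tensor_alt:
  "frag_tensor a b = frag_extend (\<lambda>x. frag_extend (\<lambda>y. frag_of (endo_tensor x y)) b) a"
  by (simp add: frag_tensor_def free_endos_def)

lemma frag_tensor_of: "frag_tensor (frag_of x) (frag_of y) = frag_of (endo_tensor x y)"
  by (simp add: frag_tensor_alt)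

lemma frag_tensor_0: "frag_tensor 0 b = 0" "frag_tensor a 0 = 0"
  by (simp_all add: frag_tensor_alt frag_extend_eq_0)

lemma frag_tensor_left:
  "frag_tensor (a + a') b = frag_tensor a b + frag_tensor a' b"
  "frag_tensor (a - a') b = frag_tensor a b - frag_tensor a' b"
  "frag_tensor (- a) b = - frag_tensor a b"
  "frag_tensor (frag_cmul c a) b = frag_cmul c (frag_tensor a b)"
  by (simp_all add: frag_tensor_alt frag_extend_add frag_extend_diff frag_extend_minus frag_extend_cmul)

lemma frag_extend_fun_add: "frag_extend (\<lambda>x. f x + g x) a = frag_extend f a + frag_extend g a"
  by (simp add: frag_extend_def frag_cmul_distrib2 sum.distrib)

lemma frag_extend_fun_cmul: "frag_extend (\<lambda>x. frag_cmul c (f x)) a = frag_cmul c (frag_extend f a)"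
  by (simp add: frag_extend_def frag_cmul_sum mult.commute)

lemma frag_tensor_right:
  "frag_tensor a (b + b') = frag_tensor a b + frag_tensor a b'"
  "frag_tensor a (b - b') = frag_tensor a b - frag_tensor a b'"
  "frag_tensor a (- b) = - frag_tensor a b"
  "frag_tensor a (frag_cmul c b) = frag_cmul c (frag_tensor a b)"
proof -
  show add: "frag_tensor a (b + b') = frag_tensor a b + frag_tensor a b'" for b b'
    by (simp add: frag_tensor_alt frag_extend_add frag_extend_fun_add)
  show cm: "frag_tensor a (frag_cmul c b) = frag_cmul c (frag_tensor a b)" for c b
    by (simp add: frag_tensor_alt frag_extend_cmul frag_extend_fun_cmul)
  show m: "frag_tensor a (- b) = - frag_tensor a b" for b
    using cm[of "-1" b] by simp
  show "frag_tensor a (b - b') = frag_tensor a b - frag_tensor a b'"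
    using add[of b "- b'"] m[of b'] by simp
qed

lemma frag_tensor_carrier:
  assumes "a \<in> carrier free_endos" "b \<in> carrier free_endos"
  shows "frag_tensor a b \<in> carrier free_endos"
  using assms(1)
proof (induction a rule: free_endos_induct)
  case (one x)
  from assms(2) show ?case
    by (induction b rule: free_endos_induct)
       (use one in \<open>auto simp: frag_tensor_0 frag_tensor_of frag_tensor_right intro: free_endos_closed endo_tensor_endos\<close>)
qed (auto simp: frag_tensor_0 frag_tensor_left intro: free_endos_closed)

text \<open>A generating relation tensored with a single endomorphism is again a generating
  relation, by \<open>short_exact_tensor\<close>; bilinearity does the rest.\<close>

lemma frag_tensor_exact_rels:
  fixes a :: "'r::comm_ring_1 endo \<Rightarrow>\<^sub>0 int"
  assumes a: "a \<in> carrier free_endos" and r: "r \<in> exact_rels"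
  shows "frag_tensor a r \<in> exact_rels" "frag_tensor r a \<in> exact_rels"
proof -
  have gen: "frag_tensor a g \<in> exact_rels \<and> frag_tensor g a \<in> exact_rels" if gen: "g \<in> exact_gens" for g
    using a
  proof (induction a rule: free_endos_induct)
    case zero
    then show ?case by (simp add: frag_tensor_0 exact_rels_closed)
  next
    case (one w)
    obtain x y z where g: "g = frag_of y - frag_of x - frag_of z" "x \<in> endos" "y \<in> endos" "z \<in> endos"
      "short_exact x y z" using gen unfolding exact_gens_def by blast
    have "frag_tensor (frag_of w) g = frag_of (endo_tensor w y) - frag_of (endo_tensor w x) - frag_of (endo_tensor w z)"
      "frag_tensor g (frag_of w) = frag_of (endo_tensor y w) - frag_of (endo_tensor x w) - frag_of (endo_tensor z w)"
      by (simp_all add: g(1) frag_tensor_left frag_tensor_right frag_tensor_of)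
    then show ?case using short_exact_tensor[OF g(2,3,4) one g(5)] g(2-4) one
      by (auto intro!: exact_relI endo_tensor_endos)
  next
    case (diff a b)
    then show ?case by (simp add: frag_tensor_left frag_tensor_right exact_rels_closed)
  qed
  have "frag_tensor a r \<in> exact_rels \<and> frag_tensor r a \<in> exact_rels"
    using r[unfolded exact_rels_eq]
    by induction (use gen in \<open>auto simp: frag_tensor_0 frag_tensor_left frag_tensor_right exact_rels_closed\<close>)
  then show "frag_tensor a r \<in> exact_rels" "frag_tensor r a \<in> exact_rels" by auto
qed

text \<open>Trilinearity reduces the claim to single endomorphisms, where both bracketings have the
  same matrices.\<close>

lemma frag_tensor_assoc:
  fixes a b c :: "'r::comm_ring_1 endo \<Rightarrow>\<^sub>0 int"
  assumes "a \<in> carrier free_endos" "b \<in> carrier free_endos" "c \<in> carrier free_endos"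
  shows "frag_tensor (frag_tensor a b) c - frag_tensor a (frag_tensor b c) \<in> exact_rels"
  using assms(1)
proof (induction a rule: free_endos_induct)
  case (one x)
  note x = one
  from assms(2) show ?case
  proof (induction b rule: free_endos_induct)
    case (one y)
    note y = one
    from assms(3) show ?case
    proof (induction c rule: free_endos_induct)
      case (one z)
      obtain p M q N s L where r: "endo_rep x p M" "endo_rep y q N" "endo_rep z s L"
        using x y one by (meson endo_rep_endos_ex)
      have "endo_rep (endo_tensor x (endo_tensor y z)) (kron (kron p q) s) (kron (kron M N) L)"
        unfolding kron_assoc using r by (intro endo_rep_tensor)
      moreover have "endo_rep (endo_tensor (endo_tensor x y) z) (kron (kron p q) s) (kron (kron M N) L)"
        using r by (intro endo_rep_tensor)
      ultimately show ?case by (simp add: frag_tensor_of frag_of_same_rep)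
    next
      case (diff a b)
      then show ?case using exact_rels_closed(2)[OF diff(3,4)]
        by (simp add: frag_tensor_right algebra_simps)
    qed (simp add: frag_tensor_0 exact_rels_closed)
  next
    case (diff a b)
    then show ?case using exact_rels_closed(2)[OF diff(3,4)]
      by (simp add: frag_tensor_right frag_tensor_left algebra_simps)
  qed (simp add: frag_tensor_0 exact_rels_closed)
next
  case (diff a b)
  then show ?case using exact_rels_closed(2)[OF diff(3,4)]
    by (simp add: frag_tensor_left algebra_simps)
qed (simp add: frag_tensor_0 exact_rels_closed)

lemma endo_rep_one: "endo_rep ((1, carrier_vec 1, \<lambda>x. x) :: 'r::comm_ring_1 endo) (1\<^sub>m 1) (1\<^sub>m 1)"
  by (auto simp: endo_rep_def fixed_vecs_def)

lemma frag_tensor_one: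
  fixes a :: "'r::comm_ring_1 endo \<Rightarrow>\<^sub>0 int"
  assumes "a \<in> carrier free_endos"
  shows "frag_tensor \<one>\<^bsub>free_endos\<^esub> a - a \<in> exact_rels" "frag_tensor a \<one>\<^bsub>free_endos\<^esub> - a \<in> exact_rels"
proof -
  have "frag_tensor \<one>\<^bsub>free_endos\<^esub> a - a \<in> exact_rels \<and> frag_tensor a \<one>\<^bsub>free_endos\<^esub> - a \<in> exact_rels"
    using assms
  proof (induction a rule: free_endos_induct)
    case zero
    then show ?case by (simp add: frag_tensor_0 exact_rels_closed)
  next
    case (one x)
    obtain p M where r: "endo_rep x p M" using one by (meson endo_rep_endos_ex)
    show ?case unfolding free_endos_simps frag_tensor_of
      using frag_of_same_rep[OF r] endo_rep_tensor[OF endo_rep_one r] endo_rep_tensor[OF r endo_rep_one]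
      by (simp only: kron_one_left kron_one_right simp_thms)
  next
    case (diff a b)
    then show ?case
      using exact_rels_closed(2)[of "frag_tensor \<one>\<^bsub>free_endos\<^esub> a - a" "frag_tensor \<one>\<^bsub>free_endos\<^esub> b - b"]
        exact_rels_closed(2)[of "frag_tensor a \<one>\<^bsub>free_endos\<^esub> - a" "frag_tensor b \<one>\<^bsub>free_endos\<^esub> - b"]
      by (simp add: frag_tensor_left frag_tensor_right algebra_simps)
  qed
  then show "frag_tensor \<one>\<^bsub>free_endos\<^esub> a - a \<in> exact_rels" "frag_tensor a \<one>\<^bsub>free_endos\<^esub> - a \<in> exact_rels"
    by auto
qed

section \<open>Cosets of the exact relations and the ring they form\<close>

definition frag_class :: "('r::comm_ring_1 endo \<Rightarrow>\<^sub>0 int) \<Rightarrow> ('r endo \<Rightarrow>\<^sub>0 int) set" where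
  "frag_class c = exact_rels +>\<^bsub>free_endos\<^esub> c"

lemma frag_class_eq: "frag_class c = {d. d - c \<in> exact_rels}"
proof -
  have "d - c \<in> exact_rels \<Longrightarrow> \<exists>h\<in>exact_rels. d = h + c" for d by (intro bexI[of _ "d - c"]) auto
  then show ?thesis by (auto simp: frag_class_def a_r_coset_def' free_endos_simps)
qed

lemma frag_class_self: "c \<in> frag_class c"
  by (simp add: frag_class_eq exact_rels_closed)

lemma frag_class_eq_iff: "frag_class a = frag_class b \<longleftrightarrow> a - b \<in> exact_rels"
proof
  assume "frag_class a = frag_class b"
  then show "a - b \<in> exact_rels" using frag_class_self[of a] by (simp add: frag_class_eq)
next
  assume ab: "a - b \<in> exact_rels"
  have "d - a \<in> exact_rels \<longleftrightarrow> d - b \<in> exact_rels" for d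
    using exact_rels_closed(3)[OF _ ab, of "d - a"] exact_rels_closed(2)[OF _ ab, of "d - b"] by auto
  then show "frag_class a = frag_class b" by (simp add: frag_class_eq)
qed

lemma frag_class_carrier: "c \<in> carrier free_endos \<Longrightarrow> d \<in> frag_class c \<Longrightarrow> d \<in> carrier free_endos"
  using exact_rels_carrier free_endos_closed(2)[of "d - c" c] by (auto simp: frag_class_eq)

lemma K0_endo_carrier: "carrier K0_endo = frag_class ` carrier free_endos"
  by (auto simp: K0_endo_def FactRing_def A_RCOSETS_def' frag_class_def)

lemma K0_endo_zero: "\<zero>\<^bsub>K0_endo\<^esub> = frag_class 0"
  by (simp add: K0_endo_def FactRing_def frag_class_eq)

lemma K0_endo_one: "\<one>\<^bsub>K0_endo\<^esub> = frag_class \<one>\<^bsub>free_endos\<^esub>"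
  by (simp add: K0_endo_def FactRing_def frag_class_def)

lemma K0_endo_add: "frag_class a \<oplus>\<^bsub>K0_endo\<^esub> frag_class b = frag_class (a + b)"
proof -
  have "d - (a + b) \<in> exact_rels \<Longrightarrow> \<exists>x. x - a \<in> exact_rels \<and> (\<exists>y. y - b \<in> exact_rels \<and> d = x + y)" for d
    by (intro exI[of _ "d - b"] conjI exI[of _ b]) (auto simp: exact_rels_closed algebra_simps)
  moreover have "x + y - (a + b) \<in> exact_rels" if "x - a \<in> exact_rels" "y - b \<in> exact_rels" for x y
    using exact_rels_closed(3)[OF that] by (simp add: algebra_simps)
  ultimately show ?thesis
    by (auto simp: K0_endo_def FactRing_def set_add_def' free_endos_simps frag_class_eq)
qed

text \<open>The product of cosets in \<open>Quot\<close> is a union over all representatives. It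
  collapses to one coset because the product of a relation with any combination is a
  relation.\<close>

lemma K0_endo_mult:
  assumes a: "a \<in> carrier free_endos" and b: "b \<in> carrier free_endos"
  shows "frag_class a \<otimes>\<^bsub>K0_endo\<^esub> frag_class b = frag_class (frag_tensor a b)"
proof -
  have "frag_class (frag_tensor a' b') = frag_class (frag_tensor a b)"
    if a': "a' \<in> frag_class a" and b': "b' \<in> frag_class b" for a' b'
  proof -
    have c: "a' \<in> carrier free_endos" "b' \<in> carrier free_endos"
      using a b a' b' frag_class_carrier by blast+
    have "frag_tensor a' b' - frag_tensor a b = frag_tensor (a' - a) b' + frag_tensor a (b' - b)"
      by (simp add: frag_tensor_left frag_tensor_right)
    moreover have "frag_tensor (a' - a) b' \<in> exact_rels" "frag_tensor a (b' - b) \<in> exact_rels"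
      using a' b' frag_tensor_exact_rels(2)[OF c(2)] frag_tensor_exact_rels(1)[OF a]
      by (simp_all add: frag_class_eq)
    ultimately show ?thesis unfolding frag_class_eq_iff by (simp add: exact_rels_closed)
  qed
  then have "(\<Union>a'\<in>frag_class a. \<Union>b'\<in>frag_class b. frag_class (frag_tensor a' b')) = frag_class (frag_tensor a b)"
    using frag_class_self[of a] frag_class_self[of b] by blast
  then show ?thesis
    by (simp add: K0_endo_def FactRing_def rcoset_mult_def frag_class_def frag_tensor_def)
qed

text \<open>Associativity and the unit laws fail in \<open>free_endos\<close> only by exact
  relations, which vanish in the quotient.\<close>

lemma ring_K0_endo: "ring (K0_endo :: ('r::comm_ring_1 endo \<Rightarrow>\<^sub>0 int) set ring)"
proof (rule ringI)
  show "abelian_group (K0_endo :: ('r endo \<Rightarrow>\<^sub>0 int) set ring)"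
  proof (rule abelian_groupI)
    fix X :: "('r endo \<Rightarrow>\<^sub>0 int) set" assume "X \<in> carrier K0_endo"
    then obtain a where a: "a \<in> carrier free_endos" "X = frag_class a" by (auto simp: K0_endo_carrier)
    then show "\<exists>y\<in>carrier K0_endo. y \<oplus>\<^bsub>K0_endo\<^esub> X = \<zero>\<^bsub>K0_endo\<^esub>"
      by (intro bexI[of _ "frag_class (- a)"])
         (auto simp: K0_endo_carrier K0_endo_add K0_endo_zero intro: free_endos_closed)
  qed (auto simp: K0_endo_carrier K0_endo_add K0_endo_zero algebra_simps intro!: imageI free_endos_closed)
  show "monoid (K0_endo :: ('r endo \<Rightarrow>\<^sub>0 int) set ring)"
  proof (rule monoidI)
    have one: "\<one>\<^bsub>free_endos\<^esub> \<in> carrier (free_endos :: ('r endo \<Rightarrow>\<^sub>0 int) ring)"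
      unfolding free_endos_simps by (intro free_endos_closed(5) endo_rep_imp_endos[OF endo_rep_one])
    then show "\<one>\<^bsub>K0_endo\<^esub> \<in> carrier (K0_endo :: ('r endo \<Rightarrow>\<^sub>0 int) set ring)"
      by (simp add: K0_endo_carrier K0_endo_one)
    fix X Y Z :: "('r endo \<Rightarrow>\<^sub>0 int) set"
    assume "X \<in> carrier K0_endo"
    then obtain a where a: "a \<in> carrier free_endos" "X = frag_class a" by (auto simp: K0_endo_carrier)
    show "\<one>\<^bsub>K0_endo\<^esub> \<otimes>\<^bsub>K0_endo\<^esub> X = X" "X \<otimes>\<^bsub>K0_endo\<^esub> \<one>\<^bsub>K0_endo\<^esub> = X"
      using a one frag_tensor_one[OF a(1)] by (simp_all add: K0_endo_one K0_endo_mult frag_class_eq_iff)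
    assume "Y \<in> carrier K0_endo"
    then obtain b where b: "b \<in> carrier free_endos" "Y = frag_class b" by (auto simp: K0_endo_carrier)
    show "X \<otimes>\<^bsub>K0_endo\<^esub> Y \<in> carrier K0_endo"
      using a b by (simp add: K0_endo_mult K0_endo_carrier frag_tensor_carrier)
    assume "Z \<in> carrier K0_endo"
    then obtain c where c: "c \<in> carrier free_endos" "Z = frag_class c" by (auto simp: K0_endo_carrier)
    show "X \<otimes>\<^bsub>K0_endo\<^esub> Y \<otimes>\<^bsub>K0_endo\<^esub> Z = X \<otimes>\<^bsub>K0_endo\<^esub> (Y \<otimes>\<^bsub>K0_endo\<^esub> Z)"
      using a b c by (simp add: K0_endo_mult frag_tensor_carrier frag_class_eq_iff frag_tensor_assoc)
  qed
qed (auto simp: K0_endo_carrier K0_endo_add K0_endo_mult frag_tensor_left frag_tensor_right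
       free_endos_closed frag_tensor_carrier)

section \<open>The ring \<open>W\<^sub>0(R)\<close>\<close>

definition zero_gens :: "('r::comm_ring_1 endo \<Rightarrow>\<^sub>0 int) set" where
  "zero_gens = {frag_of (n, E, f) | n E f. (n, E, f) \<in> endos \<and> (\<forall>x\<in>E. f x = 0\<^sub>v n)}"

text \<open>The formal combinations that become zero in W_0(R). It merges the two successive
  quotients, first by exact sequences and then by zero endomorphisms, into one.\<close>

definition null_frags :: "('r::comm_ring_1 endo \<Rightarrow>\<^sub>0 int) set" where
  "null_frags = group_closure (exact_gens \<union> zero_gens)"

lemma null_frags_closed:
  "0 \<in> null_frags" "a \<in> null_frags \<Longrightarrow> b \<in> null_frags \<Longrightarrow> a - b \<in> null_frags"
  "a \<in> null_frags \<Longrightarrow> b \<in> null_frags \<Longrightarrow> a + b \<in> null_frags" "a \<in> null_frags \<Longrightarrow> - a \<in> null_frags"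
  by (auto simp: null_frags_def intro: group_closure.diff group_closure_add)

lemma exact_rels_null: "exact_rels \<subseteq> null_frags"
  unfolding exact_rels_eq null_frags_def
  by (rule group_closure_subset) (auto intro: group_closure.base)

lemma null_frags_carrier: "null_frags \<subseteq> carrier free_endos"
proof
  fix a :: "'a endo \<Rightarrow>\<^sub>0 int" assume a: "a \<in> null_frags"
  have "zero_gens \<subseteq> (carrier free_endos :: ('a endo \<Rightarrow>\<^sub>0 int) set)"
    by (auto simp: zero_gens_def intro: free_endos_closed)
  from a this show "a \<in> carrier free_endos" unfolding null_frags_def
    by (induction) (use exact_gens_carrier in \<open>auto intro: free_endos_closed\<close>)
qed

lemma endo_rep_zero:
  assumes r: "endo_rep (n, E, f) p M" and z: "\<forall>x\<in>E. f x = 0\<^sub>v n"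
  shows "M = 0\<^sub>m n n"
proof (rule mat_eqI_vec[of _ n n])
  note d = endo_repD[OF r]
  show "M \<in> carrier_mat n n" by (rule d)
  fix v :: "'a vec" assume v: "v \<in> carrier_vec n"
  have "M *\<^sub>v (p *\<^sub>v v) = 0\<^sub>v n" using d(9)[OF d(10)[OF v]] z d(10)[OF v] by simp
  then show "M *\<^sub>v v = 0\<^sub>m n n *\<^sub>v v" using v d(1,2,4) by (simp add: mult_mat_mat_vec[of M n n p n])
qed simp

lemma zero_gens_rep:
  assumes "endo_rep x p (0\<^sub>m n n)"
  shows "frag_of x \<in> zero_gens"
proof -
  obtain m E f where x: "x = (m, E, f)" by (metis prod_cases3)
  note d = endo_repD[OF assms[unfolded x]]
  have "m = n" using d(2) by (metis carrier_matD(1) index_zero_mat(2))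
  then have "\<forall>v\<in>E. f v = 0\<^sub>v m" using d(7,9) by simp
  then show ?thesis using endo_rep_imp_endos[OF assms] unfolding x zero_gens_def by blast
qed

text \<open>The Kronecker product with a zero matrix is zero, so a tensor product with a zero
  endomorphism is again a zero endomorphism.\<close>

lemma zero_gens_tensor:
  fixes w z :: "'r::comm_ring_1 endo"
  assumes "frag_of z \<in> zero_gens" "w \<in> endos"
  shows "frag_of (endo_tensor w z) \<in> zero_gens" "frag_of (endo_tensor z w) \<in> zero_gens"
proof -
  obtain n E f where z: "z = (n, E, f)" "z \<in> endos" "\<forall>x\<in>E. f x = 0\<^sub>v n"
    using assms(1) unfolding zero_gens_def frag_of_eq by (auto simp: frag_of_eq)
  obtain p M where r: "endo_rep z p M" using z(2) by (meson endo_rep_endos_ex)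
  have r': "endo_rep z p (0\<^sub>m n n)" using endo_rep_zero[OF r[unfolded z(1)] z(3)] r by simp
  obtain m F g where w: "w = (m, F, g)" by (metis prod_cases3)
  obtain q N where s: "endo_rep w q N" using assms(2) by (meson endo_rep_endos_ex)
  have N: "N \<in> carrier_mat m m" using endo_repD(2)[OF s[unfolded w]] .
  show "frag_of (endo_tensor w z) \<in> zero_gens" "frag_of (endo_tensor z w) \<in> zero_gens"
    using endo_rep_tensor[OF s r'] endo_rep_tensor[OF r' s]
    by (auto simp: kron_zero_right[OF N] kron_zero_left[OF N] intro: zero_gens_rep)
qed

lemma frag_tensor_null:
  fixes a :: "'r::comm_ring_1 endo \<Rightarrow>\<^sub>0 int"
  assumes a: "a \<in> carrier free_endos" and r: "r \<in> null_frags"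
  shows "frag_tensor a r \<in> null_frags" "frag_tensor r a \<in> null_frags"
proof -
  have gen: "frag_tensor a g \<in> null_frags \<and> frag_tensor g a \<in> null_frags" if g: "g \<in> zero_gens" for g
    using a
  proof (induction a rule: free_endos_induct)
    case (one w)
    obtain z where z: "g = frag_of z" using g by (auto simp: zero_gens_def)
    then show ?case using zero_gens_tensor[of z w] one g
      by (auto simp: frag_tensor_of null_frags_def intro: group_closure.base)
  qed (auto simp: frag_tensor_0 frag_tensor_left frag_tensor_right null_frags_closed)
  have gen': "frag_tensor a g \<in> null_frags \<and> frag_tensor g a \<in> null_frags" if "g \<in> exact_gens" for g
    using frag_tensor_exact_rels[OF a, of g] that exact_rels_null
    by (auto simp: exact_rels_eq intro: group_closure.base)
  have "frag_tensor a r \<in> null_frags \<and> frag_tensor r a \<in> null_frags"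
    using r[unfolded null_frags_def]
    by induction (use gen gen' in \<open>auto simp: frag_tensor_0 frag_tensor_left frag_tensor_right null_frags_closed\<close>)
  then show "frag_tensor a r \<in> null_frags" "frag_tensor r a \<in> null_frags" by auto
qed

lemma ideal_null_frags:
  "ideal (frag_class ` null_frags) (K0_endo :: ('r::comm_ring_1 endo \<Rightarrow>\<^sub>0 int) set ring)"
proof -
  interpret K: ring "K0_endo :: ('r endo \<Rightarrow>\<^sub>0 int) set ring" by (rule ring_K0_endo)
  have sub: "a \<in> null_frags \<Longrightarrow> a \<in> carrier free_endos" for a :: "'r endo \<Rightarrow>\<^sub>0 int"
    using null_frags_carrier by blast
  show ?thesis
  proof (rule idealI[OF ring_K0_endo], rule K.add.subgroupI)
    show "frag_class ` null_frags \<subseteq> carrier (K0_endo :: ('r endo \<Rightarrow>\<^sub>0 int) set ring)"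
      using sub by (auto simp: K0_endo_carrier)
    show "frag_class ` null_frags \<noteq> ({} :: ('r endo \<Rightarrow>\<^sub>0 int) set set)"
      using null_frags_closed(1) by blast
    fix X :: "('r endo \<Rightarrow>\<^sub>0 int) set" assume "X \<in> frag_class ` null_frags"
    then obtain a where a: "a \<in> null_frags" "X = frag_class a" by blast
    have "\<ominus>\<^bsub>K0_endo\<^esub> X = frag_class (- a)"
      using a sub by (intro K.minus_equality)
        (auto simp: K0_endo_add K0_endo_zero K0_endo_carrier intro: free_endos_closed)
    then show "\<ominus>\<^bsub>K0_endo\<^esub> X \<in> frag_class ` null_frags" using a null_frags_closed(4) by blast
    show "X \<oplus>\<^bsub>K0_endo\<^esub> Y \<in> frag_class ` null_frags" if "Y \<in> frag_class ` null_frags" for Y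
      using that a by (auto simp: K0_endo_add intro!: imageI null_frags_closed(3))
    fix Y :: "('r endo \<Rightarrow>\<^sub>0 int) set" assume "Y \<in> carrier K0_endo"
    then obtain b where b: "b \<in> carrier free_endos" "Y = frag_class b" by (auto simp: K0_endo_carrier)
    show "Y \<otimes>\<^bsub>K0_endo\<^esub> X \<in> frag_class ` null_frags" "X \<otimes>\<^bsub>K0_endo\<^esub> Y \<in> frag_class ` null_frags"
      using a b sub frag_tensor_null[OF b(1) a(1)] by (simp_all add: K0_endo_mult)
  qed
qed

text \<open>The additive group generated by the classes of zero endomorphisms is already an ideal,
  so it is the ideal generated by them.\<close>

lemma zero_ideal_eq: "zero_ideal = (frag_class ` null_frags :: ('r::comm_ring_1 endo \<Rightarrow>\<^sub>0 int) set set)"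
proof -
  interpret K: ring "K0_endo :: ('r endo \<Rightarrow>\<^sub>0 int) set ring" by (rule ring_K0_endo)
  let ?S = "frag_class ` (zero_gens :: ('r endo \<Rightarrow>\<^sub>0 int) set)"
  have Z: "zero_ideal = Idl\<^bsub>K0_endo\<^esub> ?S"
    unfolding zero_ideal_def endo_class_def zero_gens_def frag_class_def
    by (rule arg_cong[where f = "genideal K0_endo"]) blast
  have gens: "?S \<subseteq> frag_class ` null_frags"
    by (auto simp: null_frags_def intro!: imageI group_closure.base)
  have Sc: "?S \<subseteq> carrier K0_endo"
    using gens null_frags_carrier unfolding K0_endo_carrier by blast
  have "(zero_ideal :: ('r endo \<Rightarrow>\<^sub>0 int) set set) \<subseteq> frag_class ` null_frags"
    unfolding Z by (rule K.genideal_minimal[OF ideal_null_frags gens])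
  moreover have "frag_class a \<in> zero_ideal" if "a \<in> null_frags" for a :: "'r endo \<Rightarrow>\<^sub>0 int"
    using that unfolding null_frags_def
  proof induction
    interpret I: ideal "zero_ideal" "K0_endo :: ('r endo \<Rightarrow>\<^sub>0 int) set ring"
      unfolding Z by (rule K.genideal_ideal[OF Sc])
    {
      case (base a)
      then consider "a = 0" | "a \<in> exact_rels" | "a \<in> zero_gens"
        by (auto simp: exact_rels_eq intro: group_closure.base)
      then show ?case
      proof cases
        case 3
        then show ?thesis using K.genideal_self[OF Sc] unfolding Z by blast
      next
        case 2
        then have "frag_class a = \<zero>\<^bsub>K0_endo\<^esub>" by (simp add: K0_endo_zero frag_class_eq_iff)
        then show ?thesis by (metis I.zero_closed)
      qed (metis I.zero_closed K0_endo_zero)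
    next
      case (diff a b)
      have b: "b \<in> carrier free_endos" using diff null_frags_carrier unfolding null_frags_def by blast
      have "\<ominus>\<^bsub>K0_endo\<^esub> frag_class b = frag_class (- b)"
        using b by (intro K.minus_equality)
          (auto simp: K0_endo_add K0_endo_zero K0_endo_carrier intro: free_endos_closed)
      then have "frag_class (- b) \<in> zero_ideal" using I.a_inv_closed[of "frag_class b"] diff by simp
      then have "frag_class a \<oplus>\<^bsub>K0_endo\<^esub> frag_class (- b) \<in> zero_ideal" using diff by (intro I.a_closed)
      then show ?case by (simp add: K0_endo_add)
    }
  qed
  ultimately show ?thesis by blast
qed

lemma ideal_zero_ideal: "ideal zero_ideal (K0_endo :: ('r::comm_ring_1 endo \<Rightarrow>\<^sub>0 int) set ring)"
  unfolding zero_ideal_eq by (rule ideal_null_frags)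

definition W0_class :: "('r::comm_ring_1 endo \<Rightarrow>\<^sub>0 int) \<Rightarrow> ('r endo \<Rightarrow>\<^sub>0 int) set set" where
  "W0_class c = zero_ideal +>\<^bsub>K0_endo\<^esub> frag_class c"

lemma W0_carrier: "carrier W0 = W0_class ` carrier free_endos"
  by (auto simp: W0_def FactRing_def A_RCOSETS_def' W0_class_def K0_endo_carrier)

lemma W0_class_eq: "W0_class c = frag_class ` {d. d - c \<in> null_frags}"
proof -
  have "{d. d - c \<in> null_frags} = (\<lambda>n. n + c) ` null_frags"
  proof (intro equalityI subsetI)
    fix d assume "d \<in> {d. d - c \<in> null_frags}"
    then show "d \<in> (\<lambda>n. n + c) ` null_frags" by (intro image_eqI[of _ _ "d - c"]) auto
  qed auto
  then show ?thesis by (auto simp: W0_class_def a_r_coset_def' zero_ideal_eq K0_endo_add image_image)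
qed

text \<open>Flattening the two levels of cosets gives a single coset of \<open>null_frags\<close>,
  because \<open>null_frags\<close> contains \<open>exact_rels\<close>. On this set
  \<open>L_map\<close> evaluates \<open>free_char\<close>.\<close>

lemma Union_W0_class: "\<Union> (W0_class c) = {d. d - c \<in> null_frags}"
proof -
  have "e - c \<in> null_frags" if "d - c \<in> null_frags" "e - d \<in> exact_rels" for d e
    using null_frags_closed(3)[OF _ that(1), of "e - d"] that(2) exact_rels_null by auto
  moreover have "d \<in> frag_class d" for d :: "'a endo \<Rightarrow>\<^sub>0 int" by (rule frag_class_self)
  ultimately show ?thesis unfolding W0_class_eq by (auto simp: frag_class_eq)
qed

lemma W0_class_cong: "a - b \<in> null_frags \<Longrightarrow> W0_class a = W0_class b"
proof -
  assume ab: "a - b \<in> null_frags"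
  have "d - a \<in> null_frags \<longleftrightarrow> d - b \<in> null_frags" for d
    using null_frags_closed(3)[OF _ ab, of "d - a"] null_frags_closed(2)[OF _ ab, of "d - b"] by auto
  then show ?thesis by (simp add: W0_class_eq)
qed

lemma W0_add:
  assumes "a \<in> carrier free_endos" "b \<in> carrier free_endos"
  shows "W0_class a \<oplus>\<^bsub>W0\<^esub> W0_class b = W0_class (a + b)"
proof -
  interpret I: ideal zero_ideal "K0_endo :: ('a endo \<Rightarrow>\<^sub>0 int) set ring" by (rule ideal_zero_ideal)
  show ?thesis using I.a_rcos_sum[of "frag_class a" "frag_class b"] assms
    by (simp add: W0_def FactRing_def W0_class_def K0_endo_carrier K0_endo_add)
qed

lemma W0_mult:
  assumes "a \<in> carrier free_endos" "b \<in> carrier free_endos"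
  shows "W0_class a \<otimes>\<^bsub>W0\<^esub> W0_class b = W0_class (frag_tensor a b)"
proof -
  interpret I: ideal zero_ideal "K0_endo :: ('a endo \<Rightarrow>\<^sub>0 int) set ring" by (rule ideal_zero_ideal)
  show ?thesis using I.rcoset_mult_add[of "frag_class a" "frag_class b"] assms
    by (simp add: W0_def FactRing_def W0_class_def K0_endo_carrier K0_endo_mult)
qed

lemma W0_one: "\<one>\<^bsub>W0\<^esub> = W0_class \<one>\<^bsub>free_endos\<^esub>"
  by (simp add: W0_def FactRing_def W0_class_def K0_endo_one)

section \<open>The map \<open>L\<^sub>R\<close>\<close>

lemma endo_char_nth_0: "fps_nth (endo_char x) 0 = 1"
  by (simp add: endo_char_def)

lemma free_char_superset:
  assumes "finite S" "Poly_Mapping.keys c \<subseteq> S"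
  shows "free_char c = (\<Prod>x\<in>S. fps_int_pow (endo_char x) (Poly_Mapping.lookup c x))"
  unfolding free_char_def using assms
  by (intro prod.mono_neutral_left) (auto simp: in_keys_iff)

lemma free_char_nth_0: "fps_nth (free_char c) 0 = 1"
  by (simp add: free_char_def fps_nth_prod_0 fps_int_pow_nth_0 endo_char_nth_0)

lemma free_char_add: "free_char (a + b) = free_char a * free_char b"
proof -
  let ?S = "Poly_Mapping.keys a \<union> Poly_Mapping.keys b"
  have "Poly_Mapping.keys (a + b) \<subseteq> ?S" by (rule Poly_Mapping.keys_add)
  then show ?thesis
    by (simp add: free_char_superset[of ?S] lookup_add fps_int_pow_add endo_char_nth_0 prod.distrib)
qed

lemma free_char_0: "free_char 0 = 1"
  by (simp add: free_char_def)

lemma free_char_of: "free_char (frag_of x) = endo_char x"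
  by (simp add: free_char_def keys_frag_of fps_int_pow_def)

lemma free_char_uminus: "free_char (- a) = fps_inv1 (free_char a)"
  by (rule fps_inv1_unique[symmetric])
     (simp_all add: free_char_add[symmetric] free_char_0 free_char_nth_0)

lemma free_char_diff: "free_char (a - b) = free_char a * fps_inv1 (free_char b)"
  using free_char_add[of a "- b"] by (simp add: free_char_uminus)

text \<open>One endomorphism may carry several pairs \<open>p\<close>, \<open>M\<close>. The
  sequence 0 -> x -> x -> 0 -> 0, read with one pair on the left and another in the middle, shows by
  \<open>rev_char_short_exact\<close> that det(1 - tM) is independent of the pair.\<close>

lemma endo_char_rep:
  fixes x :: "'r::comm_ring_1 endo"
  assumes r: "endo_rep x p M"
  shows "endo_char x = fps_inv1 (rev_char M)"
proof -
  let ?z = "(0, fixed_vecs (0\<^sub>m 0 0), \<lambda>v. 0\<^sub>m 0 0 *\<^sub>v v) :: 'r endo"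
  have rz: "endo_rep ?z (0\<^sub>m 0 0) (0\<^sub>m 0 0)" by (rule endo_rep_fixed_vecs) auto
  obtain q where s: "endo_rep x q (endo_mat x)" using endo_rep_endo_mat[OF endo_rep_imp_endos[OF r]] .
  obtain n E f where x: "x = (n, E, f)" by (metis prod_cases3)
  note d = endo_repD[OF r[unfolded x]]
  have "matrix_exact p M p M (0\<^sub>m 0 0) (0\<^sub>m 0 0) p (0\<^sub>m 0 n) (0\<^sub>m n 0) p"
    using d(1-5) by (auto simp: matrix_exact_def)
  from short_exactI[OF r r rz this] have "short_exact x x ?z" .
  from rev_char_short_exact[OF s r rz this] have "rev_char M = rev_char (endo_mat x)"
    by (simp add: rev_char_zero)
  moreover have "dim_row (endo_mat x) = fst x" using endo_repD(2)[OF s[unfolded x]] by (simp add: x)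
  ultimately show ?thesis by (simp add: endo_char_def rev_char_def)
qed

lemma endo_rep_rev_char_nth_0: "endo_rep x p M \<Longrightarrow> fps_nth (rev_char M) 0 = 1"
  by (cases x) (auto dest: endo_repD(2) intro: rev_char_nth_0)

text \<open>Exact relations are killed because determinants multiply along exact sequences, zero
  endomorphisms because det(1) = 1. This makes L_R well defined.\<close>

lemma free_char_null:
  fixes a :: "'r::comm_ring_1 endo \<Rightarrow>\<^sub>0 int"
  assumes "a \<in> null_frags"
  shows "free_char a = 1"
  using assms unfolding null_frags_def
proof induction
  case (base a)
  then consider "a = 0" | "a \<in> exact_gens" | "a \<in> zero_gens" by auto
  then show ?case
  proof cases
    case 2
    then obtain x y z where a: "a = frag_of y - frag_of x - frag_of z" "x \<in> endos" "y \<in> endos" "z \<in> endos"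
      "short_exact x y z" unfolding exact_gens_def by blast
    obtain p M q N s L where r: "endo_rep x p M" "endo_rep y q N" "endo_rep z s L"
      using a(2-4) by (meson endo_rep_endos_ex)
    note c = endo_rep_rev_char_nth_0[OF r(1)] endo_rep_rev_char_nth_0[OF r(3)]
    have "free_char a = fps_inv1 (rev_char M) * fps_inv1 (rev_char L) * (rev_char M * rev_char L)"
      using rev_char_short_exact[OF r a(5)] c
      by (simp add: a(1) free_char_diff free_char_of endo_char_rep[OF r(1)] endo_char_rep[OF r(2)]
          endo_char_rep[OF r(3)] fps_inv1_inv1 fps_inv1_distrib mult_ac)
    also have "\<dots> = (rev_char M * fps_inv1 (rev_char M)) * (rev_char L * fps_inv1 (rev_char L))"
      by (simp add: mult_ac)
    also have "\<dots> = 1" using c by (simp add: fps_inv1_mult)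
    finally show ?thesis .
  next
    case 3
    then obtain n E f where a: "a = frag_of (n, E, f)" "(n, E, f) \<in> endos" "\<forall>x\<in>E. f x = 0\<^sub>v n"
      by (auto simp: zero_gens_def)
    obtain p M where r: "endo_rep (n, E, f) p M" using a(2) by (meson endo_rep_endos_ex)
    then show ?thesis using endo_rep_zero[OF r a(3)]
      by (simp add: a(1) free_char_of endo_char_rep[OF r] rev_char_zero fps_inv1_one)
  qed (simp add: free_char_0)
qed (simp add: free_char_diff fps_inv1_one)

lemma L_map_W0_class: "L_map (W0_class c) = free_char c"
proof -
  have eq: "free_char d = free_char c" if "d - c \<in> null_frags" for d
    using free_char_null[OF that] free_char_add[of "d - c" c] by simp
  have "c \<in> {d. d - c \<in> null_frags}" by (simp add: null_frags_closed)
  then have "(\<lambda>_. free_char c) ` {d. d - c \<in> null_frags} = {free_char c}" by (rule image_constant)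
  moreover have "free_char ` {d. d - c \<in> null_frags} = (\<lambda>_. free_char c) ` {d. d - c \<in> null_frags}"
    by (rule image_cong[OF refl]) (rule eq, simp)
  ultimately have "free_char ` {d. d - c \<in> null_frags} = {free_char c}" by (simp only:)
  then show ?thesis by (simp add: L_map_def Union_W0_class)
qed

section \<open>Polynomials acting on sequences\<close>

text \<open>The polynomial \<open>p\<close> evaluated at the shift operator, applied to the sequence
  \<open>s\<close>.\<close>

definition act :: "'r::comm_ring_1 poly \<Rightarrow> (nat \<Rightarrow> 'r) \<Rightarrow> nat \<Rightarrow> 'r" where
  "act p s t = (\<Sum>d\<le>degree p. coeff p d * s (t + d))"

lemma act_bound:
  assumes "degree p \<le> D"
  shows "act p s t = (\<Sum>d\<le>D. coeff p d * s (t + d))"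
  unfolding act_def using assms
  by (intro sum.mono_neutral_left) (auto simp: coeff_eq_0)

lemma act_0 [simp]: "act 0 s t = 0"
  by (simp add: act_def)

lemma act_add_poly: "act (p + q) s t = act p s t + act q s t"
proof -
  let ?D = "max (degree p) (degree q)"
  have "degree (p + q) \<le> ?D" by (rule degree_add_le_max)
  then show ?thesis
    by (simp add: act_bound[of _ ?D] distrib_right sum.distrib)
qed

lemma act_smult_poly: "act (Polynomial.smult a p) s t = a * act p s t"
proof -
  have "degree (Polynomial.smult a p) \<le> degree p" by (rule degree_smult_le)
  then show ?thesis by (simp add: act_bound[of _ "degree p"] sum_distrib_left mult.assoc)
qed

lemma act_sum_poly: "act (\<Sum>x\<in>S. f x) s t = (\<Sum>x\<in>S. act (f x) s t)"
  by (induction S rule: infinite_finite_induct) (simp_all add: act_add_poly)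

lemma act_pCons: "act (pCons a p) s t = a * s t + act p s (Suc t)"
proof -
  have "act (pCons a p) s t = (\<Sum>d\<le>Suc (degree p). coeff (pCons a p) d * s (t + d))"
    by (rule act_bound) (rule degree_pCons_le)
  also have "\<dots> = a * s t + act p s (Suc t)"
    by (subst sum.atMost_Suc_shift) (simp add: act_def)
  finally show ?thesis .
qed

lemma act_shift: "act p (\<lambda>t. s (Suc t)) t = act p s (Suc t)"
  by (simp add: act_def)

lemma act_add: "act p (\<lambda>t. s t + s' t) t = act p s t + act p s' t"
  by (simp add: act_def distrib_left sum.distrib)

lemma act_smult: "act p (\<lambda>t. a * s t) t = a * act p s t"
  by (simp add: act_def sum_distrib_left mult_ac)

lemma act_zero [simp]: "act p (\<lambda>t. 0) t = 0"
  by (simp add: act_def)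

lemma act_sum: "act p (\<lambda>t. \<Sum>x\<in>S. f x t) t = (\<Sum>x\<in>S. act p (f x) t)"
  by (induction S rule: infinite_finite_induct) (simp_all add: act_add)

lemma act_mult: "act (p * q) s t = act p (act q s) t"
proof (induction p arbitrary: t)
  case (pCons a p)
  then show ?case by (simp add: act_add_poly act_smult_poly act_pCons)
qed simp

text \<open>A family \<open>u\<close> of sequences is indexed by \<open>(component, time)\<close>. A matrix of polynomials acts on it,
  the variable acting as the shift.\<close>

type_synonym 'r fam = "nat \<Rightarrow> nat \<Rightarrow> 'r"

definition fam_shift :: "'r fam \<Rightarrow> 'r fam" where
  "fam_shift u = (\<lambda>i t. u i (Suc t))"

definition mat_act :: "nat set \<Rightarrow> (nat \<Rightarrow> nat \<Rightarrow> 'r::comm_ring_1 poly) \<Rightarrow> 'r fam \<Rightarrow> 'r fam" where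
  "mat_act I P u = (\<lambda>i t. \<Sum>j\<in>I. act (P i j) (u j) t)"

definition Sol :: "nat set \<Rightarrow> (nat \<Rightarrow> nat \<Rightarrow> 'r::comm_ring_1 poly) \<Rightarrow> 'r fam set" where
  "Sol I P = {u. (\<forall>i\<in>I. \<forall>t. mat_act I P u i t = 0) \<and> (\<forall>i. i \<notin> I \<longrightarrow> (\<forall>t. u i t = 0))}"

section \<open>Monic systems of linear recurrences\<close>

definition monic_mat :: "nat set \<Rightarrow> nat \<Rightarrow> (nat \<Rightarrow> nat \<Rightarrow> 'r::comm_ring_1 poly) \<Rightarrow> bool" where
  "monic_mat I k P \<longleftrightarrow> (\<forall>i\<in>I. \<forall>j\<in>I. \<forall>d\<ge>k. coeff (P i j) d = (if i = j \<and> d = k then 1 else 0))"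

lemma monic_mat_degree:
  assumes "monic_mat I k P" "i \<in> I" "j \<in> I"
  shows "degree (P i j) \<le> k"
  using assms by (intro degree_le) (auto simp: monic_mat_def)

text \<open>Separating the top coefficient turns P u = w into a recurrence that expresses the values
  at time t + k by those at the k preceding times.\<close>

lemma mat_act_monic:
  assumes P: "monic_mat I k P" and I: "finite I" "i \<in> I"
  shows "mat_act I P u i t = u i (t + k) + (\<Sum>j\<in>I. \<Sum>d<k. coeff (P i j) d * u j (t + d))"
proof -
  have "act (P i j) (u j) t = (if i = j then u j (t + k) else 0) + (\<Sum>d<k. coeff (P i j) d * u j (t + d))"
    if "j \<in> I" for j
  proof -
    have "coeff (P i j) k = (if i = j then 1 else 0)" using P I that by (auto simp: monic_mat_def)
    moreover have "act (P i j) (u j) t = (\<Sum>d\<le>k. coeff (P i j) d * u j (t + d))"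
      by (rule act_bound) (rule monic_mat_degree[OF P I(2) that])
    ultimately show ?thesis by (simp add: lessThan_Suc_atMost[symmetric] add.commute)
  qed
  then have "mat_act I P u i t = (\<Sum>j\<in>I. (if i = j then u j (t + k) else 0)
      + (\<Sum>d<k. coeff (P i j) d * u j (t + d)))"
    by (simp add: mat_act_def)
  then show ?thesis using I by (simp add: sum.distrib)
qed

text \<open>Solves the recurrence with initial values \<open>a\<close> and right-hand side
  \<open>w\<close>. The case w = 0 provides coordinates on \<open>Sol\<close>, general
  \<open>w\<close> the surjectivity of maps between solution spaces.\<close>

function mat_solve :: "nat set \<Rightarrow> nat \<Rightarrow> (nat \<Rightarrow> nat \<Rightarrow> 'r::comm_ring_1 poly) \<Rightarrow> 'r fam \<Rightarrow> 'r fam \<Rightarrow> 'r fam" where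
  "mat_solve I k P w a i t = (if i \<notin> I then 0 else if t < k then a i t
     else w i (t - k) - (\<Sum>j\<in>I. \<Sum>d\<in>{..<k}. coeff (P i j) d * mat_solve I k P w a j (t - k + d)))"
  by pat_completeness auto
termination
  by (relation "measure (\<lambda>(I, k, P, w, a, i, t). t)") auto

declare mat_solve.simps [simp del]

lemma mat_solve_exists:
  fixes w a :: "'r::comm_ring_1 fam"
  assumes P: "monic_mat I k P" and I: "finite I"
  obtains u where "\<And>i t. i \<in> I \<Longrightarrow> mat_act I P u i t = w i t"
    "\<And>i t. i \<in> I \<Longrightarrow> t < k \<Longrightarrow> u i t = a i t" "\<And>i t. i \<notin> I \<Longrightarrow> u i t = 0"
proof -
  let ?u = "mat_solve I k P w a"
  have "mat_act I P ?u i t = w i t" if "i \<in> I" for i t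
    unfolding mat_act_monic[OF P I that] by (subst mat_solve.simps) (use that in simp)
  moreover have "?u i t = a i t" if "i \<in> I" "t < k" for i t
    using that by (simp add: mat_solve.simps)
  moreover have "?u i t = 0" if "i \<notin> I" for i t
    using that by (simp add: mat_solve.simps)
  ultimately show ?thesis using that by blast
qed

lemma mat_solve_unique:
  assumes P: "monic_mat I k P" and I: "finite I"
    and u: "u \<in> Sol I P" and init: "\<And>i t. i \<in> I \<Longrightarrow> t < k \<Longrightarrow> u i t = 0"
  shows "u = (\<lambda>i t. 0)"
proof -
  have "\<forall>i. u i t = 0" for t
  proof (induction t rule: less_induct)
    case (less t)
    show ?case
    proof
      fix i
      consider "i \<notin> I" | "i \<in> I" "t < k" | "i \<in> I" "k \<le> t" by linarith
      then show "u i t = 0"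
      proof cases
        case 3
        have "0 = mat_act I P u i (t - k)" using u 3 by (simp add: Sol_def)
        also have "\<dots> = u i t + (\<Sum>j\<in>I. \<Sum>d<k. coeff (P i j) d * u j (t - k + d))"
          using 3 by (simp add: mat_act_monic[OF P I])
        also have "\<dots> = u i t" using less 3 by simp
        finally show ?thesis by simp
      qed (use u init in \<open>auto simp: Sol_def\<close>)
    qed
  qed
  then show ?thesis by auto
qed

lemma Sol_closed:
  "(\<lambda>i t. 0) \<in> Sol I P"
  "u \<in> Sol I P \<Longrightarrow> v \<in> Sol I P \<Longrightarrow> (\<lambda>i t. u i t + v i t) \<in> Sol I P"
  "u \<in> Sol I P \<Longrightarrow> (\<lambda>i t. a * u i t) \<in> Sol I P"
  "u \<in> Sol I P \<Longrightarrow> fam_shift u \<in> Sol I P"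
  by (auto simp: Sol_def mat_act_def act_add act_smult fam_shift_def act_shift sum.distrib
      simp flip: sum_distrib_left)

section \<open>Shift-invariant spaces as endomorphisms\<close>

definition mat_endo :: "'r::comm_ring_1 mat \<Rightarrow> 'r endo" where
  "mat_endo A = (dim_row A, carrier_vec (dim_row A), \<lambda>v. A *\<^sub>v v)"

lemma endo_rep_mat_endo: "A \<in> carrier_mat n n \<Longrightarrow> endo_rep (mat_endo A) (1\<^sub>m n) A"
  by (auto simp: endo_rep_def mat_endo_def fixed_vecs_def)

lemma mat_endo_endos: "A \<in> carrier_mat n n \<Longrightarrow> mat_endo A \<in> endos"
  by (rule endo_rep_imp_endos[OF endo_rep_mat_endo])

text \<open>\<open>A\<close> is the matrix of the shift on \<open>V\<close> with respect to some basis of \<open>V\<close>.\<close>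

definition realizes :: "'r::comm_ring_1 fam set \<Rightarrow> 'r mat \<Rightarrow> bool" where
  "realizes V A \<longleftrightarrow> A \<in> carrier_mat (dim_row A) (dim_row A) \<and>
     (\<forall>u\<in>V. \<forall>v\<in>V. (\<lambda>i t. u i t + v i t) \<in> V) \<and> (\<forall>a. \<forall>u\<in>V. (\<lambda>i t. a * u i t) \<in> V) \<and>
     (\<forall>u\<in>V. fam_shift u \<in> V) \<and>
     (\<exists>c. bij_betw c V (carrier_vec (dim_row A)) \<and>
          (\<forall>u\<in>V. \<forall>v\<in>V. c (\<lambda>i t. u i t + v i t) = c u + c v) \<and>
          (\<forall>a. \<forall>u\<in>V. c (\<lambda>i t. a * u i t) = a \<cdot>\<^sub>v c u) \<and>
          (\<forall>u\<in>V. c (fam_shift u) = A *\<^sub>v c u))"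

text \<open>Transport along the coordinate maps: \<iota> is the inclusion of \<open>V1\<close> and
  \<pi> the map \<open>T\<close>, both in coordinates.\<close>

lemma realizes_short_exact:
  fixes V :: "'r::comm_ring_1 fam set"
  assumes r1: "realizes V1 A1" and r: "realizes V A" and r2: "realizes V2 A2"
    and V1: "V1 = {u \<in> V. T u = (\<lambda>i t. 0)}" and TV: "T ` V = V2"
    and Tadd: "\<And>u v. u \<in> V \<Longrightarrow> v \<in> V \<Longrightarrow> T (\<lambda>i t. u i t + v i t) = (\<lambda>i t. T u i t + T v i t)"
    and Tsmult: "\<And>a u. u \<in> V \<Longrightarrow> T (\<lambda>i t. a * u i t) = (\<lambda>i t. a * T u i t)"
    and Tshift: "\<And>u. u \<in> V \<Longrightarrow> T (fam_shift u) = fam_shift (T u)"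
  shows "short_exact (mat_endo A1) (mat_endo A) (mat_endo A2)"
proof -
  let ?n1 = "dim_row A1" and ?n = "dim_row A" and ?n2 = "dim_row A2"
  have closed: "\<And>u v. u \<in> V \<Longrightarrow> v \<in> V \<Longrightarrow> (\<lambda>i t. u i t + v i t) \<in> V"
    "\<And>a u. u \<in> V \<Longrightarrow> (\<lambda>i t. a * u i t) \<in> V" "\<And>u. u \<in> V \<Longrightarrow> fam_shift u \<in> V"
    using r unfolding realizes_def by blast+
  have V1c: "\<And>u v. u \<in> V1 \<Longrightarrow> v \<in> V1 \<Longrightarrow> (\<lambda>i t. u i t + v i t) \<in> V1"
    "\<And>a u. u \<in> V1 \<Longrightarrow> (\<lambda>i t. a * u i t) \<in> V1" "\<And>u. u \<in> V1 \<Longrightarrow> fam_shift u \<in> V1"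
    using r1 unfolding realizes_def by blast+
  obtain c1 where c1: "bij_betw c1 V1 (carrier_vec ?n1)"
    "\<And>u v. u \<in> V1 \<Longrightarrow> v \<in> V1 \<Longrightarrow> c1 (\<lambda>i t. u i t + v i t) = c1 u + c1 v"
    "\<And>a u. u \<in> V1 \<Longrightarrow> c1 (\<lambda>i t. a * u i t) = a \<cdot>\<^sub>v c1 u" "\<And>u. u \<in> V1 \<Longrightarrow> c1 (fam_shift u) = A1 *\<^sub>v c1 u"
    using r1 unfolding realizes_def by blast
  obtain c where c: "bij_betw c V (carrier_vec ?n)"
    "\<And>u v. u \<in> V \<Longrightarrow> v \<in> V \<Longrightarrow> c (\<lambda>i t. u i t + v i t) = c u + c v"
    "\<And>a u. u \<in> V \<Longrightarrow> c (\<lambda>i t. a * u i t) = a \<cdot>\<^sub>v c u" "\<And>u. u \<in> V \<Longrightarrow> c (fam_shift u) = A *\<^sub>v c u"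
    using r unfolding realizes_def by blast
  obtain c2 where c2: "bij_betw c2 V2 (carrier_vec ?n2)"
    "\<And>u v. u \<in> V2 \<Longrightarrow> v \<in> V2 \<Longrightarrow> c2 (\<lambda>i t. u i t + v i t) = c2 u + c2 v"
    "\<And>a u. u \<in> V2 \<Longrightarrow> c2 (\<lambda>i t. a * u i t) = a \<cdot>\<^sub>v c2 u" "\<And>u. u \<in> V2 \<Longrightarrow> c2 (fam_shift u) = A2 *\<^sub>v c2 u"
    using r2 unfolding realizes_def by blast
  have A: "A1 \<in> carrier_mat ?n1 ?n1" "A \<in> carrier_mat ?n ?n" "A2 \<in> carrier_mat ?n2 ?n2"
    using r1 r r2 by (auto simp: realizes_def)
  define b1 where "b1 = the_inv_into V1 c1"
  define b where "b = the_inv_into V c"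
  have b1: "b1 x \<in> V1" "c1 (b1 x) = x" if "x \<in> carrier_vec ?n1" for x
    using that bij_betw_the_inv_into[OF c1(1)] f_the_inv_into_f_bij_betw[OF c1(1)]
    unfolding b1_def bij_betw_def by auto
  have b: "b x \<in> V" "c (b x) = x" if "x \<in> carrier_vec ?n" for x
    using that bij_betw_the_inv_into[OF c(1)] f_the_inv_into_f_bij_betw[OF c(1)]
    unfolding b_def bij_betw_def by auto
  have b1c: "b1 (c1 u) = u" if "u \<in> V1" for u
    using that c1(1) unfolding b1_def bij_betw_def by (auto intro: the_inv_into_f_f)
  have bc: "b (c u) = u" if "u \<in> V" for u
    using that c(1) unfolding b_def bij_betw_def by (auto intro: the_inv_into_f_f)
  have cV: "c1 u \<in> carrier_vec ?n1" if "u \<in> V1" for u using c1(1) that by (auto simp: bij_betw_def)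
  have cV': "c u \<in> carrier_vec ?n" if "u \<in> V" for u using c(1) that by (auto simp: bij_betw_def)
  have cV2: "c2 u \<in> carrier_vec ?n2" if "u \<in> V2" for u using c2(1) that by (auto simp: bij_betw_def)
  have b1_lin: "b1 (x + y) = (\<lambda>i t. b1 x i t + b1 y i t)" "b1 (a \<cdot>\<^sub>v x) = (\<lambda>i t. a * b1 x i t)"
    "b1 (A1 *\<^sub>v x) = fam_shift (b1 x)"
    if "x \<in> carrier_vec ?n1" "y \<in> carrier_vec ?n1" for x y a
    using b1c[OF V1c(1)[OF b1(1)[OF that(1)] b1(1)[OF that(2)]]] b1c[OF V1c(2)[OF b1(1)[OF that(1)]]]
      b1c[OF V1c(3)[OF b1(1)[OF that(1)]]] b1 c1(2-4) that by simp_all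
  have b_lin: "b (x + y) = (\<lambda>i t. b x i t + b y i t)" "b (a \<cdot>\<^sub>v x) = (\<lambda>i t. a * b x i t)"
    "b (A *\<^sub>v x) = fam_shift (b x)"
    if "x \<in> carrier_vec ?n" "y \<in> carrier_vec ?n" for x y a
    using bc[OF closed(1)[OF b(1)[OF that(1)] b(1)[OF that(2)]]] bc[OF closed(2)[OF b(1)[OF that(1)]]]
      bc[OF closed(3)[OF b(1)[OF that(1)]]] b c(2-4) that by simp_all
  have sub: "u \<in> V" if "u \<in> V1" for u using V1 that by blast
  have TV2: "T u \<in> V2" if "u \<in> V" for u using TV that by blast
  \<comment> \<open>The zero family is obtained as 0 times a member of \<open>V2\<close>, which
    \<open>u\<close> provides.\<close>
  have c20: "c2 (\<lambda>i t. 0) = 0\<^sub>v ?n2" if "u \<in> V2" for u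
  proof -
    have "c2 (\<lambda>i t. 0 * u i t) = 0 \<cdot>\<^sub>v c2 u" by (rule c2(3)[OF that])
    then show ?thesis using smult_zero_vec[OF cV2[OF that]] by simp
  qed
  define \<iota> where "\<iota> x = c (b1 x)" for x
  define \<pi> where "\<pi> x = c2 (T (b x))" for x
  have "\<iota> \<in> module_hom class_ring (sub_vec ?n1 (carrier_vec ?n1)) (sub_vec ?n (carrier_vec ?n))"
    unfolding module_hom_iff \<iota>_def using b1(1) sub cV' b1_lin(1,2) c(2,3) by simp
  moreover have "\<pi> \<in> module_hom class_ring (sub_vec ?n (carrier_vec ?n)) (sub_vec ?n2 (carrier_vec ?n2))"
    unfolding module_hom_iff \<pi>_def using b(1) TV2 cV2 b_lin(1,2) c2(2,3) Tadd Tsmult by simp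
  moreover have "inj_on \<iota> (carrier_vec ?n1)"
    by (rule inj_on_inverseI[where g = "\<lambda>x. c1 (b x)"]) (simp add: \<iota>_def bc sub b1)
  moreover have "\<iota> ` carrier_vec ?n1 = {x \<in> carrier_vec ?n. \<pi> x = 0\<^sub>v ?n2}"
  proof (intro equalityI subsetI)
    fix y assume "y \<in> \<iota> ` carrier_vec ?n1"
    then obtain x where x: "x \<in> carrier_vec ?n1" "y = c (b1 x)" by (auto simp: \<iota>_def)
    have "T (b1 x) = (\<lambda>i t. 0)" using V1 b1(1)[OF x(1)] by blast
    moreover have "b y = b1 x" using bc[OF sub[OF b1(1)[OF x(1)]]] x(2) by simp
    ultimately have "\<pi> y = c2 (\<lambda>i t. 0)" by (simp add: \<pi>_def)
    also have "\<dots> = 0\<^sub>v ?n2" using c20[OF TV2[OF sub[OF b1(1)[OF x(1)]]]] .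
    finally show "y \<in> {x \<in> carrier_vec ?n. \<pi> x = 0\<^sub>v ?n2}" using cV'[OF sub[OF b1(1)[OF x(1)]]] x(2) by simp
  next
    fix y assume "y \<in> {x \<in> carrier_vec ?n. \<pi> x = 0\<^sub>v ?n2}"
    then have y: "y \<in> carrier_vec ?n" "c2 (T (b y)) = 0\<^sub>v ?n2" by (auto simp: \<pi>_def)
    have Tb: "T (b y) \<in> V2" using TV2 b(1) y(1) by blast
    have "(\<lambda>i t. 0 * T (b y) i t) \<in> V2" using r2 Tb unfolding realizes_def by blast
    then have "(\<lambda>i t. 0) \<in> V2" by simp
    moreover have "c2 (T (b y)) = c2 (\<lambda>i t. 0)" using y(2) c20[OF Tb] by simp
    ultimately have "T (b y) = (\<lambda>i t. 0)" using c2(1) Tb unfolding bij_betw_def by (blast dest: inj_onD)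
    then have "b y \<in> V1" using V1 b(1)[OF y(1)] by blast
    then have "\<iota> (c1 (b y)) = y" "c1 (b y) \<in> carrier_vec ?n1" using b(2)[OF y(1)] b1c cV by (simp_all add: \<iota>_def)
    then show "y \<in> \<iota> ` carrier_vec ?n1" by (metis imageI)
  qed
  moreover have "\<pi> ` carrier_vec ?n = carrier_vec ?n2"
  proof (intro equalityI subsetI)
    fix y assume "y \<in> \<pi> ` carrier_vec ?n"
    then show "y \<in> carrier_vec ?n2" using cV2 TV2 b(1) by (auto simp: \<pi>_def)
  next
    fix y :: "'r vec" assume "y \<in> carrier_vec ?n2"
    then have "y \<in> c2 ` V2" using c2(1) by (simp add: bij_betw_def)
    then obtain u where u: "u \<in> V" "y = c2 (T u)" using TV by blast
    then have "y = \<pi> (c u)" by (simp add: \<pi>_def bc)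
    then show "y \<in> \<pi> ` carrier_vec ?n" using cV'[OF u(1)] by blast
  qed
  moreover have "\<forall>x\<in>carrier_vec ?n1. \<iota> (A1 *\<^sub>v x) = A *\<^sub>v \<iota> x"
    using b1_lin(3) b1(1) sub c(4) by (simp add: \<iota>_def)
  moreover have "\<forall>x\<in>carrier_vec ?n. \<pi> (A *\<^sub>v x) = A2 *\<^sub>v \<pi> x"
    using b_lin(3) b(1) TV2 c2(4) Tshift by (simp add: \<pi>_def)
  ultimately show ?thesis unfolding mat_endo_def short_exact.simps
    by - (rule bexI[where x = \<iota>], rule bexI[where x = \<pi>], intro conjI)
qed

lemma realizes_exists:
  fixes V :: "'r::comm_ring_1 fam set"
  assumes closed: "\<And>u v. u \<in> V \<Longrightarrow> v \<in> V \<Longrightarrow> (\<lambda>i t. u i t + v i t) \<in> V"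
    "\<And>a u. u \<in> V \<Longrightarrow> (\<lambda>i t. a * u i t) \<in> V" "\<And>u. u \<in> V \<Longrightarrow> fam_shift u \<in> V"
    and c: "bij_betw c V (carrier_vec N)"
    "\<And>u v. u \<in> V \<Longrightarrow> v \<in> V \<Longrightarrow> c (\<lambda>i t. u i t + v i t) = c u + c v"
    "\<And>a u. u \<in> V \<Longrightarrow> c (\<lambda>i t. a * u i t) = a \<cdot>\<^sub>v c u"
  shows "\<exists>A. realizes V A"
proof -
  define b where "b = the_inv_into V c"
  have b: "b x \<in> V" "c (b x) = x" if "x \<in> carrier_vec N" for x
    using that bij_betw_the_inv_into[OF c(1)] f_the_inv_into_f_bij_betw[OF c(1)]
    unfolding b_def bij_betw_def by auto
  have bc: "b (c u) = u" if "u \<in> V" for u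
    using that c(1) unfolding b_def bij_betw_def by (auto intro: the_inv_into_f_f)
  have cV: "c u \<in> carrier_vec N" if "u \<in> V" for u using c(1) that by (auto simp: bij_betw_def)
  have "\<exists>A\<in>carrier_mat N N. \<forall>x\<in>carrier_vec N. c (fam_shift (b x)) = A *\<^sub>v x"
  proof (rule linear_matrix)
    fix x y :: "'r vec" and a assume x: "x \<in> carrier_vec N"
    show "c (fam_shift (b x)) \<in> carrier_vec N" using b(1) x closed(3) cV by blast
    have "b (a \<cdot>\<^sub>v x) = (\<lambda>i t. a * b x i t)"
      using bc[OF closed(2)[OF b(1)[OF x]]] c(3)[OF b(1)[OF x]] b(2)[OF x] by simp
    then have "fam_shift (b (a \<cdot>\<^sub>v x)) = (\<lambda>i t. a * fam_shift (b x) i t)" by (simp add: fam_shift_def)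
    then show "c (fam_shift (b (a \<cdot>\<^sub>v x))) = a \<cdot>\<^sub>v c (fam_shift (b x))"
      using c(3) closed(3) b(1) x by simp
    assume y: "y \<in> carrier_vec N"
    have "b (x + y) = (\<lambda>i t. b x i t + b y i t)"
      using bc[OF closed(1)[OF b(1)[OF x] b(1)[OF y]]] c(2)[OF b(1)[OF x] b(1)[OF y]] b(2) x y by simp
    then have "fam_shift (b (x + y)) = (\<lambda>i t. fam_shift (b x) i t + fam_shift (b y) i t)"
      by (simp add: fam_shift_def)
    then show "c (fam_shift (b (x + y))) = c (fam_shift (b x)) + c (fam_shift (b y))"
      using c(2) closed(3) b(1) x y by simp
  qed
  then obtain A where A: "A \<in> carrier_mat N N" "\<And>x. x \<in> carrier_vec N \<Longrightarrow> c (fam_shift (b x)) = A *\<^sub>v x"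
    by blast
  then have "c (fam_shift u) = A *\<^sub>v c u" if "u \<in> V" for u
    using bc[OF that] cV[OF that] by fastforce
  then have "realizes V A" unfolding realizes_def using A(1) closed c by (intro conjI exI[of _ c]) auto
  then show ?thesis by blast
qed

text \<open>The values at times below \<open>k\<close> determine a solution and can be prescribed
  freely, so they are coordinates and the solution space is free of rank k |I|.\<close>

lemma Sol_coords:
  fixes P :: "nat \<Rightarrow> nat \<Rightarrow> 'r::comm_ring_1 poly"
  assumes P: "monic_mat I k P" and I: "finite I" and e: "bij_betw e {..<N} (I \<times> {..<k})"
  shows "bij_betw (\<lambda>u. vec N (\<lambda>x. u (fst (e x)) (snd (e x)))) (Sol I P) (carrier_vec N)"
    (is "bij_betw ?c _ _")
proof (rule bij_betw_imageI)
  show "inj_on ?c (Sol I P)"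
  proof (rule inj_onI)
    fix u v assume u: "u \<in> Sol I P" and v: "v \<in> Sol I P" and eq: "?c u = ?c v"
    let ?w = "\<lambda>i t. u i t + (- 1) * v i t"
    have "?w = (\<lambda>i t. 0)"
    proof (rule mat_solve_unique[OF P I])
      show "?w \<in> Sol I P" by (rule Sol_closed(2)[OF u Sol_closed(3)[OF v]])
      fix i t assume "i \<in> I" "t < k"
      then have "(i, t) \<in> e ` {..<N}" using e by (simp add: bij_betw_def)
      then obtain x where x: "x < N" "e x = (i, t)" by auto
      have "?c u $ x = ?c v $ x" using eq by simp
      then show "?w i t = 0" using x by simp
    qed
    then have "u i t + (- 1) * v i t = 0" for i t by meson
    then show "u = v" by (intro ext) simp
  qed
  show "?c ` Sol I P = carrier_vec N"
  proof (intro equalityI subsetI)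
    fix x :: "'r vec" assume x: "x \<in> carrier_vec N"
    obtain u where u: "\<And>i t. i \<in> I \<Longrightarrow> mat_act I P u i t = 0"
      "\<And>i t. i \<in> I \<Longrightarrow> t < k \<Longrightarrow> u i t = x $ the_inv_into {..<N} e (i, t)" "\<And>i t. i \<notin> I \<Longrightarrow> u i t = 0"
      using mat_solve_exists[OF P I, of "\<lambda>i t. 0" "\<lambda>i t. x $ the_inv_into {..<N} e (i, t)"] by metis
    have "u \<in> Sol I P" using u(1,3) by (simp add: Sol_def)
    moreover have "x = ?c u"
    proof (rule eq_vecI)
      fix j assume "j < dim_vec (?c u)"
      then have j: "j < N" by simp
      then have "e j \<in> I \<times> {..<k}" using e by (auto simp: bij_betw_def)
      then have "u (fst (e j)) (snd (e j)) = x $ the_inv_into {..<N} e (e j)" using u(2) by auto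
      also have "the_inv_into {..<N} e (e j) = j"
        using e j by (intro the_inv_into_f_f) (auto simp: bij_betw_def)
      finally show "x $ j = ?c u $ j" using j by simp
    qed (use x in simp)
    ultimately show "x \<in> ?c ` Sol I P" by blast
  qed auto
qed

lemma Sol_realizable:
  assumes P: "monic_mat I k P" and I: "finite I"
  shows "\<exists>A. realizes (Sol I P) A"
proof -
  obtain e where "bij_betw e {0..<card (I \<times> {..<k})} (I \<times> {..<k})"
    using ex_bij_betw_nat_finite[of "I \<times> {..<k}"] I by auto
  then have e: "bij_betw e {..<card (I \<times> {..<k})} (I \<times> {..<k})" by (simp add: atLeast0LessThan)
  show ?thesis
    by (rule realizes_exists[OF Sol_closed(2-4) Sol_coords[OF P I e]]) (auto intro!: eq_vecI)
qed

lemma realizes_zero: "realizes {\<lambda>i t. 0 :: 'r::comm_ring_1} (0\<^sub>m 0 0)"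
proof -
  have "bij_betw (\<lambda>u. 0\<^sub>v 0 :: 'r vec) {\<lambda>i t. 0 :: 'r} (carrier_vec 0)"
    by (auto simp: bij_betw_def)
  then show ?thesis unfolding realizes_def
    by (intro conjI exI[of _ "\<lambda>u. 0\<^sub>v 0"]) (auto simp: fam_shift_def)
qed

lemma mat_endo_zero_null: "frag_of (mat_endo (0\<^sub>m n n)) \<in> null_frags"
  unfolding null_frags_def
  by (intro group_closure.base insertI2 UnI2 zero_gens_rep[OF endo_rep_mat_endo[of "0\<^sub>m n n" n]]) simp

lemma null_exactI:
  "x \<in> endos \<Longrightarrow> y \<in> endos \<Longrightarrow> z \<in> endos \<Longrightarrow> short_exact x y z
    \<Longrightarrow> frag_of y - frag_of x - frag_of z \<in> null_frags"
  using exact_relI exact_rels_null by blast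

section \<open>Classes of shift-invariant spaces\<close>

definition space_frag :: "'r::comm_ring_1 fam set \<Rightarrow> 'r endo \<Rightarrow>\<^sub>0 int" where
  "space_frag V = frag_of (mat_endo (SOME A. realizes V A))"

lemma realizes_endos: "realizes V A \<Longrightarrow> mat_endo A \<in> endos"
  unfolding realizes_def by (blast intro: mat_endo_endos)

lemma space_frag_exact:
  fixes V :: "'r::comm_ring_1 fam set"
  assumes V: "realizes V1 A1" "realizes V A" "realizes V2 A2"
    and T: "V1 = {u \<in> V. T u = (\<lambda>i t. 0)}" "T ` V = V2"
    "\<And>u v. u \<in> V \<Longrightarrow> v \<in> V \<Longrightarrow> T (\<lambda>i t. u i t + v i t) = (\<lambda>i t. T u i t + T v i t)"
    "\<And>a u. u \<in> V \<Longrightarrow> T (\<lambda>i t. a * u i t) = (\<lambda>i t. a * T u i t)"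
    "\<And>u. u \<in> V \<Longrightarrow> T (fam_shift u) = fam_shift (T u)"
  shows "space_frag V - space_frag V1 - space_frag V2 \<in> null_frags"
proof -
  have r: "realizes V1 (SOME A. realizes V1 A)" "realizes V (SOME A. realizes V A)"
    "realizes V2 (SOME A. realizes V2 A)"
    by (rule someI[of "realizes V1", OF V(1)], rule someI[of "realizes V", OF V(2)],
        rule someI[of "realizes V2", OF V(3)])
  show ?thesis unfolding space_frag_def
    by (rule null_exactI[OF realizes_endos[OF r(1)] realizes_endos[OF r(2)] realizes_endos[OF r(3)]
          realizes_short_exact[OF r T]])
qed

text \<open>The identity of \<open>V\<close>, a surjection with zero kernel, connects any two
  matrices realising \<open>V\<close>. Hence the choice made in \<open>space_frag\<close> is
  irrelevant in W_0(R).\<close>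

lemma space_frag_realizes:
  fixes V :: "'r::comm_ring_1 fam set"
  assumes V: "realizes V A"
  shows "frag_of (mat_endo A) - space_frag V \<in> null_frags"
proof -
  let ?B = "SOME A. realizes V A"
  have B: "realizes V ?B" using V by (rule someI)
  have z: "(\<lambda>i t. 0) \<in> V"
  proof -
    obtain c :: "'r fam \<Rightarrow> 'r vec" where c: "bij_betw c V (carrier_vec (dim_row A))" using V unfolding realizes_def by blast
    have "0\<^sub>v (dim_row A) \<in> c ` V" using c by (simp add: bij_betw_def)
    then obtain u where "u \<in> V" by blast
    then have "(\<lambda>i t. 0 * u i t) \<in> V" using V unfolding realizes_def by blast
    then show ?thesis by simp
  qed
  have eq: "{\<lambda>i t. 0} = {u \<in> V. u = (\<lambda>i t. 0)}" using z by auto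
  have "short_exact (mat_endo (0\<^sub>m 0 0)) (mat_endo A) (mat_endo ?B)"
    by (rule realizes_short_exact[OF realizes_zero V B, of "\<lambda>u. u"]) (use eq in auto)
  from null_exactI[OF realizes_endos[OF realizes_zero] realizes_endos[OF V] realizes_endos[OF B] this]
  have "frag_of (mat_endo A) - frag_of (mat_endo (0\<^sub>m 0 0)) - space_frag V \<in> null_frags"
    by (simp add: space_frag_def)
  from null_frags_closed(3)[OF this mat_endo_zero_null[of 0]] show ?thesis by simp
qed

lemma space_frag_zero: "space_frag {\<lambda>i t. 0 :: 'r::comm_ring_1} \<in> null_frags"
  using null_frags_closed(2)[OF mat_endo_zero_null[of 0] space_frag_realizes[OF realizes_zero]] by simp

section \<open>Monic matrices of polynomials\<close>

text \<open>For monic \<open>p\<close> of degree d the space is free of rank d and the shift acts on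
  initial values by a companion matrix of \<open>p\<close>. The index 0 is merely a fixed name for
  the only component.\<close>

definition scalar_frag :: "'r::comm_ring_1 poly \<Rightarrow> 'r endo \<Rightarrow>\<^sub>0 int" where
  "scalar_frag p = space_frag (Sol {0} (\<lambda>_ _. p))"

lemma monic_mat_scalar: "lead_coeff p = 1 \<Longrightarrow> monic_mat {i} (degree p) (\<lambda>_ _. p)"
  by (auto simp: monic_mat_def coeff_eq_0)

lemma Sol_singleton: "Sol {i} P = Sol {i} (\<lambda>_ _. P i i)"
  by (simp add: Sol_def mat_act_def)

text \<open>Renaming component \<open>n\<close> to 0 is an isomorphism, used as a surjection with
  zero kernel.\<close>

lemma space_frag_singleton:
  fixes P :: "nat \<Rightarrow> nat \<Rightarrow> 'r::comm_ring_1 poly"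
  assumes p: "lead_coeff (P n n) = 1"
  shows "space_frag (Sol {n} P) - scalar_frag (P n n) \<in> null_frags"
proof -
  let ?T = "\<lambda>(u :: 'r fam) (i :: nat) (t :: nat). if i = 0 then u n t else (0 :: 'r)"
  obtain A B where r: "realizes (Sol {n} (\<lambda>_ _. P n n)) A" "realizes (Sol {0} (\<lambda>_ _. P n n)) B"
    using Sol_realizable[OF monic_mat_scalar[OF p]] by fastforce
  have "space_frag (Sol {n} (\<lambda>_ _. P n n)) - space_frag {\<lambda>i t. 0} - space_frag (Sol {0} (\<lambda>_ _. P n n))
        \<in> null_frags"
  proof (rule space_frag_exact[OF realizes_zero r, of ?T])
    show "{\<lambda>i t. 0} = {u \<in> Sol {n} (\<lambda>_ _. P n n). ?T u = (\<lambda>i t. 0)}"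
    proof (intro equalityI subsetI)
      fix u assume u0: "u \<in> {u \<in> Sol {n} (\<lambda>_ _. P n n). ?T u = (\<lambda>i t. 0)}"
      then have uS: "u \<in> Sol {n} (\<lambda>_ _. P n n)" by blast
      have T0: "?T u = (\<lambda>i t. 0)" using u0 unfolding mem_Collect_eq by (rule conjunct2)
      have u: "u i t = 0" if "i \<noteq> n" for i t using uS that by (simp add: Sol_def)
      have "u n t = 0" for t using fun_cong[OF fun_cong[OF T0, of 0], of t] by simp
      then have "u i t = 0" for i t using u by (cases "i = n") auto
      then show "u \<in> {\<lambda>i t. 0}" by auto
    qed (auto intro: Sol_closed(1))
    show "?T ` Sol {n} (\<lambda>_ _. P n n) = Sol {0} (\<lambda>_ _. P n n)"
    proof (intro equalityI subsetI)
      fix v assume v: "v \<in> Sol {0} (\<lambda>_ _. P n n)"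
      let ?u = "\<lambda>i t. if i = n then v 0 t else 0"
      have "?u \<in> Sol {n} (\<lambda>_ _. P n n)" using v by (simp add: Sol_def mat_act_def)
      moreover have "v = ?T ?u" using v by (auto simp: Sol_def intro!: ext)
      ultimately show "v \<in> ?T ` Sol {n} (\<lambda>_ _. P n n)" by - (rule image_eqI[where x = ?u])
    qed (auto simp: Sol_def mat_act_def)
  qed (auto simp: fam_shift_def intro!: ext)
  from null_frags_closed(3)[OF this space_frag_zero] show ?thesis
    by (simp add: scalar_frag_def flip: Sol_singleton)
qed

lemma space_frag_prod:
  fixes P Q :: "nat \<Rightarrow> nat \<Rightarrow> 'r::comm_ring_1 poly"
  assumes P: "monic_mat I k P" and Q: "monic_mat I l Q" and I: "finite I"
  defines "PQ \<equiv> (\<lambda>i j. \<Sum>h\<in>I. P i h * Q h j)"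
  shows "monic_mat I (k + l) PQ"
    and "space_frag (Sol I PQ) - space_frag (Sol I Q) - space_frag (Sol I P) \<in> null_frags"
proof -
  show M: "monic_mat I (k + l) PQ" unfolding monic_mat_def
  proof (intro ballI allI impI)
    fix i j d assume ij: "i \<in> I" "j \<in> I" and d: "k + l \<le> d"
    have "coeff (P i h * Q h j) d = (if i = h then if h = j \<and> d = k + l then 1 else 0 else 0)" if h: "h \<in> I" for h
    proof -
      have "coeff (P i h * Q h j) d = (\<Sum>e\<le>d. coeff (P i h) e * coeff (Q h j) (d - e))"
        by (rule coeff_mult)
      also have "\<dots> = (\<Sum>e\<le>d. if e = k then (if i = h then coeff (Q h j) (d - k) else 0) else 0)"
      \<comment> \<open>As d >= k + l, only e = k survives: for e < k the index d - e exceeds l, and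
        for e > k the coefficient of \<open>P\<close> vanishes.\<close>
      proof (rule sum.cong[OF refl])
        fix e assume "e \<in> {..d}"
        show "coeff (P i h) e * coeff (Q h j) (d - e)
              = (if e = k then (if i = h then coeff (Q h j) (d - k) else 0) else 0)"
          using P Q ij h d by (cases "e < k") (auto simp: monic_mat_def)
      qed
      also have "\<dots> = (if i = h then coeff (Q h j) (d - k) else 0)" using d by simp
      also have "\<dots> = (if i = h then if h = j \<and> d = k + l then 1 else 0 else 0)"
        using Q h ij d by (auto simp: monic_mat_def)
      finally show ?thesis .
    qed
    then have "coeff (PQ i j) d = (\<Sum>h\<in>I. if i = h then if h = j \<and> d = k + l then 1 else 0 else 0)"
      by (simp add: PQ_def coeff_sum)
    then show "coeff (PQ i j) d = (if i = j \<and> d = k + l then 1 else 0)" using I ij by simp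
  qed
  obtain A B C where r: "realizes (Sol I Q) A" "realizes (Sol I PQ) B" "realizes (Sol I P) C"
    using Sol_realizable[OF P I] Sol_realizable[OF Q I] Sol_realizable[OF M I] by blast
  \<comment> \<open>\<open>Q\<close> applied to \<open>u\<close>, cut off outside \<open>I\<close>
    because members of \<open>Sol\<close> vanish there.\<close>
  let ?T = "\<lambda>(u :: 'r fam) (i :: nat) (t :: nat). if i \<in> I then mat_act I Q u i t else 0"
  have PQ: "mat_act I PQ u i t = mat_act I P (?T u) i t" for u i t
  proof -
    have "mat_act I PQ u i t = (\<Sum>j\<in>I. \<Sum>h\<in>I. act (P i h) (act (Q h j) (u j)) t)"
      by (simp add: mat_act_def PQ_def act_sum_poly act_mult)
    also have "\<dots> = (\<Sum>h\<in>I. \<Sum>j\<in>I. act (P i h) (act (Q h j) (u j)) t)" by (rule sum.swap)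
    also have "\<dots> = mat_act I P (?T u) i t"
      by (simp add: mat_act_def act_sum[symmetric] cong: sum.cong)
    finally show ?thesis .
  qed
  show "space_frag (Sol I PQ) - space_frag (Sol I Q) - space_frag (Sol I P) \<in> null_frags"
  proof (rule space_frag_exact[OF r, of ?T])
    show "Sol I Q = {u \<in> Sol I PQ. ?T u = (\<lambda>i t. 0)}"
    proof (intro equalityI subsetI)
      fix u assume u: "u \<in> Sol I Q"
      then have T: "?T u = (\<lambda>i t. 0)" by (auto simp: Sol_def intro!: ext)
      then have "u \<in> Sol I PQ" using u by (simp add: Sol_def PQ) (simp add: mat_act_def)
      with T show "u \<in> {u \<in> Sol I PQ. ?T u = (\<lambda>i t. 0)}" by simp
    next
      fix u assume u: "u \<in> {u \<in> Sol I PQ. ?T u = (\<lambda>i t. 0)}"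
      then have T0: "?T u = (\<lambda>i t. 0)" by simp
      have "mat_act I Q u i t = 0" if "i \<in> I" for i t
        using fun_cong[OF fun_cong[OF T0, of i], of t] that by simp
      then show "u \<in> Sol I Q" using u by (simp add: Sol_def)
    qed
    show "?T ` Sol I PQ = Sol I P"
    proof (intro equalityI subsetI)
      fix v assume v: "v \<in> Sol I P"
      obtain u where u: "\<And>i t. i \<in> I \<Longrightarrow> mat_act I Q u i t = v i t" "\<And>i t. i \<notin> I \<Longrightarrow> u i t = 0"
        by (rule mat_solve_exists[OF Q I, of v "\<lambda>i t. 0"]) blast
      have Tu: "?T u = v"
      proof (intro ext)
        fix i t
        show "?T u i t = v i t" using u(1)[of i t] v by (cases "i \<in> I") (simp_all add: Sol_def)
      qed
      have "mat_act I PQ u i t = 0" if "i \<in> I" for i t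
        unfolding PQ Tu using v that by (simp add: Sol_def)
      then have "u \<in> Sol I PQ" using u(2) by (simp add: Sol_def)
      then show "v \<in> ?T ` Sol I PQ" by (rule image_eqI[where f = ?T, OF Tu[symmetric]])
    next
      fix v assume "v \<in> ?T ` Sol I PQ"
      then show "v \<in> Sol I P" unfolding Sol_def PQ by auto
    qed
  qed (auto simp: mat_act_def act_add act_smult sum.distrib sum_distrib_left fam_shift_def act_shift intro!: ext)
qed

lemma monic_mat_subset: "monic_mat I k P \<Longrightarrow> J \<subseteq> I \<Longrightarrow> monic_mat J k P"
  unfolding monic_mat_def by blast

lemma monic_mat_lead_coeff:
  assumes "monic_mat I k P" "i \<in> I"
  shows "lead_coeff (P i i) = 1" "degree (P i i) = k"
proof -
  have c: "coeff (P i i) k = 1" "\<And>d. d > k \<Longrightarrow> coeff (P i i) d = 0" using assms by (auto simp: monic_mat_def)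
  show "degree (P i i) = k"
    by (rule antisym[OF degree_le]) (use c in \<open>auto intro: le_degree\<close>)
  with c show "lead_coeff (P i i) = 1" by simp
qed

lemma mat_act_insert:
  "finite I \<Longrightarrow> n \<notin> I \<Longrightarrow> mat_act (insert n I) P u i t = act (P i n) (u n) t + mat_act I P u i t"
  by (simp add: mat_act_def)

lemma mat_act_cong: "(\<And>j. j \<in> I \<Longrightarrow> u j = v j) \<Longrightarrow> mat_act I P u i t = mat_act I P v i t"
  by (simp add: mat_act_def)

lemma mat_act_0 [simp]: "mat_act I P (\<lambda>i t. 0) i t = 0"
  by (simp add: mat_act_def)

text \<open>If column n vanishes on \<open>I\<close>, the components in \<open>I\<close> satisfy a
  system of their own, and restriction to them is onto with kernel \<open>Sol {n} P\<close>. If row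
  n vanishes on \<open>I\<close>, component n does, and the kernel is \<open>Sol I P\<close>.
  Extending a partial solution amounts to solving an inhomogeneous system.\<close>

lemma space_frag_triangular:
  fixes P :: "nat \<Rightarrow> nat \<Rightarrow> 'r::comm_ring_1 poly"
  assumes P: "monic_mat (insert n I) k P" and I: "finite I" "n \<notin> I"
    and z: "(\<forall>i\<in>I. P i n = 0) \<or> (\<forall>j\<in>I. P n j = 0)"
  shows "space_frag (Sol (insert n I) P) - space_frag (Sol I P) - space_frag (Sol {n} P) \<in> null_frags"
proof -
  have PI: "monic_mat I k P" and Pn: "monic_mat {n} k P" using P by (auto intro: monic_mat_subset)
  obtain A B C where r: "realizes (Sol I P) A" "realizes (Sol (insert n I) P) B" "realizes (Sol {n} P) C"
    using Sol_realizable[OF P] Sol_realizable[OF PI I(1)] Sol_realizable[OF Pn] I(1) by blast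
  note ins = mat_act_insert[OF I]
  have single: "mat_act {n} P u i t = act (P i n) (u n) t" for u i t by (simp add: mat_act_def)
  from z show ?thesis
  proof
    assume z: "\<forall>i\<in>I. P i n = 0"
    let ?T = "\<lambda>(u :: 'r fam) (i :: nat) (t :: nat). if i \<in> I then u i t else (0 :: 'r)"
    have T: "mat_act I P (?T u) i t = mat_act I P u i t" for u i t by (rule mat_act_cong) simp
    have "space_frag (Sol (insert n I) P) - space_frag (Sol {n} P) - space_frag (Sol I P) \<in> null_frags"
    proof (rule space_frag_exact[OF r(3,2,1), of ?T])
      show "Sol {n} P = {u \<in> Sol (insert n I) P. ?T u = (\<lambda>i t. 0)}"
      proof (intro equalityI subsetI)
        fix u assume u: "u \<in> Sol {n} P"
        then have "u i t = 0" if "i \<in> I" for i t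
          using I(2) that by (cases "i = n") (auto simp: Sol_def)
        then have T0: "?T u = (\<lambda>i t. 0)" by (intro ext) simp
        have "mat_act I P u i t = 0" for i t using T[of u i t] unfolding T0 by simp
        with u z show "u \<in> {u \<in> Sol (insert n I) P. ?T u = (\<lambda>i t. 0)}"
          using T0 by (simp add: Sol_def ins single)
      next
        fix u assume u: "u \<in> {u \<in> Sol (insert n I) P. ?T u = (\<lambda>i t. 0)}"
        then have T0: "?T u = (\<lambda>i t. 0)" by simp
        have "mat_act I P u i t = 0" for i t using T[of u i t] unfolding T0 by simp
        moreover have "u i t = 0" if "i \<in> I" for i t using fun_cong[OF fun_cong[OF T0, of i], of t] that by simp
        ultimately show "u \<in> Sol {n} P" using u by (auto simp: Sol_def ins single)
      qed
      show "?T ` Sol (insert n I) P = Sol I P"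
      proof (intro equalityI subsetI)
        fix v assume "v \<in> ?T ` Sol (insert n I) P"
        then obtain u where u: "u \<in> Sol (insert n I) P" "v = ?T u" by blast
        then show "v \<in> Sol I P" using z by (simp add: Sol_def T ins)
      next
        fix v assume v: "v \<in> Sol I P"
        obtain w where w: "\<And>t. mat_act {n} P w n t = - mat_act I P v n t"
          using mat_solve_exists[OF Pn finite.insertI[OF finite.emptyI], of "\<lambda>i t. - mat_act I P v n t"]
          by (metis singletonI)
        let ?u = "\<lambda>i t. if i = n then w n t else v i t"
        have vu: "mat_act I P ?u i t = mat_act I P v i t" for i t
          by (rule mat_act_cong) (use I(2) in auto)
        have "?u \<in> Sol (insert n I) P" using v z w by (auto simp: Sol_def ins vu single)
        moreover have "v = ?T ?u" using v I(2) by (auto simp: Sol_def intro!: ext)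
        ultimately show "v \<in> ?T ` Sol (insert n I) P" by - (rule image_eqI[where x = ?u])
      qed
    qed (auto simp: fam_shift_def intro!: ext)
    then show ?thesis by (simp add: algebra_simps)
  next
    assume z: "\<forall>j\<in>I. P n j = 0"
    let ?T = "\<lambda>(u :: 'r fam) (i :: nat) (t :: nat). if i = n then u n t else (0 :: 'r)"
    have zn: "mat_act I P u n t = 0" for u t using z by (simp add: mat_act_def)
    show ?thesis
    proof (rule space_frag_exact[OF r(1,2,3), of ?T])
      show "Sol I P = {u \<in> Sol (insert n I) P. ?T u = (\<lambda>i t. 0)}"
      proof (intro equalityI subsetI)
        fix u assume u: "u \<in> Sol I P"
        then have un: "u n = (\<lambda>t. 0)" using I(2) by (auto simp: Sol_def)
        then have T0: "?T u = (\<lambda>i t. 0)" by (intro ext) simp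
        have "u \<in> Sol (insert n I) P" using u un zn by (auto simp: Sol_def ins)
        with T0 show "u \<in> {u \<in> Sol (insert n I) P. ?T u = (\<lambda>i t. 0)}" by simp
      next
        fix u assume u: "u \<in> {u \<in> Sol (insert n I) P. ?T u = (\<lambda>i t. 0)}"
        then have T0: "?T u = (\<lambda>i t. 0)" by simp
        have un: "u n t = 0" for t using fun_cong[OF fun_cong[OF T0, of n], of t] by simp
        then have "u n = (\<lambda>t. 0)" by (intro ext)
        moreover have "u i t = 0" if "i \<notin> I" for i t
          using u un that by (cases "i = n") (auto simp: Sol_def)
        ultimately show "u \<in> Sol I P" using u by (simp add: Sol_def ins)
      qed
      show "?T ` Sol (insert n I) P = Sol {n} P"
      proof (intro equalityI subsetI)
        fix v assume "v \<in> ?T ` Sol (insert n I) P"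
        then obtain u where u: "u \<in> Sol (insert n I) P" "v = ?T u" by blast
        then show "v \<in> Sol {n} P" using zn by (simp add: Sol_def single ins)
      next
        fix v assume v: "v \<in> Sol {n} P"
        obtain w where w: "\<And>i t. i \<in> I \<Longrightarrow> mat_act I P w i t = - act (P i n) (v n) t"
          "\<And>i t. i \<notin> I \<Longrightarrow> w i t = 0"
          using mat_solve_exists[OF PI I(1), of "\<lambda>i t. - act (P i n) (v n) t"] by metis
        let ?u = "\<lambda>i t. if i = n then v n t else w i t"
        have wu: "mat_act I P ?u i t = mat_act I P w i t" for i t
          by (rule mat_act_cong) (use I(2) in auto)
        have "?u \<in> Sol (insert n I) P" using v w zn by (auto simp: Sol_def ins wu single)
        moreover have "v = ?T ?u" using v by (auto simp: Sol_def intro!: ext)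
        ultimately show "v \<in> ?T ` Sol (insert n I) P" by - (rule image_eqI[where x = ?u])
      qed
    qed (auto simp: fam_shift_def intro!: ext)
  qed
qed

text \<open>The top coefficient of the product is 1 times that of \<open>q\<close>, so it survives
  even in the presence of zero divisors.\<close>

lemma lead_coeff_monic_mult:
  fixes p q :: "'r::comm_ring_1 poly"
  assumes "lead_coeff p = 1"
  shows "lead_coeff (p * q) = lead_coeff q"
proof (cases "q = 0")
  case False
  have c: "coeff (p * q) (degree p + degree q) = lead_coeff q"
    by (simp add: coeff_mult_degree_sum assms)
  then have "degree (p * q) = degree p + degree q"
    using False by (intro antisym degree_mult_le le_degree) auto
  with c show ?thesis by simp
qed simp

lemma scalar_frag_mult:
  assumes p: "lead_coeff p = 1" and q: "lead_coeff q = 1"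
  shows "scalar_frag (p * q) - scalar_frag p - scalar_frag q \<in> null_frags"
proof -
  show ?thesis
    using space_frag_prod(2)[OF monic_mat_scalar[OF p, of 0] monic_mat_scalar[OF q, of 0]]
    by (simp add: scalar_frag_def algebra_simps)
qed

section \<open>Solution spaces and determinants\<close>

abbreviation pmat :: "nat \<Rightarrow> (nat \<Rightarrow> nat \<Rightarrow> 'r poly) \<Rightarrow> 'r::comm_ring_1 poly mat" where
  "pmat n P \<equiv> mat n n (\<lambda>(i, j). P i j)"

text \<open>Monicity of the determinant is carried along because \<open>scalar_frag\<close> is
  multiplicative on monic polynomials.\<close>

definition det_class :: "nat \<Rightarrow> (nat \<Rightarrow> nat \<Rightarrow> 'r::comm_ring_1 poly) \<Rightarrow> bool" where
  "det_class n P \<longleftrightarrow> lead_coeff (det (pmat n P)) = 1 \<and>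
     space_frag (Sol {..<n} P) - scalar_frag (det (pmat n P)) \<in> null_frags"

lemma det_pmat_triangular:
  fixes P :: "nat \<Rightarrow> nat \<Rightarrow> 'r::comm_ring_1 poly"
  assumes z: "(\<forall>i\<in>{..<n}. P i n = 0) \<or> (\<forall>j\<in>{..<n}. P n j = 0)"
  shows "det (pmat (Suc n) P) = det (pmat n P) * P n n"
proof -
  let ?D = "mat 1 1 (\<lambda>_. P n n)"
  have D: "det ?D = P n n" by (subst det_single) auto
  from z show ?thesis
  proof
    assume z: "\<forall>i\<in>{..<n}. P i n = 0"
    have "pmat (Suc n) P = four_block_mat (pmat n P) (0\<^sub>m n 1) (mat 1 n (\<lambda>(_, j). P n j)) ?D"
      by (rule eq_matI) (use z in \<open>auto simp: less_Suc_eq\<close>)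
    also have "det \<dots> = det (pmat n P) * det ?D"
      by (rule det_four_block_mat_upper_right_zero_col) auto
    finally show ?thesis by (simp only: D)
  next
    assume z: "\<forall>j\<in>{..<n}. P n j = 0"
    have "pmat (Suc n) P = four_block_mat (pmat n P) (mat n 1 (\<lambda>(i, _). P i n)) (0\<^sub>m 1 n) ?D"
      by (rule eq_matI) (use z in \<open>auto simp: less_Suc_eq\<close>)
    also have "det \<dots> = det (pmat n P) * det ?D"
      by (rule det_four_block_upper) auto
    finally show ?thesis by (simp only: D)
  qed
qed

text \<open>Both sides grow in parallel: the space by the solutions of \<open>P n n\<close>, the
  determinant by the factor \<open>P n n\<close>.\<close>

lemma det_class_triangular:
  fixes P :: "nat \<Rightarrow> nat \<Rightarrow> 'r::comm_ring_1 poly"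
  assumes P: "monic_mat {..<Suc n} k P" and g: "det_class n P"
    and z: "(\<forall>i\<in>{..<n}. P i n = 0) \<or> (\<forall>j\<in>{..<n}. P n j = 0)"
  shows "det_class (Suc n) P"
proof -
  let ?d = "det (pmat n P)" and ?p = "P n n"
  have p: "lead_coeff ?p = 1" by (rule monic_mat_lead_coeff[OF P]) simp
  have d: "lead_coeff ?d = 1" and g: "space_frag (Sol {..<n} P) - scalar_frag ?d \<in> null_frags"
    using g by (auto simp: det_class_def)
  have "space_frag (Sol {..<Suc n} P) - space_frag (Sol {..<n} P) - space_frag (Sol {n} P) \<in> null_frags"
    unfolding lessThan_Suc by (rule space_frag_triangular[OF P[unfolded lessThan_Suc] _ _ z]) auto
  from null_frags_closed(3)[OF null_frags_closed(2)[OF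
      null_frags_closed(3)[OF this null_frags_closed(3)[OF g space_frag_singleton[of P n, OF p]]]
      scalar_frag_mult[OF d p]] null_frags_closed(1)]
  have "space_frag (Sol {..<Suc n} P) - scalar_frag (?d * ?p) \<in> null_frags"
    by (simp add: algebra_simps)
  then show ?thesis
    unfolding det_class_def det_pmat_triangular[of n P, OF z] using lead_coeff_monic_mult[OF d] p by simp
qed

text \<open>The empty determinant is 1, and the scalar recurrence for the polynomial 1 has only the
  zero solution.\<close>

lemma det_class_0: "det_class 0 P"
proof -
  have "Sol {} P = Sol {0} (\<lambda>_ _. 1)"
  proof (intro equalityI subsetI)
    fix u :: "'a fam" assume "u \<in> Sol {0} (\<lambda>_ _. 1)"
    then have "u i t = 0" for i t by (cases "i = 0") (simp_all add: Sol_def mat_act_def act_def)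
    then show "u \<in> Sol {} P" by (simp add: Sol_def)
  qed (simp add: Sol_def mat_act_def act_def)
  then show ?thesis by (simp add: det_class_def scalar_frag_def null_frags_closed)
qed

lemma det_class_diag:
  assumes "lead_coeff p = 1"
  shows "det_class n (\<lambda>i j. if i = j then p else 0)"
proof (induction n)
  case (Suc n)
  have "monic_mat {..<Suc n} (degree p) (\<lambda>i j. if i = j then p else 0)"
    using assms by (auto simp: monic_mat_def coeff_eq_0)
  then show ?case by (rule det_class_triangular[OF _ Suc]) auto
qed (rule det_class_0)

lemma det_class_cong:
  assumes "\<And>i j. i < n \<Longrightarrow> j < n \<Longrightarrow> P i j = Q i j"
  shows "det_class n P = det_class n Q"
proof -
  have "pmat n P = pmat n Q" by (rule eq_matI) (use assms in auto)
  moreover have "Sol {..<n} P = Sol {..<n} Q"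
  proof -
    have "mat_act {..<n} P u i t = mat_act {..<n} Q u i t" if "i < n" for u i t
      unfolding mat_act_def using that assms by (intro sum.cong) auto
    then show ?thesis by (auto simp: Sol_def)
  qed
  ultimately show ?thesis by (simp add: det_class_def)
qed

text \<open>Gaussian elimination: with \<open>p = P n n\<close>, left multiplication by \<open>[[p, -c], [0, p]]\<close>, where \<open>c\<close> is
  the last column of \<open>P\<close>, clears that column above the diagonal. No division by \<open>p\<close> is needed since the
  class of the triangular factor is known and can be subtracted.\<close>

lemma det_class_monic:
  fixes P :: "nat \<Rightarrow> nat \<Rightarrow> 'r::comm_ring_1 poly"
  assumes "monic_mat {..<n} k P"
  shows "det_class n P"
  using assms
proof (induction n arbitrary: k P)
  case (Suc n)
  let ?p = "P n n" and ?I = "{..<Suc n}"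
  define E where "E = (\<lambda>i j. if i = j then ?p else if j = n then - P i n else 0)"
  define EP where "EP = (\<lambda>i j. \<Sum>h\<in>?I. E i h * P h j)"
  have P: "monic_mat ?I k P" by fact
  have p: "lead_coeff ?p = 1" by (rule monic_mat_lead_coeff[OF P]) simp
  \<comment> \<open>The off-diagonal entries of \<open>P\<close> have degree below \<open>k\<close>,
    so \<open>E\<close> is monic of the same degree \<open>k\<close>.\<close>
  have E: "monic_mat ?I k E"
    using P by (auto simp: monic_mat_def E_def)
  have "det_class n E"
    using det_class_diag[OF p, of n] by (subst det_class_cong[of n E "\<lambda>i j. if i = j then ?p else 0"]) (auto simp: E_def)
  then have gE: "det_class (Suc n) E"
    by (rule det_class_triangular[OF E]) (auto simp: E_def)
  note prod = space_frag_prod[OF E P finite_lessThan, folded EP_def]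
  \<comment> \<open>\<open>EP\<close> is monic of degree k + k, which is why the induction runs over
    arbitrary \<open>k\<close>.\<close>
  have "det_class n EP" by (rule Suc.IH[OF monic_mat_subset[OF prod(1)]]) auto
  \<comment> \<open>With \<open>p = P n n\<close> the entry is p times \<open>P i n\<close> minus
    \<open>P i n\<close> times p.\<close>
  moreover have "EP i n = 0" if "i < n" for i
  proof -
    have "(\<Sum>h<n. E i h * P h n) = (\<Sum>h<n. if i = h then ?p * P h n else 0)"
      by (rule sum.cong) (auto simp: E_def)
    then show ?thesis using that by (simp add: EP_def) (simp add: E_def)
  qed
  ultimately have gEP: "det_class (Suc n) EP"
    by (intro det_class_triangular[OF prod(1)]) auto
  have "pmat (Suc n) EP = pmat (Suc n) E * pmat (Suc n) P"
    by (rule eq_matI) (auto simp: EP_def scalar_prod_def lessThan_atLeast0 simp del: sum.lessThan_Suc sum.op_ivl_Suc)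
  then have det: "det (pmat (Suc n) EP) = det (pmat (Suc n) E) * det (pmat (Suc n) P)"
    by (simp only:) (rule det_mult[of _ "Suc n"], auto)
  let ?e = "det (pmat (Suc n) E)" and ?d = "det (pmat (Suc n) P)"
  have e: "lead_coeff ?e = 1" "space_frag (Sol ?I E) - scalar_frag ?e \<in> null_frags"
    using gE by (auto simp: det_class_def)
  have ep: "lead_coeff (?e * ?d) = 1" "space_frag (Sol ?I EP) - scalar_frag (?e * ?d) \<in> null_frags"
    using gEP unfolding det_class_def det by auto
  have d: "lead_coeff ?d = 1" using ep(1) lead_coeff_monic_mult[OF e(1), of ?d] by simp
  \<comment> \<open>Modulo \<open>null_frags\<close>, [EP] = [E] + [P], while the determinants give
    [EP] = [e] + [d] and [E] = [e]; subtracting leaves [P] = [d].\<close>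
  from null_frags_closed(2)[OF null_frags_closed(2)[OF
      null_frags_closed(3)[OF ep(2) scalar_frag_mult[OF e(1) d]] prod(2)] e(2)]
  have "space_frag (Sol ?I P) - scalar_frag ?d \<in> null_frags" by (simp add: algebra_simps)
  with d show ?case by (simp add: det_class_def)
qed (rule det_class_0)

section \<open>Characteristic polynomials\<close>

definition char_entry :: "'r::comm_ring_1 mat \<Rightarrow> nat \<Rightarrow> nat \<Rightarrow> 'r poly" where
  "char_entry A i j = [:- A $$ (i, j), if i = j then 1 else 0:]"

lemma monic_char_entry: "monic_mat I 1 (char_entry A)"
  by (auto simp: monic_mat_def char_entry_def coeff_pCons split: nat.splits)

text \<open>The system for x - A says that the shift of u is A u. A solution is thus determined by
  its values at time 0, on which the shift acts as A.\<close>

lemma realizes_char_entry: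
  fixes A :: "'r::comm_ring_1 mat"
  assumes A: "A \<in> carrier_mat m m"
  shows "realizes (Sol {..<m} (char_entry A)) A"
proof -
  let ?V = "Sol {..<m} (char_entry A)" and ?c = "\<lambda>u :: 'r fam. vec m (\<lambda>i. u i 0)"
  have "bij_betw (\<lambda>i. (i, 0)) {..<m} ({..<m} \<times> {..<1 :: nat})"
    by (auto simp: bij_betw_def inj_on_def)
  from Sol_coords[OF monic_char_entry finite_lessThan this]
  have "bij_betw ?c ?V (carrier_vec (dim_row A))" using A by simp
  moreover have "?c (fam_shift u) = A *\<^sub>v ?c u" if u: "u \<in> ?V" for u
  proof (rule eq_vecI)
    fix i assume "i < dim_vec (A *\<^sub>v ?c u)"
    then have i: "i < m" using A by simp
    have "0 = mat_act {..<m} (char_entry A) u i 0" using u i by (simp add: Sol_def)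
    also have "\<dots> = (\<Sum>j<m. (if i = j then u j 1 else 0) - A $$ (i, j) * u j 0)"
      by (simp add: mat_act_def char_entry_def act_pCons) (rule sum.cong, auto)
    also have "\<dots> = u i 1 - (\<Sum>j<m. A $$ (i, j) * u j 0)" using i by (simp add: sum_subtractf)
    finally show "?c (fam_shift u) $ i = (A *\<^sub>v ?c u) $ i"
      using A i by (simp add: fam_shift_def scalar_prod_def lessThan_atLeast0)
  qed (use A in simp)
  ultimately show ?thesis
    unfolding realizes_def using A by (intro conjI exI[of _ ?c]) (auto intro: Sol_closed intro!: eq_vecI)
qed

text \<open>Substituting x = 1/t and multiplying by t takes each factor d x - a to d - a t.
  Coefficients are reversed with respect to the formal degree |S|, also when some d vanish; the
  second clause records that nothing lies above it.\<close>

lemma prod_reverse: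
  fixes a d :: "'b \<Rightarrow> 'r::comm_ring_1"
  assumes "finite S"
  defines "F \<equiv> \<Prod>i\<in>S. fps_const (d i) - fps_X * fps_const (a i)" and "G \<equiv> \<Prod>i\<in>S. [:- a i, d i:]"
  shows "\<forall>j. (j \<le> card S \<longrightarrow> fps_nth F j = coeff G (card S - j)) \<and>
             (card S < j \<longrightarrow> fps_nth F j = 0 \<and> coeff G j = 0)"
  unfolding F_def G_def using assms(1)
proof (induction S)
  case (insert x S)
  let ?F = "\<Prod>i\<in>S. fps_const (d i) - fps_X * fps_const (a i)" and ?G = "\<Prod>i\<in>S. [:- a i, d i:]"
  have F: "fps_nth (\<Prod>i\<in>insert x S. fps_const (d i) - fps_X * fps_const (a i)) j
      = d x * fps_nth ?F j - (if j = 0 then 0 else a x * fps_nth ?F (j - 1))" for j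
    using insert(1,2) by (simp add: left_diff_distrib mult.assoc)
  have G: "coeff (\<Prod>i\<in>insert x S. [:- a i, d i:]) j
      = - a x * coeff ?G j + (if j = 0 then 0 else d x * coeff ?G (j - 1))" for j
    using insert(1,2) by (cases j) (simp_all add: algebra_simps)
  have c: "card (insert x S) = Suc (card S)" using insert(1,2) by simp
  have IH: "j \<le> card S \<Longrightarrow> fps_nth ?F j = coeff ?G (card S - j)" "card S < j \<Longrightarrow> fps_nth ?F j = 0"
    "card S < j \<Longrightarrow> coeff ?G j = 0" for j
    using spec[OF insert(3), of j] by auto
  have "fps_nth (\<Prod>i\<in>insert x S. fps_const (d i) - fps_X * fps_const (a i)) j
               = coeff (\<Prod>i\<in>insert x S. [:- a i, d i:]) (card (insert x S) - j)"
    if j: "j \<le> card (insert x S)" for j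
  proof -
    consider "j = 0" | "j = Suc (card S)" | "0 < j" "j \<le> card S" using j c by force
    then show ?thesis
    proof cases
      case 3
      then obtain l where l: "j = Suc l" "l < card S" by (cases j) auto
      then have "card S - l \<noteq> 0" "card S - l - 1 = card S - Suc l" by auto
      then show ?thesis unfolding F G c l(1) using IH(1)[of "Suc l"] IH(1)[of l] l(2) by simp
    next
      case 1
      then show ?thesis unfolding F G c using IH(1)[of 0] IH(3)[of "Suc (card S)"] by simp
    next
      case 2
      then show ?thesis unfolding F G c using IH(1)[of "card S"] IH(2)[of "Suc (card S)"] by simp
    qed
  qed
  moreover have "fps_nth (\<Prod>i\<in>insert x S. fps_const (d i) - fps_X * fps_const (a i)) j = 0 \<and>
      coeff (\<Prod>i\<in>insert x S. [:- a i, d i:]) j = 0" if "card (insert x S) < j" for j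
  proof -
    have "card S < j - 1" "card S < j" "0 < j" using that c by auto
    then show ?thesis unfolding F G using IH(2,3)[of j] IH(2,3)[of "j - 1"] by simp
  qed
  ultimately show ?case by (intro allI conjI impI) auto
qed auto

text \<open>Both determinants are expanded over permutations. Each term is a product of m factors as
  in \<open>prod_reverse\<close>, with d = 1 exactly at the fixed points of the permutation.\<close>

lemma rev_char_coeff:
  fixes A :: "'r::comm_ring_1 mat"
  assumes A: "A \<in> carrier_mat m m"
  shows "j \<le> m \<Longrightarrow> fps_nth (rev_char A) j = coeff (det (pmat m (char_entry A))) (m - j)"
    and "m < j \<Longrightarrow> coeff (det (pmat m (char_entry A))) j = 0"
proof -
  let ?d = "\<lambda>\<pi> i. if i = \<pi> i then 1 else (0 :: 'r)"
  let ?F = "\<lambda>\<pi>. \<Prod>i\<in>{0..<m}. fps_const (?d \<pi> i) - fps_X * fps_const (A $$ (i, \<pi> i))"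
  let ?G = "\<lambda>\<pi>. \<Prod>i\<in>{0..<m}. [:- A $$ (i, \<pi> i), ?d \<pi> i:]"
  let ?S = "{\<pi>. \<pi> permutes {0..<m}}"
  have pl: "\<pi> i < m" if "\<pi> permutes {0..<m}" "i < m" for \<pi> i
    using permutes_in_image[OF that(1), of i] that(2) by simp
  have "det (1\<^sub>m m - fps_X \<cdot>\<^sub>m map_mat fps_const A) = (\<Sum>\<pi>\<in>?S. signof \<pi> * ?F \<pi>)"
    by (subst det_def'[of _ m])
       (use A in \<open>auto intro!: sum.cong arg_cong2[where f = "(*)"] prod.cong simp: pl\<close>)
  then have F: "rev_char A = (\<Sum>\<pi>\<in>?S. signof \<pi> * ?F \<pi>)" using A by (simp add: rev_char_def)
  have G: "det (pmat m (char_entry A)) = (\<Sum>\<pi>\<in>?S. signof \<pi> * ?G \<pi>)"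
    by (subst det_def'[of _ m])
       (use A in \<open>auto intro!: sum.cong arg_cong2[where f = "(*)"] prod.cong simp: pl char_entry_def\<close>)
  have R: "(j \<le> m \<longrightarrow> fps_nth (?F \<pi>) j = coeff (?G \<pi>) (m - j)) \<and> (m < j \<longrightarrow> coeff (?G \<pi>) j = 0)" for \<pi> j
    using prod_reverse[of "{0..<m}" "?d \<pi>" "\<lambda>i. A $$ (i, \<pi> i)"] by simp
  have sF: "fps_nth (signof \<pi> * f) j = signof \<pi> * fps_nth f j" for \<pi> :: "nat \<Rightarrow> nat" and f :: "'r fps" and j
    by (simp add: sign_def)
  have sG: "coeff (signof \<pi> * f) j = signof \<pi> * coeff f j" for \<pi> :: "nat \<Rightarrow> nat" and f :: "'r poly" and j
    by (simp add: sign_def)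
  show "fps_nth (rev_char A) j = coeff (det (pmat m (char_entry A))) (m - j)" if "j \<le> m"
    unfolding F G fps_sum_nth coeff_sum sF sG using R that by (intro sum.cong) auto
  show "coeff (det (pmat m (char_entry A))) j = 0" if "m < j"
    unfolding G coeff_sum sG using R that by (intro sum.neutral) auto
qed

text \<open>For matrices of equal size the reversal can be undone, so the characteristic polynomials
  agree, and by \<open>det_class_monic\<close> they determine the classes.\<close>

lemma mat_endo_rev_char:
  fixes A B :: "'r::comm_ring_1 mat"
  assumes A: "A \<in> carrier_mat m m" and B: "B \<in> carrier_mat m m" and eq: "rev_char A = rev_char B"
  shows "frag_of (mat_endo A) - frag_of (mat_endo B) \<in> null_frags"
proof -
  have "det (pmat m (char_entry A)) = det (pmat m (char_entry B))"
  proof (rule poly_eqI)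
    fix j
    show "coeff (det (pmat m (char_entry A))) j = coeff (det (pmat m (char_entry B))) j"
      using rev_char_coeff(1)[OF A, of "m - j"] rev_char_coeff(1)[OF B, of "m - j"] eq
        rev_char_coeff(2)[OF A, of j] rev_char_coeff(2)[OF B, of j]
      by (cases "j \<le> m") auto
  qed
  moreover have h: "frag_of (mat_endo C) - scalar_frag (det (pmat m (char_entry C))) \<in> null_frags"
    if "C \<in> carrier_mat m m" for C :: "'r mat"
    using null_frags_closed(3)[OF space_frag_realizes[OF realizes_char_entry[OF that]],
        of "space_frag (Sol {..<m} (char_entry C)) - scalar_frag (det (pmat m (char_entry C)))"]
      det_class_monic[OF monic_char_entry, of m C]
    by (simp add: det_class_def)
  ultimately show ?thesis using null_frags_closed(2)[OF h[OF A] h[OF B]] by simp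
qed

section \<open>Injectivity of \<open>L\<^sub>R\<close>\<close>

text \<open>The maps are the inclusion of the first and the projection to the second summand with
  their standard splittings; empty blocks bring these rectangular matrices into four-block
  form.\<close>

lemma mat_endo_block_sum:
  fixes A D :: "'r::comm_ring_1 mat"
  assumes A: "A \<in> carrier_mat n n" and D: "D \<in> carrier_mat m m"
  shows "frag_of (mat_endo (four_block_mat A (0\<^sub>m n m) (0\<^sub>m m n) D))
         - frag_of (mat_endo A) - frag_of (mat_endo D) \<in> null_frags"
proof -
  let ?M = "four_block_mat A (0\<^sub>m n m) (0\<^sub>m m n) D"
  let ?I = "four_block_mat (1\<^sub>m n :: 'r mat) (0\<^sub>m n 0) (0\<^sub>m m n) (0\<^sub>m m 0)"
  let ?J = "four_block_mat (1\<^sub>m n :: 'r mat) (0\<^sub>m n m) (0\<^sub>m 0 n) (0\<^sub>m 0 m)"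
  let ?S = "four_block_mat (0\<^sub>m n 0 :: 'r mat) (0\<^sub>m n m) (0\<^sub>m m 0) (1\<^sub>m m)"
  let ?P = "four_block_mat (0\<^sub>m 0 n :: 'r mat) (0\<^sub>m 0 m) (0\<^sub>m m n) (1\<^sub>m m)"
  have c: "?I \<in> carrier_mat (n + m) n" "?J \<in> carrier_mat n (n + m)" "?S \<in> carrier_mat (n + m) m"
    "?P \<in> carrier_mat m (n + m)" "?M \<in> carrier_mat (n + m) (n + m)"
    using A D by (auto intro!: carrier_matI)
  have z: "four_block_mat X (0\<^sub>m r 0) (0\<^sub>m 0 k) (0\<^sub>m 0 0) = X" if "X \<in> carrier_mat r k" for X :: "'r mat" and r k
    by (rule eq_matI) (use that in auto)
  have z': "four_block_mat (0\<^sub>m 0 0) (0\<^sub>m 0 k) (0\<^sub>m r 0) X = X" if "X \<in> carrier_mat r k" for X :: "'r mat" and r k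
    by (rule eq_matI) (use that in auto)
  have "?J * ?I = four_block_mat (1\<^sub>m n) (0\<^sub>m n 0) (0\<^sub>m 0 n) (0\<^sub>m 0 0)"
    by (subst mult_four_block_mat[of _ n n _ m _ 0 _ _ n _ 0]) simp_all
  then have "?J * ?I = 1\<^sub>m n" by (simp only: z[OF one_carrier_mat])
  moreover have "?P * ?S = four_block_mat (0\<^sub>m 0 0) (0\<^sub>m 0 m) (0\<^sub>m m 0) (1\<^sub>m m)"
    by (subst mult_four_block_mat[of _ 0 n _ m _ m _ _ 0 _ m]) simp_all
  then have "?P * ?S = 1\<^sub>m m" by (simp only: z'[OF one_carrier_mat])
  moreover have "?P * ?I = 0\<^sub>m m n"
  proof -
    have "?P * ?I = four_block_mat (0\<^sub>m 0 n) (0\<^sub>m 0 0) (0\<^sub>m m n) (0\<^sub>m m 0)"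
      by (subst mult_four_block_mat[of _ 0 n _ m _ m _ _ n _ 0]) simp_all
    also have "\<dots> = 0\<^sub>m m n" by (rule eq_matI) auto
    finally show ?thesis .
  qed
  moreover have "?I * ?J + ?S * ?P = 1\<^sub>m (n + m)"
  proof -
    have IJ: "?I * ?J = four_block_mat (1\<^sub>m n) (0\<^sub>m n m) (0\<^sub>m m n) (0\<^sub>m m m)"
      by (subst mult_four_block_mat[of _ n n _ 0 _ m _ _ n _ m]) simp_all
    have SP: "?S * ?P = four_block_mat (0\<^sub>m n n) (0\<^sub>m n m) (0\<^sub>m m n) (1\<^sub>m m)"
      by (subst mult_four_block_mat[of _ n 0 _ m _ m _ _ n _ m]) simp_all
    show ?thesis unfolding IJ SP by (rule eq_matI) auto
  qed
  moreover have "?M * ?I = ?I * A"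
  proof -
    have "?M * ?I = four_block_mat A (0\<^sub>m n 0) (0\<^sub>m m n) (0\<^sub>m m 0)"
      by (subst mult_four_block_mat[of _ n n _ m _ m _ _ n _ 0]) (use A D in auto)
    moreover have "?I * four_block_mat A (0\<^sub>m n 0) (0\<^sub>m 0 n) (0\<^sub>m 0 0) = four_block_mat A (0\<^sub>m n 0) (0\<^sub>m m n) (0\<^sub>m m 0)"
      by (subst mult_four_block_mat[of _ n n _ 0 _ m _ _ n _ 0]) (use A in auto)
    ultimately show ?thesis by (simp only: z[OF A])
  qed
  moreover have "?P * ?M = D * ?P"
  proof -
    have "?P * ?M = four_block_mat (0\<^sub>m 0 n) (0\<^sub>m 0 m) (0\<^sub>m m n) D"
      by (subst mult_four_block_mat[of _ 0 n _ m _ m _ _ n _ m]) (use A D in auto)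
    moreover have "four_block_mat (0\<^sub>m 0 0) (0\<^sub>m 0 m) (0\<^sub>m m 0) D * ?P = four_block_mat (0\<^sub>m 0 n) (0\<^sub>m 0 m) (0\<^sub>m m n) D"
      by (subst mult_four_block_mat[of _ 0 0 _ m _ m _ _ n _ m]) (use D in auto)
    ultimately show ?thesis by (simp only: z'[OF D])
  qed
  moreover have "?I * 1\<^sub>m n = ?I" by (rule right_mult_one_mat[OF c(1)])
  moreover have "1\<^sub>m m * ?P = ?P" by (rule left_mult_one_mat[OF c(4)])
  ultimately have "matrix_exact (1\<^sub>m n) A (1\<^sub>m (n + m)) ?M (1\<^sub>m m) D ?I ?P ?S ?J"
    unfolding matrix_exact_def index_one_mat by - (intro conjI c)
  from short_exactI[OF endo_rep_mat_endo[OF A] endo_rep_mat_endo[OF c(5)] endo_rep_mat_endo[OF D] this]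
  show ?thesis by (intro null_exactI mat_endo_endos[OF A] mat_endo_endos[OF c(5)] mat_endo_endos[OF D])
qed

text \<open>(R^n, M) is the direct sum of (E, f) and the kernel of \<open>p\<close> with the zero
  endomorphism, which is null. So in W_0(R) projective modules can be replaced by free ones.\<close>

lemma frag_of_mat_endo:
  fixes x :: "'r::comm_ring_1 endo"
  assumes r: "endo_rep x p M"
  shows "frag_of x - frag_of (mat_endo M) \<in> null_frags"
proof -
  obtain n E f where x: "x = (n, E, f)" by (metis prod_cases3)
  note d = endo_repD[OF r[unfolded x]]
  let ?q = "1\<^sub>m n - p" and ?z = "(n, fixed_vecs (1\<^sub>m n - p), \<lambda>v. 0\<^sub>m n n *\<^sub>v v)"
  have q: "?q \<in> carrier_mat n n" using d(1) by auto
  have pp: "?q * p = 0\<^sub>m n n" "p * ?q = 0\<^sub>m n n" "?q * ?q = ?q" "?q * M = 0\<^sub>m n n" "M * ?q = 0\<^sub>m n n"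
    using d(1-5) q
    by (simp_all add: minus_mult_distrib_mat[of _ n n _ _ n] mult_minus_distrib_mat[of _ n n _ n])
      (auto intro!: eq_matI)
  have rz: "endo_rep ?z ?q (0\<^sub>m n n)" by (rule endo_rep_fixed_vecs) (use q pp in \<open>auto simp: left_mult_zero_mat right_mult_zero_mat\<close>)
  have rM: "endo_rep (mat_endo M) (1\<^sub>m n) M" by (rule endo_rep_mat_endo[OF d(2)])
  have "p + ?q = 1\<^sub>m n" using d(1) by (auto intro!: eq_matI)
  then have "matrix_exact p M (1\<^sub>m n) M ?q (0\<^sub>m n n) p ?q ?q p"
    using d(1-5) q pp by (simp add: matrix_exact_def)
  from short_exactI[OF r rM rz this]
  have 1: "frag_of (mat_endo M) - frag_of x - frag_of ?z \<in> null_frags"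
    by (intro null_exactI endo_rep_imp_endos[OF r] endo_rep_imp_endos[OF rM] endo_rep_imp_endos[OF rz])
  have 2: "frag_of ?z \<in> null_frags"
    unfolding null_frags_def by (intro group_closure.base insertI2 UnI2 zero_gens_rep[OF rz])
  from null_frags_closed(4)[OF null_frags_closed(3)[OF 1 2]] show ?thesis by simp
qed

text \<open>In the induction step (A1 - B1) - (A2 - B2) is collected into the block sum of A1 and B2
  minus that of B1 and A2.\<close>

lemma frag_difference_of_matrices:
  fixes c :: "'r::comm_ring_1 endo \<Rightarrow>\<^sub>0 int"
  assumes "c \<in> carrier free_endos"
  shows "\<exists>n A m B. A \<in> carrier_mat n n \<and> B \<in> carrier_mat m m \<and>
           c - (frag_of (mat_endo A) - frag_of (mat_endo B)) \<in> null_frags"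
  using assms
proof (induction c rule: free_endos_induct)
  case zero
  show ?case
    by (rule exI[of _ 0], rule exI[of _ "0\<^sub>m 0 0"], rule exI[of _ 0], rule exI[of _ "0\<^sub>m 0 0"])
       (simp add: null_frags_closed)
next
  case (one x)
  then obtain p M where r: "endo_rep x p M" by (meson endo_rep_endos_ex)
  obtain n E f where x: "x = (n, E, f)" by (metis prod_cases3)
  have M: "M \<in> carrier_mat n n" using endo_repD(2)[OF r[unfolded x]] .
  have "frag_of x - frag_of (mat_endo M) + frag_of (mat_endo (0\<^sub>m 0 0)) \<in> null_frags"
    by (intro null_frags_closed frag_of_mat_endo[OF r] mat_endo_zero_null)
  then show ?case using M
    by (intro exI[of _ n] exI[of _ M] exI[of _ 0] exI[of _ "0\<^sub>m 0 0"]) (simp add: algebra_simps)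
next
  case (diff a b)
  obtain n1 A1 m1 B1 where 1: "A1 \<in> carrier_mat n1 n1" "B1 \<in> carrier_mat m1 m1"
    "a - (frag_of (mat_endo A1) - frag_of (mat_endo B1)) \<in> null_frags" using diff(3) by blast
  obtain n2 A2 m2 B2 where 2: "A2 \<in> carrier_mat n2 n2" "B2 \<in> carrier_mat m2 m2"
    "b - (frag_of (mat_endo A2) - frag_of (mat_endo B2)) \<in> null_frags" using diff(4) by blast
  let ?A = "four_block_mat A1 (0\<^sub>m n1 m2) (0\<^sub>m m2 n1) B2" and ?B = "four_block_mat B1 (0\<^sub>m m1 n2) (0\<^sub>m n2 m1) A2"
  have "?A \<in> carrier_mat (n1 + m2) (n1 + m2)" "?B \<in> carrier_mat (m1 + n2) (m1 + n2)" using 1 2 by auto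
  moreover from null_frags_closed(2)[OF null_frags_closed(3)[OF null_frags_closed(2)[OF 1(3) 2(3)]
      mat_endo_block_sum[OF 1(2) 2(1)]] mat_endo_block_sum[OF 1(1) 2(2)]]
  have "a - b - (frag_of (mat_endo ?A) - frag_of (mat_endo ?B)) \<in> null_frags" by (simp add: algebra_simps)
  ultimately show ?case by blast
qed

lemma free_char_mat_endo: "A \<in> carrier_mat n n \<Longrightarrow> free_char (frag_of (mat_endo A)) = fps_inv1 (rev_char A)"
  by (simp add: free_char_of endo_char_rep[OF endo_rep_mat_endo])

text \<open>Equality of det(1 - tA) and det(1 - tB) leaves the sizes of A and B open. Zero blocks
  bring both to size n + m without changing the determinants or the classes in W_0(R).\<close>

theorem free_char_eq_1_imp_null:
  fixes c :: "'r::comm_ring_1 endo \<Rightarrow>\<^sub>0 int"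
  assumes c: "c \<in> carrier free_endos" and 1: "free_char c = 1"
  shows "c \<in> null_frags"
proof -
  obtain n A m B where A: "A \<in> carrier_mat n n" and B: "B \<in> carrier_mat m m"
    and cAB: "c - (frag_of (mat_endo A) - frag_of (mat_endo B)) \<in> null_frags"
    using frag_difference_of_matrices[OF c] by blast
  have "free_char c = free_char (frag_of (mat_endo A) - frag_of (mat_endo B))"
    using free_char_null[OF cAB] free_char_add[of "c - (frag_of (mat_endo A) - frag_of (mat_endo B))" "frag_of (mat_endo A) - frag_of (mat_endo B)"]
    by simp
  then have "fps_inv1 (rev_char A) * rev_char B = 1"
    using 1 A B by (simp add: free_char_diff free_char_mat_endo fps_inv1_inv1 rev_char_nth_0)
  then have "rev_char B = rev_char A"
    using fps_inv1_unique[of "fps_inv1 (rev_char A)" "rev_char B"] fps_inv1_inv1[OF rev_char_nth_0[OF A]] by simp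
  moreover let ?A = "four_block_mat A (0\<^sub>m n m) (0\<^sub>m m n) (0\<^sub>m m m)"
    and ?B = "four_block_mat (0\<^sub>m n n) (0\<^sub>m n m) (0\<^sub>m m n) B"
  have "rev_char ?A = rev_char A" "rev_char ?B = rev_char B"
    using A B by (simp_all add: rev_char_four_block[of _ n _ m] rev_char_zero)
  ultimately have "rev_char ?A = rev_char ?B" by simp
  moreover have "?A \<in> carrier_mat (n + m) (n + m)" "?B \<in> carrier_mat (n + m) (n + m)" using A B by auto
  ultimately have AB: "frag_of (mat_endo ?A) - frag_of (mat_endo ?B) \<in> null_frags"
    by (intro mat_endo_rev_char)
  from null_frags_closed(2)[OF null_frags_closed(2)[OF null_frags_closed(3)[OF AB
      mat_endo_block_sum[OF zero_carrier_mat B, of n]] mat_endo_block_sum[OF A zero_carrier_mat, of m]]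
      null_frags_closed(2)[OF mat_endo_zero_null[of m] mat_endo_zero_null[of n]]]
  have "frag_of (mat_endo A) - frag_of (mat_endo B) \<in> null_frags" by (simp add: algebra_simps)
  from null_frags_closed(3)[OF cAB this] show ?thesis by simp
qed

section \<open>Rationality\<close>

text \<open>The powers of L generate Z[L] as an additive group.\<close>

lemma int_poly_induct [case_names zero power diff]:
  fixes a :: "int poly"
  assumes zero: "P 0" and power: "\<And>i. P (lefschetz ^ i)" and diff: "\<And>a b. P a \<Longrightarrow> P b \<Longrightarrow> P (a - b)"
  shows "P a"
proof -
  have minus: "P (- a)" if "P a" for a using diff[OF zero that] by simp
  have add: "P (a + b)" if "P a" "P b" for a b using diff[OF that(1) minus[OF that(2)]] by simp
  have "P (of_int c * lefschetz ^ i)" for c i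
  proof (induction c rule: int_induct[where k = 0])
    case (step1 c)
    then show ?case using add[OF step1(2) power[of i]] by (simp add: algebra_simps)
  next
    case (step2 c)
    then show ?case using diff[OF step2(2) power[of i]] by (simp add: algebra_simps)
  qed (simp add: zero)
  moreover have "Polynomial.monom c i = of_int c * lefschetz ^ i" for c i
    by (simp add: monom_altdef of_int_poly)
  ultimately have monom: "P (Polynomial.monom c i)" for c i by simp
  have "P (\<Sum>i\<in>S. Polynomial.monom (coeff a i) i)" for S
    by (induction S rule: infinite_finite_induct) (auto intro: zero add monom)
  from this[of "{..degree a}"] show ?thesis by (simp add: poly_as_sum_of_monoms)
qed

section \<open>The morphism r_mu\<close>

definition rank_one :: "'r::comm_ring_1 \<Rightarrow> 'r endo" where
  "rank_one s = mat_endo (mat 1 1 (\<lambda>_. s))"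

lemma endo_rep_rank_one: "endo_rep (rank_one s) (1\<^sub>m 1) (mat 1 1 (\<lambda>_. s))"
  unfolding rank_one_def by (rule endo_rep_mat_endo) simp

lemma endo_char_rank_one: "endo_char (rank_one s) = fps_inv1 (1 - fps_const s * fps_X)"
proof -
  have "rev_char (mat 1 1 (\<lambda>_. s)) = 1 - fps_const s * fps_X"
    unfolding rev_char_def by (subst det_single) (auto simp: mult.commute)
  then show ?thesis using endo_char_rep[OF endo_rep_rank_one, of s] by simp
qed

lemma rank_one_tensor:
  "frag_of (endo_tensor (rank_one s) (rank_one s')) - frag_of (rank_one (s * s')) \<in> exact_rels"
proof -
  have "kron (mat 1 1 (\<lambda>_. s)) (mat 1 1 (\<lambda>_. s')) = mat 1 1 (\<lambda>_. s * s')"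
    by (rule eq_matI) (auto simp: kron_def)
  then have "endo_rep (endo_tensor (rank_one s) (rank_one s')) (1\<^sub>m 1) (mat 1 1 (\<lambda>_. s * s'))"
    using endo_rep_tensor[OF endo_rep_rank_one[of s] endo_rep_rank_one[of s']] by (simp add: kron_one_left[simplified])
  then show ?thesis by (rule frag_of_same_rep[OF endo_rep_rank_one])
qed

text \<open>With s = mu(L), a lift of r_mu to formal combinations. It is strictly additive, but
  multiplicative only modulo \<open>null_frags\<close>.\<close>

definition rank_one_frag :: "'r::comm_ring_1 \<Rightarrow> int poly \<Rightarrow> 'r endo \<Rightarrow>\<^sub>0 int" where
  "rank_one_frag s a = (\<Sum>i\<le>degree a. frag_cmul (coeff a i) (frag_of (rank_one (s ^ i))))"

lemma rank_one_frag_bound: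
  assumes "degree a \<le> D"
  shows "rank_one_frag s a = (\<Sum>i\<le>D. frag_cmul (coeff a i) (frag_of (rank_one (s ^ i))))"
  unfolding rank_one_frag_def using assms
  by (intro sum.mono_neutral_left) (auto simp: coeff_eq_0)

lemma rank_one_frag_diff: "rank_one_frag s (a - b) = rank_one_frag s a - rank_one_frag s b"
proof -
  let ?D = "max (degree a) (degree b)"
  have "degree (a - b) \<le> ?D" by (rule degree_diff_le_max)
  then show ?thesis
    by (simp add: rank_one_frag_bound[of _ ?D] frag_cmul_diff_distrib sum_subtractf)
qed

lemma rank_one_frag_0 [simp]: "rank_one_frag s 0 = 0"
  by (simp add: rank_one_frag_def)

lemma rank_one_frag_add: "rank_one_frag s (a + b) = rank_one_frag s a + rank_one_frag s b"
  using rank_one_frag_diff[of s a "- b"] rank_one_frag_diff[of s 0 b] by simp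

lemma rank_one_frag_power: "rank_one_frag s (lefschetz ^ i) = frag_of (rank_one (s ^ i))"
proof -
  have m: "lefschetz ^ i = Polynomial.monom 1 i" by (simp add: monom_altdef)
  have "rank_one_frag s (lefschetz ^ i) = (\<Sum>k\<le>i. if k = i then frag_of (rank_one (s ^ i)) else 0)"
    unfolding rank_one_frag_def by (rule sum.cong) (auto simp: m degree_monom_eq)
  then show ?thesis by simp
qed

lemma rank_one_frag_carrier: "rank_one_frag s a \<in> carrier free_endos"
proof (induction a rule: int_poly_induct)
  case (power i)
  then show ?case unfolding rank_one_frag_power
    by (intro free_endos_closed endo_rep_imp_endos[OF endo_rep_rank_one])
qed (auto simp: rank_one_frag_diff intro: free_endos_closed)

lemma rank_one_frag_mult:
  "frag_tensor (rank_one_frag s a) (rank_one_frag s b) - rank_one_frag s (a * b) \<in> null_frags"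
proof (induction a rule: int_poly_induct)
  case (power i)
  show ?case
  proof (induction b rule: int_poly_induct)
    case (power j)
    show ?case
      using subsetD[OF exact_rels_null rank_one_tensor[of "s ^ i" "s ^ j"]]
      by (simp only: rank_one_frag_power frag_tensor_of power_add[symmetric])
  next
    case (diff b c)
    from null_frags_closed(2)[OF diff] show ?case
      by (simp add: rank_one_frag_diff frag_tensor_right right_diff_distrib algebra_simps)
  qed (simp add: frag_tensor_0 null_frags_closed)
next
  case (diff a c)
  from null_frags_closed(2)[OF diff] show ?case
    by (simp add: rank_one_frag_diff frag_tensor_left left_diff_distrib algebra_simps)
qed (simp add: frag_tensor_0 null_frags_closed)

lemma zeta_lefschetz_power:
  fixes \<mu> :: "int poly \<Rightarrow> 'r::comm_ring_1"
  assumes "comm_ring_hom \<mu>"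
  shows "zeta \<mu> (lefschetz ^ i) = fps_inv1 (1 - fps_const (\<mu> lefschetz ^ i) * fps_X)"
proof -
  interpret comm_ring_hom \<mu> by fact
  have g: "fps_inv1 (1 - fps_const c * fps_X) = Abs_fps (\<lambda>n. c ^ n)" for c :: "'b::comm_ring_1"
    using fps_inv1_geometric_power[of 1 c] by simp
  show ?thesis
    unfolding zeta_def kapranov_zeta_lefschetz_power by (simp add: g fps_eq_iff hom_power)
qed

lemma zeta_eq_free_char:
  fixes \<mu> :: "int poly \<Rightarrow> 'r::comm_ring_1"
  assumes \<mu>: "comm_ring_hom \<mu>"
  shows "zeta \<mu> a = free_char (rank_one_frag (\<mu> lefschetz) a)"
proof (induction a rule: int_poly_induct)
  case zero
  \<comment> \<open>zeta(0) is idempotent under multiplication of series and invertible, hence equal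
    to 1.\<close>
  have "zeta \<mu> 0 * zeta \<mu> 0 = zeta \<mu> 0" using zeta_add[OF \<mu>, of 0 0] by simp
  moreover have z0: "fps_nth (zeta \<mu> a) 0 = 1" for a
  proof -
    interpret comm_ring_hom \<mu> by fact
    show ?thesis by (simp add: zeta_def kapranov_zeta_nth_0)
  qed
  ultimately have "zeta \<mu> 0 * (zeta \<mu> 0 * fps_inv1 (zeta \<mu> 0)) = zeta \<mu> 0 * fps_inv1 (zeta \<mu> 0)"
    by (simp add: mult.assoc[symmetric])
  then show ?case using fps_inv1_mult[OF z0[of 0]] by (simp add: free_char_0)
next
  case (power i)
  then show ?case
    by (simp add: zeta_lefschetz_power[OF \<mu>] rank_one_frag_power free_char_of endo_char_rank_one)
next
  case (diff a b)
  have z0: "fps_nth (zeta \<mu> b) 0 = 1" unfolding diff(2) by (rule free_char_nth_0)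
  have "zeta \<mu> a = zeta \<mu> (a - b) * zeta \<mu> b" using zeta_add[OF \<mu>, of "a - b" b] by simp
  then have "zeta \<mu> a * fps_inv1 (zeta \<mu> b) = zeta \<mu> (a - b) * (zeta \<mu> b * fps_inv1 (zeta \<mu> b))"
    by (simp add: mult.assoc)
  then show ?case using fps_inv1_mult[OF z0] diff by (simp add: rank_one_frag_diff free_char_diff)
qed

text \<open>Uniqueness is pointwise: each value r a is the class of some c, and
  \<open>free_char c\<close> = zeta(a) forces c to differ from the explicit lift by an element of
  \<open>null_frags\<close>.\<close>

theorem rational_hom:
  fixes \<mu> :: "int poly \<Rightarrow> 'r::comm_ring_1"
  assumes \<mu>: "comm_ring_hom \<mu>"
  shows "rational \<mu>"
  unfolding rational_def
proof (intro conjI exponentiable_hom[OF \<mu>] ex1I)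
  let ?r = "\<lambda>a. W0_class (rank_one_frag (\<mu> lefschetz) a)"
  note c = rank_one_frag_carrier[of "\<mu> lefschetz"]
  have "?r 1 = \<one>\<^bsub>W0\<^esub>"
  proof -
    have "mat 1 1 (\<lambda>_. 1 :: 'r) = 1\<^sub>m 1" by (rule eq_matI) auto
    then have "endo_rep (rank_one (1 :: 'r)) (1\<^sub>m 1) (1\<^sub>m 1)" using endo_rep_rank_one[of "1 :: 'r"] by simp
    from frag_of_same_rep[OF endo_rep_one this] show ?thesis
      using rank_one_frag_power[of "\<mu> lefschetz" 0] exact_rels_null
      by (auto simp: W0_one free_endos_simps intro!: W0_class_cong)
  qed
  moreover have "?r (a * b) = ?r a \<otimes>\<^bsub>W0\<^esub> ?r b" for a b
    unfolding W0_mult[OF c c] by (rule W0_class_cong[OF rank_one_frag_mult, symmetric])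
  moreover have "?r (a + b) = ?r a \<oplus>\<^bsub>W0\<^esub> ?r b" for a b
    unfolding W0_add[OF c c] rank_one_frag_add ..
  ultimately show "?r \<in> ring_hom class_ring W0"
    using c by (simp add: Ring.ring_hom_def W0_carrier)
  show "zeta \<mu> = L_map \<circ> ?r" by (auto simp: L_map_W0_class zeta_eq_free_char[OF \<mu>])
next
  fix r assume r: "r \<in> ring_hom class_ring W0 \<and> zeta \<mu> = L_map \<circ> r"
  show "r = (\<lambda>a. W0_class (rank_one_frag (\<mu> lefschetz) a))"
  proof
    fix a
    let ?\<rho> = "rank_one_frag (\<mu> lefschetz) a"
    have "r a \<in> carrier W0" using r by (auto simp: Ring.ring_hom_def)
    then obtain c where c: "c \<in> carrier free_endos" "r a = W0_class c" by (auto simp: W0_carrier)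
    have "zeta \<mu> a = L_map (r a)" using r by simp
    then have "free_char ?\<rho> = free_char c" using c(2) by (simp add: L_map_W0_class zeta_eq_free_char[OF \<mu>])
    then have "free_char (c - ?\<rho>) = 1" by (simp add: free_char_diff fps_inv1_mult[OF free_char_nth_0])
    then have "c - ?\<rho> \<in> null_frags"
      by (intro free_char_eq_1_imp_null free_endos_closed c(1) rank_one_frag_carrier)
    then show "r a = W0_class ?\<rho>" unfolding c(2) by (rule W0_class_cong)
  qed
qed

theorem proposition6:
  fixes \<mu> :: "int poly \<Rightarrow> 'r::comm_ring_1"
  assumes "motivic_measure \<mu>"
  shows "exponentiable \<mu> \<and> rational \<mu>"
  using motivic_measure_hom[OF assms] by (simp add: exponentiable_hom rational_hom)

end
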